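(* The Destructive Shift Bribery problem for the Borda rule is in $\mathrm{P}$ (i.e., decidable in polynomial time).
   Context: **Elections.** An election is a pair $E=(C,V)$, where $C=\{c_1,\dots,c_m\}$ is a finite set of candidates and $V=\{v_1,\dots,v_n\}$ is a finite multiset of voters; each voter $v$ has a strict ranking (preference order) of all candidates from best to worst, and $\mathrm{pos}_v(c)\in\{1,\dots,m\}$ is the position of $c$ in $v$'s ranking (1 = best). An election rule $\mathcal{R}$ maps each election $E$ to a set $\mathcal{R}(E)\subseteq C$ of (tied) winners; $c$ is the unique winner if $\mathcal{R}(E)=\{c\}$. **Destructive Shift Bribery for $\mathcal{R}$.** Input: an election $E=(C,V)$ with $m$ candidates and $n$ voters, a despised candidate $d\in C$, a budget $B$ (a nonnegative integer), and for each voter $v_i$ a price function $\rho_i$. Shifting $d$ back by $t$ positions in a vote moves $d$ $t$ places towards the end of the ranking, each passed candidate moving up by one place and all else unchanged. A price function for a voter $v$ with $j=\mathrm{pos}_v(d)$ is $\rho:\mathbb{N}\to\mathbb{N}\cup\{+\infty\}$ with $\rho(0)=0$, $\rho(i)\le\rho(i')$ for $i<i'\le m-j$, and $\rho(i)=+\infty$ for $i>m-j$; $\rho(i)$ is the cost of shifting $d$ back by $i$ positions in $v$'s ranking. Price functions are encoded by listing their values at all arguments where they are finite; numbers are in binary. Question: are there nonnegative integers $t_1,\dots,t_n$ with $\sum_i\rho_i(t_i)\le B$ such that, after shifting $d$ back by $t_i$ positions in the ranking of each $v_i$, $d$ is not the unique $\mathcal{R}$-winner? **Borda.** For an election with $m$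 candidates, the Borda score of $c$ is $\sum_{v\in V}(m-\mathrm{pos}_v(c))$; the candidates with the highest score are the winners. *)

theory Defs
  imports Main "HOL-Library.Multiset" "HOL-Library.Extended_Nat"
    "HOL-Computational_Algebra.Polynomial"
begin

section \<open>Elections, Borda, and Destructive Shift Bribery\<close>

text \<open>A ranking lists the candidates from best to worst.\<close>

type_synonym 'c ranking = "'c list"
type_synonym 'c election = "'c set \<times> 'c ranking multiset"
type_synonym 'c election_rule = "'c election \<Rightarrow> 'c set"

definition is_ranking :: "'c set \<Rightarrow> 'c ranking \<Rightarrow> bool" where
  "is_ranking C v \<longleftrightarrow> distinct v \<and> set v = C"

text \<open>Positions start at 1 (best). The value is meaningful only for \<open>c \<in> set v\<close>.\<close>

definition pos :: "'c ranking \<Rightarrow> 'c \<Rightarrow> nat" where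
  "pos v c = Suc (length (takeWhile (\<lambda>x. x \<noteq> c) v))"

definition borda_score :: "'c election \<Rightarrow> 'c \<Rightarrow> nat" where
  "borda_score E c = (\<Sum>v\<in>#snd E. card (fst E) - pos v c)"

definition borda :: "'c election_rule" where
  "borda E = {c \<in> fst E. \<forall>c' \<in> fst E. borda_score E c' \<le> borda_score E c}"

text \<open>If fewer than \<open>t\<close> candidates are ranked below \<open>d\<close>, then \<open>d\<close> ends up last; such shifts
  have infinite price and are therefore never affordable.\<close>

definition shift_back :: "'c \<Rightarrow> nat \<Rightarrow> 'c ranking \<Rightarrow> 'c ranking" where
  "shift_back d t v =
     (let above = takeWhile (\<lambda>x. x \<noteq> d) v; below = tl (dropWhile (\<lambda>x. x \<noteq> d) v)
      in above @ take t below @ d # drop t below)"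

definition is_price_function :: "'c set \<Rightarrow> 'c \<Rightarrow> 'c ranking \<Rightarrow> (nat \<Rightarrow> enat) \<Rightarrow> bool" where
  "is_price_function C d v \<rho> \<longleftrightarrow>
     \<rho> 0 = 0 \<and>
     (\<forall>i i'. i < i' \<and> i' \<le> card C - pos v d \<longrightarrow> \<rho> i \<le> \<rho> i') \<and>
     (\<forall>i > card C - pos v d. \<rho> i = \<infinity>)"

type_synonym 'c priced_voter = "'c ranking \<times> (nat \<Rightarrow> enat)"

definition is_instance :: "'c set \<Rightarrow> 'c \<Rightarrow> 'c priced_voter list \<Rightarrow> bool" where
  "is_instance C d vs \<longleftrightarrow>
     finite C \<and> d \<in> C \<and>
     (\<forall>(v, \<rho>) \<in> set vs. is_ranking C v \<and> is_price_function C d v \<rho>)"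

definition is_yes_instance ::
  "'c election_rule \<Rightarrow> 'c set \<Rightarrow> 'c \<Rightarrow> nat \<Rightarrow> 'c priced_voter list \<Rightarrow> bool" where
  "is_yes_instance R C d B vs \<longleftrightarrow>
     is_instance C d vs \<and>
     (\<exists>t :: nat \<Rightarrow> nat.
        (\<Sum>i<length vs. snd (vs ! i) (t i)) \<le> enat B \<and>
        R (C, mset (map (\<lambda>i. shift_back d (t i) (fst (vs ! i))) [0..<length vs])) \<noteq> {d})"


section \<open>Encoding of instances as bit strings\<close>

text \<open>Binary digits, least significant first, without superfluous zeros.\<close>

fun bits :: "nat \<Rightarrow> bool list" where
  "bits n = (if n = 0 then [] else odd n # bits (n div 2))"

declare bits.simps [simp del]

text \<open>Every list element is announced by a \<open>True\<close>, and \<open>False\<close> ends the list. Hence the code is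
  prefix-free whenever the code of the elements is, and tuples can be encoded by concatenation.
  A number \<open>n\<close> takes \<open>2 * length (bits n) + 1\<close> bits.\<close>

definition enc_list :: "('a \<Rightarrow> bool list) \<Rightarrow> 'a list \<Rightarrow> bool list" where
  "enc_list f xs = concat (map (\<lambda>x. True # f x) xs) @ [False]"

definition enc_nat :: "nat \<Rightarrow> bool list" where
  "enc_nat n = enc_list (\<lambda>b. [b]) (bits n)"

text \<open>By monotonicity, the arguments with finite price form an initial segment of the natural
  numbers, so that the list of values determines the price function.\<close>

definition enc_price :: "(nat \<Rightarrow> enat) \<Rightarrow> bool list" where
  "enc_price \<rho> =
     enc_list (\<lambda>i. enc_nat (the_enat (\<rho> i))) (sorted_list_of_set {i. \<rho> i \<noteq> \<infinity>})"

text \<open>The candidates are named \<open>1, \<dots>, m\<close>. The number \<open>m\<close> is encoded in binary as well.\<close>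

definition enc_instance :: "nat \<Rightarrow> nat \<Rightarrow> nat \<Rightarrow> nat priced_voter list \<Rightarrow> bool list" where
  "enc_instance m d B vs =
     enc_nat m @ enc_nat d @ enc_nat B @
     enc_list (\<lambda>(v, \<rho>). enc_list enc_nat v @ enc_price \<rho>) vs"

text \<open>On well-formed instances the encoding is injective.\<close>

lemma enc_list_inj:
  assumes "\<And>x y r s. x \<in> set xs \<Longrightarrow> y \<in> set ys \<Longrightarrow> f x @ r = f y @ s \<Longrightarrow> x = y \<and> r = s"
    and "enc_list f xs @ r = enc_list f ys @ s"
  shows "xs = ys \<and> r = s"
  using assms
proof (induction xs arbitrary: ys)
  case Nil
  then show ?case by (cases ys) (auto simp: enc_list_def)
next
  case (Cons x xs)
  show ?case
  proof (cases ys)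
    case Nil
    then show ?thesis using Cons.prems(2) by (simp add: enc_list_def)
  next
    case (Cons y ys')
    have "f x @ (enc_list f xs @ r) = f y @ (enc_list f ys' @ s)"
      using Cons.prems(2) Cons by (simp add: enc_list_def)
    then have "x = y" "enc_list f xs @ r = enc_list f ys' @ s"
      using Cons.prems(1) Cons by (metis list.set_intros(1))+
    moreover have "xs = ys' \<and> r = s"
      using calculation(2) Cons.prems(1) Cons by (intro Cons.IH) auto
    ultimately show ?thesis using Cons by simp
  qed
qed

lemma bits_inj: "bits m = bits n \<Longrightarrow> m = n"
proof (induction m arbitrary: n rule: less_induct)
  case (less m)
  show ?case
  proof (cases "m = 0 \<or> n = 0")
    case True
    then show ?thesis using less.prems by (simp add: bits.simps[of m] bits.simps[of n] split: if_splits)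
  next
    case False
    then have e: "odd m = odd n" "bits (m div 2) = bits (n div 2)"
      using less.prems by (simp_all add: bits.simps[of m] bits.simps[of n])
    then have "m div 2 = n div 2" using less.IH[of "m div 2"] False by simp
    then show ?thesis using e(1) by presburger
  qed
qed

lemma enc_nat_inj:
  assumes "enc_nat m @ r = enc_nat n @ s"
  shows "m = n \<and> r = s"
proof -
  have "bits m = bits n \<and> r = s"
    by (rule enc_list_inj[OF _ assms[unfolded enc_nat_def]]) simp
  then show ?thesis using bits_inj by blast
qed

lemma enc_price_inj:
  assumes p: "is_price_function C d v \<rho>" "is_price_function C d v \<rho>'"
    and e: "enc_price \<rho> @ r = enc_price \<rho>' @ s"
  shows "\<rho> = \<rho>' \<and> r = s"
proof -
  let ?vals = "\<lambda>\<rho>. map (\<lambda>i. the_enat (\<rho> i)) (sorted_list_of_set {i. \<rho> i \<noteq> (\<infinity>::enat)})"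
  have "enc_price \<rho> = enc_list enc_nat (?vals \<rho>)" for \<rho>
    by (simp add: enc_price_def enc_list_def comp_def)
  then have "enc_list enc_nat (?vals \<rho>) @ r = enc_list enc_nat (?vals \<rho>') @ s"
    using e by simp
  then have "?vals \<rho> = ?vals \<rho>' \<and> r = s"
    by (rule enc_list_inj[rotated]) (rule enc_nat_inj)
  then have eq: "?vals \<rho> = ?vals \<rho>'" "r = s" by blast+
  have seg: "\<exists>k. {i. \<rho> i \<noteq> (\<infinity>::enat)} = {..<k}" if q: "is_price_function C d v \<rho>" for \<rho>
  proof -
    define A where "A = {i. \<rho> i \<noteq> (\<infinity>::enat)}"
    let ?N = "card C - pos v d"
    have N: "i \<le> ?N" if "i \<in> A" for i
    proof (rule ccontr)
      assume "\<not> i \<le> ?N"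
      then have "\<rho> i = \<infinity>" using q unfolding is_price_function_def by (meson not_le)
      then show False using that by (simp add: A_def)
    qed
    then have fin: "finite A" by (meson finite_nat_set_iff_bounded_le)
    have "\<rho> 0 = 0" using q by (simp add: is_price_function_def)
    then have "0 \<in> A" by (simp add: A_def zero_enat_def)
    then have Max: "Max A \<in> A" using fin Max_in by blast
    have "i \<in> A \<longleftrightarrow> i < Suc (Max A)" for i
    proof
      assume "i \<in> A"
      then show "i < Suc (Max A)" using Max_ge[OF fin] by (simp only: less_Suc_eq_le)
    next
      assume "i < Suc (Max A)"
      then consider "i = Max A" | "i < Max A" by linarith
      then show "i \<in> A"
      proof cases
        case 2
        then have "\<rho> i \<le> \<rho> (Max A)"
          using q N[OF Max] unfolding is_price_function_def by blast
        moreover have "\<rho> (Max A) \<noteq> \<infinity>" using Max unfolding A_def by blast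
        ultimately have "\<rho> i \<noteq> \<infinity>" by (cases "\<rho> i") auto
        then show ?thesis unfolding A_def by blast
      qed (use Max in simp)
    qed
    then have "A = {..<Suc (Max A)}" by blast
    then show ?thesis unfolding A_def by blast
  qed
  obtain k k' where k: "{i. \<rho> i \<noteq> \<infinity>} = {..<k}" "{i. \<rho>' i \<noteq> \<infinity>} = {..<k'}"
    using seg[OF p(1)] seg[OF p(2)] by blast
  have [simp]: "sorted_list_of_set {..<n} = [0..<n]" for n :: nat
    by (simp add: lessThan_atLeast0)
  have m: "map (\<lambda>i. the_enat (\<rho> i)) [0..<k] = map (\<lambda>i. the_enat (\<rho>' i)) [0..<k']"
    using eq k by simp
  then have "k = k'" using map_eq_imp_length_eq by fastforce
  have "\<rho> i = \<rho>' i" for i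
  proof (cases "i < k")
    case True
    then have "the_enat (\<rho> i) = the_enat (\<rho>' i)" using m \<open>k = k'\<close> by simp
    moreover have "\<rho> i \<noteq> \<infinity>" "\<rho>' i \<noteq> \<infinity>" using True k \<open>k = k'\<close> by blast+
    ultimately show ?thesis by auto
  next
    case False
    then show ?thesis using k \<open>k = k'\<close> by (metis (mono_tags) lessThan_iff mem_Collect_eq)
  qed
  then show ?thesis using eq by auto
qed

lemma enc_instance_inj:
  assumes "is_instance {1..m} d vs" "is_instance {1..m'} d' vs'"
    and "enc_instance m d B vs = enc_instance m' d' B' vs'"
  shows "m = m' \<and> d = d' \<and> B = B' \<and> vs = vs'"
proof -
  let ?f = "\<lambda>(v, \<rho>). enc_list enc_nat v @ enc_price \<rho>"
  have e: "m = m'" "d = d'" "B = B'" "enc_list ?f vs @ [] = enc_list ?f vs' @ []"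
    using assms(3) unfolding enc_instance_def append_Nil2 by (metis enc_nat_inj)+
  have "vs = vs' \<and> [] = ([]::bool list)"
  proof (rule enc_list_inj[OF _ e(4)])
    fix x y r s
    assume h: "x \<in> set vs" "y \<in> set vs'" "?f x @ r = ?f y @ s"
    obtain v \<rho> v' \<rho>' where xy: "x = (v, \<rho>)" "y = (v', \<rho>')" by (cases x, cases y)
    have "enc_list enc_nat v @ (enc_price \<rho> @ r) = enc_list enc_nat v' @ (enc_price \<rho>' @ s)"
      using h(3) xy by simp
    then have "v = v' \<and> enc_price \<rho> @ r = enc_price \<rho>' @ s"
      by (rule enc_list_inj[rotated]) (rule enc_nat_inj)
    then have "v = v'" "enc_price \<rho> @ r = enc_price \<rho>' @ s" by blast+
    moreover have "is_price_function {1..m} d v \<rho>" "is_price_function {1..m} d v' \<rho>'"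
      using assms(1,2) h(1,2) xy e(1,2) unfolding is_instance_def by auto
    ultimately show "x = y \<and> r = s"
      using enc_price_inj[of "{1..m}" d v \<rho> \<rho>' r s] xy by simp
  qed
  then show ?thesis using e by simp
qed

definition Destructive_Shift_Bribery :: "nat election_rule \<Rightarrow> bool list set" where
  "Destructive_Shift_Bribery R =
     {enc_instance m d B vs | m d B vs. is_yes_instance R {1..m} d B vs}"


section \<open>Deterministic multi-tape Turing machines and the class P\<close>

text \<open>Tapes are infinite in both directions; a tape consists of its content and the head position.
  States and tape symbols are numbers below \<open>tm_states\<close> and \<open>tm_symbols\<close>, respectively. Symbol 0
  is the blank, and symbols 1 and 2 represent the input bits \<open>False\<close> and \<open>True\<close>.\<close>

datatype move = Move_Left | Move_Stay | Move_Right

type_synonym tape = "(int \<Rightarrow> nat) \<times> int"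
type_synonym config = "nat \<times> tape list"

record tm =
  tm_tapes :: nat
  tm_states :: nat
  tm_symbols :: nat
  tm_start :: nat
  tm_accept :: nat
  tm_reject :: nat
  tm_delta :: "nat \<Rightarrow> nat list \<Rightarrow> nat \<times> (nat \<times> move) list"

definition wf_tm :: "tm \<Rightarrow> bool" where
  "wf_tm M \<longleftrightarrow>
     tm_tapes M \<ge> 1 \<and> tm_symbols M \<ge> 3 \<and>
     tm_start M < tm_states M \<and> tm_accept M < tm_states M \<and> tm_reject M < tm_states M \<and>
     tm_accept M \<noteq> tm_reject M \<and>
     (\<forall>q ss. q < tm_states M \<and> length ss = tm_tapes M \<and> set ss \<subseteq> {..<tm_symbols M} \<longrightarrow>
        (case tm_delta M q ss of (q', as) \<Rightarrow>
           q' < tm_states M \<and> length as = tm_tapes M \<and> fst ` set as \<subseteq> {..<tm_symbols M}))"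

fun move_offset :: "move \<Rightarrow> int" where
  "move_offset Move_Left = -1"
| "move_offset Move_Stay = 0"
| "move_offset Move_Right = 1"

definition tape_read :: "tape \<Rightarrow> nat" where
  "tape_read = (\<lambda>(f, h). f h)"

definition tape_act :: "nat \<times> move \<Rightarrow> tape \<Rightarrow> tape" where
  "tape_act = (\<lambda>(s, d) (f, h). (f(h := s), h + move_offset d))"

text \<open>The accepting and the rejecting state are halting: configurations in them do not change.\<close>

definition tm_step :: "tm \<Rightarrow> config \<Rightarrow> config" where
  "tm_step M = (\<lambda>(q, ts).
     if q = tm_accept M \<or> q = tm_reject M then (q, ts)
     else (case tm_delta M q (map tape_read ts) of (q', as) \<Rightarrow> (q', map2 tape_act as ts)))"

definition input_tape :: "bool list \<Rightarrow> tape" where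
  "input_tape x =
     (\<lambda>i. if 0 \<le> i \<and> i < int (length x) then (if x ! nat i then 2 else 1) else 0, 0)"

definition tm_init :: "tm \<Rightarrow> bool list \<Rightarrow> config" where
  "tm_init M x = (tm_start M, input_tape x # replicate (tm_tapes M - 1) (\<lambda>_. 0, 0))"

text \<open>Since halting configurations do not change, \<open>M\<close> halts within \<open>T n\<close> steps on inputs of length
  \<open>n\<close> iff it is in a halting state after exactly \<open>T n\<close> steps.\<close>

definition decides_in_time :: "tm \<Rightarrow> bool list set \<Rightarrow> (nat \<Rightarrow> nat) \<Rightarrow> bool" where
  "decides_in_time M L T \<longleftrightarrow>
     (\<forall>x. fst ((tm_step M ^^ T (length x)) (tm_init M x)) =
          (if x \<in> L then tm_accept M else tm_reject M))"

definition class_P :: "bool list set set" where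
  "class_P = {L. \<exists>M (p :: nat poly). wf_tm M \<and> decides_in_time M L (poly p)}"

end

theory Submission imports Defs begin

text \<open>For a fixed rival \<open>c\<close> of \<open>d\<close>, the cheapest shifts after which \<open>c\<close> has at least the score of \<open>d\<close>
  solve a knapsack problem in which the gain of \<open>c\<close> on \<open>d\<close> is bounded by a polynomial while the prices
  are large numbers. Dynamic programming over the voters, with a table indexed by the gain, solves it
  in polynomial time; the answer is positive iff some rival can catch up within the budget.

  To obtain a Turing machine, data are represented by binary trees, which are written as self-delimiting
  words on a stack. Functions computed by programs over four stacks in polynomial time are closed under
  composition, pairing, case distinction and iteration with polynomially bounded intermediate
  results, and a stack program is executed step by step by a machine whose states are the stacks of
  pending commands. The decision algorithm is thus a functional program whose running time is
  bounded by applying closure properties.\<close>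

section \<open>Stack programs\<close>

text \<open>Fixing the rival makes the problem additive: \<open>d\<close> fails to win alone iff
  some other candidate scores at least as much, and for a fixed \<open>c\<close> the votes
  contribute independently to the score difference. Every affordable shift has its own entry in the
  listed prices, so a vote contributes at most about the length of its price list, however large the
  prices are. Three obstacles shape the rest. The number \<open>m\<close> is given in binary and may
  be exponential in the input length, so nothing may enumerate \<open>{1..m}\<close>; candidates are
  taken from a vote instead. Finally, iterating a polynomial-time function need not be polynomial,
  as repeated doubling shows, so every loop comes with a bound on the sizes of its intermediate
  values; for the tables this bound comes from their length and from discarding costs above
  \<open>B\<close>.\<close>

text \<open>\<open>Write\<close> is no source construct: it is the second half of \<open>Push\<close> on a machine that writes
  before it moves.\<close>

datatype com =
    Skip
  | Pop nat
  | Push nat nat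
  | Write nat nat
  | Seq com com (infixr ";;" 60)
  | Ite nat "nat set" com com
  | While nat "nat set" com

type_synonym store = "nat \<Rightarrow> nat list"

text \<open>The default 0 is the blank, which the head reads on an empty stack.\<close>

definition hd0 :: "nat list \<Rightarrow> nat" where
  "hd0 xs = (case xs of [] \<Rightarrow> 0 | x # _ \<Rightarrow> x)"

lemma hd0_simps [simp]: "hd0 [] = 0" "hd0 (x # xs) = x"
  by (simp_all add: hd0_def)

text \<open>The times are exact numbers of machine steps: \<open>Push\<close> needs two because the
  head must move before the new symbol is written, and unfolding a compound command or testing a
  symbol needs one.\<close>

inductive exec :: "com \<Rightarrow> store \<Rightarrow> nat \<Rightarrow> store \<Rightarrow> bool" where
  Skip: "exec Skip s 1 s"
| Pop: "exec (Pop i) s 1 (s(i := tl (s i)))"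
| Push: "exec (Push i a) s 2 (s(i := a # s i))"
| Seq: "exec c1 s t1 s1 \<Longrightarrow> exec c2 s1 t2 s2 \<Longrightarrow> exec (c1 ;; c2) s (1 + t1 + t2) s2"
| Ite: "exec (if hd0 (s i) \<in> A then c1 else c2) s t s' \<Longrightarrow> exec (Ite i A c1 c2) s (1 + t) s'"
| While_exit: "hd0 (s i) \<notin> A \<Longrightarrow> exec (While i A c) s 1 s"
| While_iter: "hd0 (s i) \<in> A \<Longrightarrow> exec c s t1 s1 \<Longrightarrow> exec (While i A c) s1 t2 s2 \<Longrightarrow>
    exec (While i A c) s (1 + t1 + t2) s2"

fun wf_com :: "com \<Rightarrow> bool" where
  "wf_com Skip = True"
| "wf_com (Pop i) = (i < 4)"
| "wf_com (Push i a) = (i < 4 \<and> a < 4)"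
| "wf_com (Write i a) = (i < 4 \<and> a < 4)"
| "wf_com (c1 ;; c2) = (wf_com c1 \<and> wf_com c2)"
| "wf_com (Ite i A c1 c2) = (i < 4 \<and> wf_com c1 \<and> wf_com c2)"
| "wf_com (While i A c) = (i < 4 \<and> wf_com c)"

section \<open>Compilation to Turing machines\<close>

text \<open>The control state of the machine is the stack of commands that remain to be executed.\<close>

fun ctl_step :: "com list \<Rightarrow> nat list \<Rightarrow> com list \<times> (nat \<times> move) list" where
  "ctl_step [] ss = ([], map (\<lambda>a. (a, Move_Stay)) ss)"
| "ctl_step (Skip # k) ss = (k, map (\<lambda>a. (a, Move_Stay)) ss)"
| "ctl_step (Pop i # k) ss = (k, (map (\<lambda>a. (a, Move_Stay)) ss)[i := (ss ! i, Move_Right)])"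
| "ctl_step (Push i a # k) ss =
     (Write i a # k, (map (\<lambda>a. (a, Move_Stay)) ss)[i := (ss ! i, Move_Left)])"
| "ctl_step (Write i a # k) ss = (k, (map (\<lambda>a. (a, Move_Stay)) ss)[i := (a, Move_Stay)])"
| "ctl_step ((c1 ;; c2) # k) ss = (c1 # c2 # k, map (\<lambda>a. (a, Move_Stay)) ss)"
| "ctl_step (Ite i A c1 c2 # k) ss =
     ((if ss ! i \<in> A then c1 else c2) # k, map (\<lambda>a. (a, Move_Stay)) ss)"
| "ctl_step (While i A c # k) ss =
     (if ss ! i \<in> A then c # While i A c # k else k, map (\<lambda>a. (a, Move_Stay)) ss)"

text \<open>The control stacks that can occur from the start of a command until control returns to
  \<open>k\<close>. The body of a loop returns to the loop itself, so unboundedly many rounds still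
  visit finitely many control stacks; these become the machine states.\<close>

fun conts :: "com \<Rightarrow> com list \<Rightarrow> com list set" where
  "conts (Push i a) k = {Push i a # k, Write i a # k}"
| "conts (c1 ;; c2) k = insert ((c1 ;; c2) # k) (conts c1 (c2 # k) \<union> conts c2 k)"
| "conts (Ite i A c1 c2) k = insert (Ite i A c1 c2 # k) (conts c1 k \<union> conts c2 k)"
| "conts (While i A c) k = insert (While i A c # k) (conts c (While i A c # k))"
| "conts c k = {c # k}"

lemma finite_conts: "finite (conts c k)"
  by (induction c k rule: conts.induct) auto

lemma conts_start: "c # k \<in> conts c k"
  by (cases c) auto

lemma conts_wf:
  assumes "wf_com c" "list_all wf_com k"
  shows "\<forall>q \<in> conts c k. list_all wf_com q"
  using assms by (induction c k rule: conts.induct) (simp_all add: ball_Un)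

text \<open>Within the set, control can leave only to \<open>k\<close>. With \<open>k = []\<close>
  the set together with \<open>[]\<close> is closed under steps and hence can serve as a state
  space.\<close>

lemma conts_closed: "q \<in> conts c k \<Longrightarrow> fst (ctl_step q ss) \<in> insert k (conts c k)"
proof (induction c k arbitrary: q rule: conts.induct)
  case (2 c1 c2 k)
  then show ?case using conts_start[of c1 "c2 # k"] conts_start[of c2 k] by fastforce
next
  case (3 i A c1 c2 k)
  then show ?case using conts_start[of c1 k] conts_start[of c2 k] by auto
next
  case (4 i A c k)
  then show ?case using conts_start[of c "While i A c # k"] by fastforce
qed auto

definition conf_step :: "com list \<times> tape list \<Rightarrow> com list \<times> tape list" where
  "conf_step = (\<lambda>(k, ts). case ctl_step k (map tape_read ts) of (k', as) \<Rightarrow> (k', map2 tape_act as ts))"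

text \<open>The head is on the top of the stack; whatever lies to its left is garbage.\<close>

definition is_stack :: "tape \<Rightarrow> nat list \<Rightarrow> bool" where
  "is_stack = (\<lambda>(f, h) xs. \<forall>j. f (h + int j) = (if j < length xs then xs ! j else 0))"

definition represents :: "tape list \<Rightarrow> store \<Rightarrow> bool" where
  "represents ts s \<longleftrightarrow> length ts = 4 \<and> (\<forall>i < 4. is_stack (ts ! i) (s i))"

lemma is_stack_read: "is_stack t xs \<Longrightarrow> tape_read t = hd0 xs"
proof -
  assume "is_stack t xs"
  then have "fst t (snd t + int 0) = (if 0 < length xs then xs ! 0 else 0)"
    unfolding is_stack_def by (metis (mono_tags, lifting) case_prod_unfold)
  then show ?thesis by (cases xs) (auto simp: tape_read_def split: prod.splits)
qed

lemma tape_act_stay [simp]: "tape_act (tape_read t, Move_Stay) t = t"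
  by (cases t) (simp add: tape_act_def tape_read_def)

lemma is_stack_pop: "is_stack t xs \<Longrightarrow> is_stack (tape_act (tape_read t, Move_Right) t) (tl xs)"
proof -
  assume a: "is_stack t xs"
  obtain f h where t: "t = (f, h)" by (cases t)
  have "f (h + 1 + int j) = (if j < length (tl xs) then tl xs ! j else 0)" for j
    using a[unfolded is_stack_def t, simplified, rule_format, of "Suc j"]
    by (cases xs) (auto simp: algebra_simps)
  then show ?thesis by (simp add: t is_stack_def tape_act_def tape_read_def)
qed

lemma is_stack_push:
  assumes "is_stack t xs"
  shows "is_stack (tape_act (a, Move_Stay) (tape_act (tape_read t, Move_Left) t)) (a # xs)"
proof -
  obtain f h where t: "t = (f, h)" by (cases t)
  have "(f(h - 1 := a)) (h - 1 + int j) = (if j < length (a # xs) then (a # xs) ! j else 0)" for j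
    using assms[unfolded is_stack_def t, simplified, rule_format, of "j - 1"]
    by (cases j) (auto simp: algebra_simps)
  then show ?thesis by (simp add: t is_stack_def tape_act_def tape_read_def)
qed

lemma map2_stay [simp]: "map2 tape_act (map (\<lambda>a. (a, Move_Stay)) (map tape_read ts)) ts = ts"
  by (intro nth_equalityI) auto

lemma map2_stay_update:
  "i < length ts \<Longrightarrow>
    map2 tape_act ((map (\<lambda>a. (a, Move_Stay)) (map tape_read ts))[i := x]) ts = ts[i := tape_act x (ts ! i)]"
  by (intro nth_equalityI) (auto simp: nth_list_update)

lemma represents_update:
  "represents ts s \<Longrightarrow> is_stack t xs \<Longrightarrow> represents (ts[i := t]) (s(i := xs))"
  by (auto simp: represents_def nth_list_update)

text \<open>The induction follows the run and not the command, because a loop runs itself again. An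
  arbitrary \<open>k\<close> is needed since a part of a program is executed with its remainder
  still pending.\<close>

lemma exec_conf_step:
  assumes "exec c s t s'" "wf_com c" "represents ts s"
  shows "\<exists>ts'. (conf_step ^^ t) (c # k, ts) = (k, ts') \<and> represents ts' s'"
  using assms
proof (induction arbitrary: k ts rule: exec.induct)
  case (Skip s)
  then show ?case by (simp add: conf_step_def del: map_map)
next
  case (Pop i s)
  let ?t = "tape_act (tape_read (ts ! i), Move_Right) (ts ! i)"
  have i: "i < length ts" "i < 4" using Pop by (simp_all add: represents_def)
  then have "conf_step (Pop i # k, ts) = (k, ts[i := ?t])"
    by (simp add: conf_step_def map2_stay_update del: map_map)
  moreover have "is_stack ?t (tl (s i))"
    using i Pop by (intro is_stack_pop) (simp add: represents_def)
  then have "represents (ts[i := ?t]) (s(i := tl (s i)))" using Pop by (intro represents_update)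
  ultimately show ?case by (simp del: fun_upd_apply)
next
  case (Push i a s)
  let ?t1 = "tape_act (tape_read (ts ! i), Move_Left) (ts ! i)"
  let ?t = "tape_act (a, Move_Stay) ?t1"
  have i: "i < length ts" "i < 4" using Push by (simp_all add: represents_def)
  then have "conf_step (Push i a # k, ts) = (Write i a # k, ts[i := ?t1])"
    by (simp add: conf_step_def map2_stay_update del: map_map)
  moreover have "conf_step (Write i a # k, ts[i := ?t1]) = (k, ts[i := ?t])"
    using i by (simp add: conf_step_def map2_stay_update del: map_map)
  moreover have "is_stack ?t (a # s i)"
    using i Push by (intro is_stack_push) (simp add: represents_def)
  then have "represents (ts[i := ?t]) (s(i := a # s i))" using Push by (intro represents_update)
  ultimately show ?case by (simp add: numeral_2_eq_2 del: fun_upd_apply)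
next
  case (Seq c1 s t1 s1 c2 t2 s2)
  obtain ts1 where 1: "(conf_step ^^ t1) (c1 # c2 # k, ts) = (c2 # k, ts1)" "represents ts1 s1"
    using Seq by (metis wf_com.simps(5))
  obtain ts2 where 2: "(conf_step ^^ t2) (c2 # k, ts1) = (k, ts2)" "represents ts2 s2"
    using Seq 1 by (metis wf_com.simps(5))
  have 0: "conf_step ((c1 ;; c2) # k, ts) = (c1 # c2 # k, ts)"
    by (simp add: conf_step_def del: map_map)
  \<comment> \<open>The right summand of an exponent is iterated first, so the first part of the run
    stands on the right.\<close>
  have "(conf_step ^^ (t2 + Suc t1)) ((c1 ;; c2) # k, ts) = (k, ts2)"
    by (simp only: funpow_add funpow_Suc_right o_apply 0 1 2)
  then show ?case using 2 by (auto simp: add.commute add.left_commute)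
next
  case (Ite s i A c1 c2 t s')
  let ?c = "if hd0 (s i) \<in> A then c1 else c2"
  have i: "i < length ts" "i < 4" using Ite by (simp_all add: represents_def)
  have r: "tape_read (ts ! i) = hd0 (s i)"
    using Ite i by (intro is_stack_read) (simp add: represents_def)
  have 0: "conf_step (Ite i A c1 c2 # k, ts) = (?c # k, ts)"
    using i r by (simp add: conf_step_def del: map_map)
  have "wf_com ?c" using Ite.prems(1) by simp
  then obtain ts' where 1: "(conf_step ^^ t) (?c # k, ts) = (k, ts')" "represents ts' s'"
    using Ite.IH[OF _ Ite.prems(2), of k] by blast
  have "(conf_step ^^ Suc t) (Ite i A c1 c2 # k, ts) = (k, ts')"
    by (simp only: funpow_add funpow_Suc_right o_apply 0 1)
  then show ?case using 1 by (auto simp: add.commute)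
next
  case (While_exit s i A c)
  have i: "i < length ts" "i < 4" using While_exit by (simp_all add: represents_def)
  have r: "tape_read (ts ! i) = hd0 (s i)"
    using While_exit i by (intro is_stack_read) (simp add: represents_def)
  then show ?case using While_exit i by (simp add: conf_step_def del: map_map)
next
  case (While_iter s i A c t1 s1 t2 s2)
  have i: "i < length ts" "i < 4" using While_iter by (simp_all add: represents_def)
  have r: "tape_read (ts ! i) = hd0 (s i)"
    using While_iter i by (intro is_stack_read) (simp add: represents_def)
  have 0: "conf_step (While i A c # k, ts) = (c # While i A c # k, ts)"
    using i r While_iter.hyps(1) by (simp add: conf_step_def del: map_map)
  obtain ts1 where 1: "(conf_step ^^ t1) (c # While i A c # k, ts) = (While i A c # k, ts1)"
      "represents ts1 s1"
    using While_iter by (metis wf_com.simps(7))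
  obtain ts2 where 2: "(conf_step ^^ t2) (While i A c # k, ts1) = (k, ts2)" "represents ts2 s2"
    using While_iter 1 by metis
  have "(conf_step ^^ (t2 + Suc t1)) (While i A c # k, ts) = (k, ts2)"
    by (simp only: funpow_add funpow_Suc_right o_apply 0 1 2)
  then show ?case using 2 by (auto simp: add.commute add.left_commute)
qed

text \<open>The machine depends on \<open>c\<close> only and serves all stores. Symbol 2 on top of
  stack 0 is the root of the code of \<open>True\<close>; the additional step in
  \<open>Suc n\<close> reads it and gives the verdict.\<close>

lemma tm_of_com:
  assumes "wf_com c"
  obtains M where "wf_tm M" "tm_tapes M = 4"
    "\<And>s t s' ts. exec c s t s' \<Longrightarrow> represents ts s \<Longrightarrow>
       \<exists>n \<le> t. fst ((tm_step M ^^ Suc n) (tm_start M, ts)) =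
         (if hd0 (s' 0) = 2 then tm_accept M else tm_reject M)"
proof -
  define S where "S = insert [] (conts c [])"
  have fin: "finite S" by (simp add: S_def finite_conts)
  define N where "N = card S"
  obtain h where h: "bij_betw h S {0..<N}"
    using ex_bij_betw_finite_nat[OF fin] unfolding N_def by blast
  have h_lt: "h k < N" if "k \<in> S" for k
    using h that unfolding bij_betw_def by auto
  have h_inv: "inv_into S h (h k) = k" if "k \<in> S" for k
    using h that by (simp add: bij_betw_def)
  have inv_S: "inv_into S h q \<in> S" if "q < N" for q
    using h that by (metis atLeastLessThan_iff bij_betw_def inv_into_into zero_le)
  have S_step: "fst (ctl_step k ss) \<in> S" if "k \<in> S" for k ss
    using that conts_closed[of k c "[]" ss] by (auto simp: S_def)
  have S_wf: "list_all wf_com k" if "k \<in> S" for k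
    using that conts_wf[of c "[]"] assms by (auto simp: S_def)
  have S_init: "[c] \<in> S" by (simp add: S_def conts_start)
  \<comment> \<open>States below \<open>N\<close> number the control stacks; \<open>N\<close>
    accepts and \<open>Suc N\<close> rejects. The first branch concerns only these halting states,
    for which well-formedness also demands legal values.\<close>
  define delta where "delta = (\<lambda>q ss.
     let k = inv_into S h q in
     if N \<le> q then (q, map (\<lambda>a. (a, Move_Stay)) ss)
     else if k = [] then (if ss ! 0 = 2 then N else Suc N, map (\<lambda>a. (a, Move_Stay)) ss)
     else (h (fst (ctl_step k ss)), snd (ctl_step k ss)))"
  define M where "M = \<lparr>tm_tapes = 4, tm_states = N + 2, tm_symbols = 4, tm_start = h [c],
     tm_accept = N, tm_reject = Suc N, tm_delta = delta\<rparr>"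
  have ctl_wf: "length (snd (ctl_step k ss)) = 4 \<and> fst ` set (snd (ctl_step k ss)) \<subseteq> {..<4}"
    if "k \<in> S" "length ss = 4" "set ss \<subseteq> {..<4}" for k ss
  proof -
    have upd: "fst ` set ((map (\<lambda>a. (a, Move_Stay)) ss)[i := x]) \<subseteq> {..<4}" if "fst x < 4" for i x
      using set_update_subset_insert[of "map (\<lambda>a. (a, Move_Stay)) ss" i x] that \<open>set ss \<subseteq> {..<4}\<close>
      by fastforce
    have nth: "ss ! i < 4" if "i < 4" for i
      using that \<open>set ss \<subseteq> {..<4}\<close> \<open>length ss = 4\<close> by (metis lessThan_iff nth_mem subsetD)
    show ?thesis
      using S_wf[OF \<open>k \<in> S\<close>] that(2,3) nth
      by (cases "(k, ss)" rule: ctl_step.cases) (simp_all add: upd image_image)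
  qed
  have M_step: "tm_step M (h k, ts) = (h (fst (conf_step (k, ts))), snd (conf_step (k, ts)))"
    if "k \<in> S" "k \<noteq> []" for k ts
    using that h_lt[OF that(1)] h_inv[OF that(1)]
    by (auto simp: tm_step_def M_def delta_def conf_step_def Let_def split: prod.splits)
  have conf_S: "fst (conf_step (k, ts)) \<in> S" if "k \<in> S" for k ts
    using S_step[OF that, of "map tape_read ts"] by (auto simp: conf_step_def split: prod.splits)
  \<comment> \<open>\<open>conf_step\<close> idles on the empty control stack whereas the machine
    gives its verdict there, so idle steps are cut off and only an upper bound on the number of
    steps remains.\<close>
  have sim: "\<exists>n \<le> t. (tm_step M ^^ n) (h k, ts) = (h [], ts')"
    if "k \<in> S" "(conf_step ^^ t) (k, ts) = ([], ts')" for t k ts ts'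
    using that
  proof (induction t arbitrary: k ts)
    case (Suc t)
    show ?case
    proof (cases "k = []")
      case True
      then have "conf_step (k, ts) = (k, ts)" by (simp add: conf_step_def del: map_map)
      then have "(conf_step ^^ t) (k, ts) = ([], ts')"
        using Suc.prems by (simp only: funpow_Suc_right o_apply)
      then show ?thesis using Suc.IH Suc.prems(1) le_SucI by blast
    next
      case False
      obtain k1 ts1 where 1: "conf_step (k, ts) = (k1, ts1)" by fastforce
      then have "(conf_step ^^ t) (k1, ts1) = ([], ts')"
        using Suc.prems by (simp only: funpow_Suc_right o_apply)
      moreover have "k1 \<in> S" using conf_S[OF Suc.prems(1), of ts] 1 by simp
      ultimately obtain n where n: "n \<le> t" "(tm_step M ^^ n) (h k1, ts1) = (h [], ts')"
        using Suc.IH by blast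
      have "(tm_step M ^^ Suc n) (h k, ts) = (h [], ts')"
        using M_step[OF Suc.prems(1) False, of ts] 1 n by (simp only: funpow_Suc_right o_apply fst_conv snd_conv)
      then show ?thesis using n(1) by (meson Suc_le_mono)
    qed
  qed auto
  have "wf_tm M"
    unfolding wf_tm_def
  proof (intro conjI allI impI)
    fix q ss assume a: "q < tm_states M \<and> length ss = tm_tapes M \<and> set ss \<subseteq> {..<tm_symbols M}"
    then have b: "length ss = 4" "set ss \<subseteq> {..<4}" by (auto simp: M_def)
    show "case tm_delta M q ss of (q', as) \<Rightarrow>
      q' < tm_states M \<and> length as = tm_tapes M \<and> fst ` set as \<subseteq> {..<tm_symbols M}"
    proof (cases "q < N \<and> inv_into S h q \<noteq> []")
      case True
      then show ?thesis
        using ctl_wf[OF inv_S b] h_lt[OF S_step[OF inv_S], of q ss] b a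
        by (auto simp: M_def delta_def Let_def)
    next
      case False
      then show ?thesis using a b by (auto simp: M_def delta_def Let_def image_image)
    qed
  qed (use h_lt[OF S_init] in \<open>auto simp: M_def\<close>)
  moreover have "\<exists>n \<le> t. fst ((tm_step M ^^ Suc n) (tm_start M, ts)) =
         (if hd0 (s' 0) = 2 then tm_accept M else tm_reject M)"
    if ex: "exec c s t s'" and r: "represents ts s" for s t s' ts
  proof -
    obtain ts' where "(conf_step ^^ t) ([c], ts) = ([], ts')" and r': "represents ts' s'"
      using exec_conf_step[OF ex assms r] by blast
    then obtain n where n: "n \<le> t" "(tm_step M ^^ n) (h [c], ts) = (h [], ts')"
      using sim[OF S_init] by blast
    have "tape_read (ts' ! 0) = hd0 (s' 0)" "ts' \<noteq> []"
      using r' by (auto simp: represents_def intro: is_stack_read)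
    moreover have "[] \<in> S" by (simp add: S_def)
    ultimately have "fst (tm_step M (h [], ts')) = (if hd0 (s' 0) = 2 then N else Suc N)"
      using h_lt[of "[]"] h_inv[of "[]"] r'
      by (auto simp: tm_step_def M_def delta_def represents_def)
    then have "fst ((tm_step M ^^ Suc n) (h [c], ts)) = (if hd0 (s' 0) = 2 then N else Suc N)"
      using n(2) by simp
    then show ?thesis using n(1) by (auto simp: M_def)
  qed
  ultimately show ?thesis using that[of M] by (simp add: M_def)
qed

lemma tm_step_halted:
  "q = tm_accept M \<or> q = tm_reject M \<Longrightarrow> fst ((tm_step M ^^ n) (q, ts)) = q"
  by (induction n arbitrary: ts) (auto simp: tm_step_def funpow_swap1 simp del: funpow.simps simp add: funpow_Suc_right)

section \<open>Data and polynomial-time functions\<close>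

datatype tree = Leaf | Node tree tree

text \<open>Polish notation: no code is a proper prefix of another one, and the end of a code is
  found by counting the subtrees that are still missing.\<close>

primrec tree_code :: "tree \<Rightarrow> nat list" where
  "tree_code Leaf = [1]"
| "tree_code (Node l r) = 2 # tree_code l @ tree_code r"

class data =
  fixes tree_of :: "'a \<Rightarrow> tree"

instantiation bool :: data begin
definition "tree_of b = (if b then Node Leaf Leaf else Leaf)"
instance ..
end

instantiation prod :: (data, data) data begin
definition "tree_of p = Node (tree_of (fst p)) (tree_of (snd p))"
instance ..
end

instantiation list :: (data) data begin
primrec tree_of_list :: "'a list \<Rightarrow> tree" where
  "tree_of_list [] = Leaf"
| "tree_of_list (x # xs) = Node (tree_of x) (tree_of_list xs)"
instance ..
end

instantiation option :: (data) data begin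
primrec tree_of_option :: "'a option \<Rightarrow> tree" where
  "tree_of_option None = Leaf"
| "tree_of_option (Some x) = Node (tree_of x) Leaf"
instance ..
end

instantiation nat :: data begin
definition "tree_of n = tree_of (bits n)"
instance ..
end

definition code :: "'a::data \<Rightarrow> nat list" where
  "code x = tree_code (tree_of x)"

definition sz :: "'a::data \<Rightarrow> nat" where
  "sz x = length (code x)"

lemma code_simps [simp]:
  "code True = [2, 1, 1]" "code False = [1]"
  "code (x, y) = 2 # code x @ code y"
  "code [] = [1]" "code (z # zs) = 2 # code z @ code zs"
  "code None = [1]" "code (Some z) = 2 # code z @ [1]"
  by (simp_all add: code_def tree_of_bool_def tree_of_prod_def)

lemma sz_simps [simp]:
  "sz True = 3" "sz False = 1" "sz (x, y) = 1 + sz x + sz y"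
  "sz [] = 1" "sz (z # zs) = 1 + sz z + sz zs"
  "sz None = 1" "sz (Some z) = 2 + sz z"
  by (simp_all add: sz_def)

lemma sz_pos [simp]: "0 < sz x"
  by (cases "tree_of x") (simp_all add: sz_def code_def)

lemma sz_ge_1: "1 \<le> sz x"
  using sz_pos[of x] by linarith

lemma sz_append: "sz (xs @ ys) + 1 = sz xs + sz ys"
  by (induction xs) simp_all

lemma sz_bool_le: "sz (b::bool) \<le> 3"
  by (cases b) simp_all

lemma length_le_sz: "length xs \<le> sz xs"
  by (induction xs) simp_all

lemma sz_mem: "x \<in> set xs \<Longrightarrow> sz x \<le> sz xs"
  by (induction xs) auto

lemma sz_cong: "tree_of x = tree_of y \<Longrightarrow> sz x = sz y"
  by (simp add: sz_def code_def)

lemma set_code: "set (tree_code t) \<subseteq> {1, 2}"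
  by (induction t) auto

definition poly_bounded :: "('a::data \<Rightarrow> nat) \<Rightarrow> bool" where
  "poly_bounded T \<longleftrightarrow> (\<exists>p. \<forall>x. T x \<le> poly p (sz x))"

definition runs :: "com \<Rightarrow> store \<Rightarrow> store \<Rightarrow> nat \<Rightarrow> bool" where
  "runs c s s' T \<longleftrightarrow> (\<exists>t \<le> T. exec c s t s')"

text \<open>The argument is replaced by the value on the top of stack 0, no matter what lies beneath
  it and on the other stacks, which makes programs composable.\<close>

definition implements :: "com \<Rightarrow> ('a::data \<Rightarrow> 'b::data) \<Rightarrow> ('a \<Rightarrow> nat) \<Rightarrow> bool" where
  "implements c f T \<longleftrightarrow> wf_com c \<and>
     (\<forall>x r s. s 0 = code x @ r \<longrightarrow> runs c s (s(0 := code (f x) @ r)) (T x))"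

definition ptime :: "('a::data \<Rightarrow> 'b::data) \<Rightarrow> bool" where
  "ptime f \<longleftrightarrow> (\<exists>c T. poly_bounded T \<and> implements c f T)"

named_theorems ptime_intros

lemma ptimeI: "poly_bounded T \<Longrightarrow> implements c f T \<Longrightarrow> ptime f"
  by (auto simp: ptime_def)

text \<open>Natural coefficients make polynomials monotone, so that a size may be replaced by any
  upper bound inside a time bound and bounds may be composed.\<close>

lemma poly_mono_nat: "m \<le> n \<Longrightarrow> poly (p :: nat poly) m \<le> poly p n"
  by (induction p) (auto intro!: add_mono mult_mono)

lemma poly_bounded_const: "poly_bounded (\<lambda>_. n)"
  unfolding poly_bounded_def by (rule exI[of _ "[:n:]"]) simp

lemma poly_bounded_sz: "poly_bounded sz"
  unfolding poly_bounded_def by (rule exI[of _ "[:0, 1:]"]) simp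

lemma poly_bounded_add: "poly_bounded S \<Longrightarrow> poly_bounded T \<Longrightarrow> poly_bounded (\<lambda>x. S x + T x)"
  unfolding poly_bounded_def by (metis add_mono poly_add)

lemma poly_bounded_mult: "poly_bounded S \<Longrightarrow> poly_bounded T \<Longrightarrow> poly_bounded (\<lambda>x. S x * T x)"
  unfolding poly_bounded_def by (metis mult_le_mono poly_mult)

lemma poly_bounded_mono: "poly_bounded T \<Longrightarrow> (\<And>x. S x \<le> T x) \<Longrightarrow> poly_bounded S"
  unfolding poly_bounded_def by (meson le_trans)

lemma poly_bounded_poly: "poly_bounded T \<Longrightarrow> poly_bounded (\<lambda>x. poly p (T x))"
  unfolding poly_bounded_def
proof (elim exE)
  fix q assume q: "\<forall>x. T x \<le> poly q (sz x)"
  have "poly p (T x) \<le> poly (pcompose p q) (sz x)" for x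
    using q by (simp add: poly_pcompose poly_mono_nat)
  then show "\<exists>q. \<forall>x. poly p (T x) \<le> poly q (sz x)" by blast
qed

lemma runs_mono: "runs c s s' S \<Longrightarrow> S \<le> T \<Longrightarrow> runs c s s' T"
  by (meson le_trans runs_def)

lemma runs_Skip: "runs Skip s s 1"
  unfolding runs_def by (intro exI conjI, rule order_refl, rule exec.Skip)

lemma runs_Pop: "runs (Pop i) s (s(i := tl (s i))) 1"
  unfolding runs_def by (intro exI conjI, rule order_refl, rule exec.Pop)

lemma runs_Push: "runs (Push i a) s (s(i := a # s i)) 2"
  unfolding runs_def by (intro exI conjI, rule order_refl, rule exec.Push)

lemma runs_Seq: "runs c1 s s1 T1 \<Longrightarrow> runs c2 s1 s2 T2 \<Longrightarrow> runs (c1 ;; c2) s s2 (1 + T1 + T2)"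
  unfolding runs_def by (elim exE conjE, rule exI, rule conjI[rotated], erule (1) exec.Seq) simp

lemma runs_Ite: "runs (if hd0 (s i) \<in> A then c1 else c2) s s' T \<Longrightarrow> runs (Ite i A c1 c2) s s' (1 + T)"
  unfolding runs_def by (meson add_le_cancel_left exec.Ite)

lemma runs_Ite_True: "hd0 (s i) \<in> A \<Longrightarrow> runs c1 s s' T \<Longrightarrow> runs (Ite i A c1 c2) s s' (1 + T)"
  by (rule runs_Ite) simp

lemma runs_Ite_False: "hd0 (s i) \<notin> A \<Longrightarrow> runs c2 s s' T \<Longrightarrow> runs (Ite i A c1 c2) s s' (1 + T)"
  by (rule runs_Ite) simp

lemma runs_While_exit: "hd0 (s i) \<notin> A \<Longrightarrow> runs (While i A c) s s 1"
  unfolding runs_def by (intro exI conjI, rule order_refl, rule exec.While_exit)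

lemma runs_While_iter:
  "hd0 (s i) \<in> A \<Longrightarrow> runs c s s1 T1 \<Longrightarrow> runs (While i A c) s1 s2 T2 \<Longrightarrow>
    runs (While i A c) s s2 (1 + T1 + T2)"
  unfolding runs_def by (elim exE conjE, rule exI, rule conjI[rotated], erule (2) exec.While_iter) simp

lemmas runs_intros = runs_Seq runs_Pop runs_Push runs_Skip

section \<open>Moving, copying and discarding values on the stacks\<close>

text \<open>Symbol 3 never occurs in codes and marks the bottom of temporary data on the stacks 1 to 3.
  The loop counts the subtrees that are still to come in unary on stack 3; the code arrives reversed.\<close>

definition move_tree :: "nat \<Rightarrow> nat \<Rightarrow> com" where
  "move_tree i j = Push 3 3 ;; Push 3 1 ;;
     While 3 {1} (Ite i {2} (Push 3 1 ;; Pop i ;; Push j 2) (Pop 3 ;; Pop i ;; Push j 1)) ;; Pop 3"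

text \<open>Both subtrees of a node are handled by the same loop, so a single tree does not
  correspond to a complete run of \<open>W\<close>. Prefixing an arbitrary remaining run makes
  induction on the tree possible. A round costs at most 9 steps, which 10 per symbol covers.\<close>

lemma move_tree_loop:
  assumes ij: "i < 3" "j < 3" "i \<noteq> j"
  defines "W \<equiv> While 3 {1} (Ite i {2} (Push 3 1 ;; Pop i ;; Push j 2) (Pop 3 ;; Pop i ;; Push j 1))"
  assumes "s i = tree_code t @ r" "s 3 = 1 # R"
    and "runs W (s(i := r, 3 := R, j := rev (tree_code t) @ s j)) s' T"
  shows "runs W s s' (T + 10 * length (tree_code t))"
  using assms(5-)
proof (induction t arbitrary: s r R T)
  case Leaf
  have "runs (Ite i {2} (Push 3 1 ;; Pop i ;; Push j 2) (Pop 3 ;; Pop i ;; Push j 1)) s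
    (s(i := r, 3 := R, j := 1 # s j)) (1 + (1 + 1 + (1 + 1 + 2)))"
  proof (rule runs_Ite_False)
    have "s(i := r, 3 := R, j := 1 # s j) =
      (let s1 = s(3 := tl (s 3)); s2 = s1(i := tl (s1 i)) in s2(j := 1 # s2 j))"
      using Leaf ij by (auto simp: Let_def fun_eq_iff)
    then show "runs (Pop 3 ;; Pop i ;; Push j 1) s (s(i := r, 3 := R, j := 1 # s j)) (1 + 1 + (1 + 1 + 2))"
      unfolding Let_def by (simp only:) (rule runs_intros)+
  qed (use Leaf in simp)
  moreover have "runs W (s(i := r, 3 := R, j := 1 # s j)) s' T" using Leaf(3) by (simp del: fun_upd_apply)
  ultimately have "runs W s s' (1 + (1 + (1 + 1 + (1 + 1 + 2))) + T)"
    unfolding W_def using Leaf(2) by (intro runs_While_iter) simp_all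
  then show ?case by (auto elim: runs_mono)
next
  case (Node t1 t2)
  define s1 where "s1 = s(i := tree_code t1 @ tree_code t2 @ r, 3 := 1 # 1 # R, j := 2 # s j)"
  define s2 where "s2 = s1(i := tree_code t2 @ r, 3 := 1 # R, j := rev (tree_code t1) @ 2 # s j)"
  have "s2(i := r, 3 := R, j := rev (tree_code t2) @ s2 j) =
      s(i := r, 3 := R, j := rev (tree_code (Node t1 t2)) @ s j)"
    using ij by (auto simp: s1_def s2_def fun_eq_iff)
  then have w2: "runs W (s2(i := r, 3 := R, j := rev (tree_code t2) @ s2 j)) s' T"
    using Node.prems(3) by (simp only:)
  have w2: "runs W s2 s' (T + 10 * length (tree_code t2))"
    by (rule Node.IH(2)[OF _ _ w2]) (use ij in \<open>simp_all add: s2_def\<close>)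
  have w1: "runs W s1 s' (T + 10 * length (tree_code t2) + 10 * length (tree_code t1))"
    by (rule Node.IH(1)[of s1 "tree_code t2 @ r" "1 # R"], use ij in \<open>simp add: s1_def\<close>,
        use ij in \<open>simp add: s1_def\<close>)
      (use w2 ij in \<open>simp add: s1_def s2_def del: fun_upd_apply add: fun_upd_same fun_upd_other\<close>)
  have "runs (Ite i {2} (Push 3 1 ;; Pop i ;; Push j 2) (Pop 3 ;; Pop i ;; Push j 1)) s
    s1 (1 + (1 + 2 + (1 + 1 + 2)))"
  proof (rule runs_Ite_True)
    have "s1 = (let s1 = s(3 := 1 # s 3); s2 = s1(i := tl (s1 i)) in s2(j := 2 # s2 j))"
      using Node.prems ij by (auto simp: Let_def fun_eq_iff s1_def)
    then show "runs (Push 3 1 ;; Pop i ;; Push j 2) s s1 (1 + 2 + (1 + 1 + 2))"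
      unfolding Let_def by (simp only:) (rule runs_intros)+
  qed (use Node in simp)
  with w1 have "runs W s s' (1 + (1 + (1 + 2 + (1 + 1 + 2))) + (T + 10 * length (tree_code t2) + 10 * length (tree_code t1)))"
    unfolding W_def using Node.prems(2) by (intro runs_While_iter) simp_all
  then show ?case by (auto elim: runs_mono)
qed

lemma runs_move_tree:
  assumes ij: "i < 3" "j < 3" "i \<noteq> j" and s: "s i = tree_code t @ r"
  shows "runs (move_tree i j) s (s(i := r, j := rev (tree_code t) @ s j)) (10 + 10 * length (tree_code t))"
proof -
  define s1 where "s1 = s(3 := 3 # s 3)"
  define s2 where "s2 = s1(3 := 1 # s1 3)"
  define s3 where "s3 = s2(i := r, 3 := 3 # s 3, j := rev (tree_code t) @ s2 j)"
  let ?W = "While 3 {1} (Ite i {2} (Push 3 1 ;; Pop i ;; Push j 2) (Pop 3 ;; Pop i ;; Push j 1))"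
  have "runs ?W s3 s3 1" by (rule runs_While_exit) (use ij in \<open>simp add: s3_def\<close>)
  then have W: "runs ?W s2 s3 (1 + 10 * length (tree_code t))"
    unfolding s3_def using ij s by (intro move_tree_loop) (simp_all add: s1_def s2_def)
  have "runs (move_tree i j) s (s3(3 := tl (s3 3)))
      (1 + 2 + (1 + 2 + (1 + (1 + 10 * length (tree_code t)) + 1)))"
    unfolding move_tree_def by (rule runs_Seq runs_Push[of 3 3 s, folded s1_def]
        runs_Push[of 3 1 s1, folded s2_def] W runs_Pop)+
  moreover have "s3(3 := tl (s3 3)) = s(i := r, j := rev (tree_code t) @ s j)"
    using ij by (auto simp: s3_def s2_def s1_def fun_eq_iff)
  ultimately show ?thesis by (auto elim: runs_mono)
qed

primrec push_all :: "nat list \<Rightarrow> nat \<Rightarrow> com" where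
  "push_all [] a = Skip"
| "push_all (i # is) a = Push i a ;; push_all is a"

text \<open>Several targets receive copies simultaneously, which is how values are duplicated; an
  empty list of targets discards the block.\<close>

definition move_block :: "nat \<Rightarrow> nat list \<Rightarrow> com" where
  "move_block j is = While j {1, 2} (Ite j {1} (Pop j ;; push_all is 1) (Pop j ;; push_all is 2)) ;; Pop j"

lemma runs_push_all:
  "distinct is \<Longrightarrow> runs (push_all is a) s (\<lambda>i. if i \<in> set is then a # s i else s i) (1 + 3 * length is)"
proof (induction "is" arbitrary: s)
  case (Cons i "is")
  let ?s = "s(i := a # s i)"
  have "runs (push_all (i # is) a) s (\<lambda>k. if k \<in> set is then a # ?s k else ?s k) (1 + 2 + (1 + 3 * length is))"
    unfolding push_all.simps using Cons.prems by (intro runs_Seq[OF runs_Push Cons.IH]) simp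
  moreover have "(\<lambda>k. if k \<in> set is then a # ?s k else ?s k) = (\<lambda>k. if k \<in> set (i # is) then a # s k else s k)"
    using Cons.prems by (auto simp: fun_eq_iff)
  ultimately show ?case by (auto elim: runs_mono)
qed (use runs_Skip in simp)

text \<open>The block may end at a marker or at the bottom of the stack; the latter case occurs when
  the input, which has no marker beneath it, is read.\<close>

lemma runs_move_block_end:
  assumes j: "j \<notin> set is" "distinct is" "s j = w @ r" "hd0 r \<notin> {1, 2}" "set w \<subseteq> {1, 2}"
  shows "runs (move_block j is) s (\<lambda>i. if i = j then tl r else if i \<in> set is then rev w @ s i else s i)
    (3 + (5 + 3 * length is) * length w)"
proof -
  let ?B = "Ite j {1} (Pop j ;; push_all is 1) (Pop j ;; push_all is 2)"
  have "runs (While j {1, 2} ?B) s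
    (\<lambda>i. if i = j then r else if i \<in> set is then rev w @ s i else s i) (1 + (5 + 3 * length is) * length w)"
    using j(3,5)
  proof (induction w arbitrary: s)
    case Nil
    then have "s = (\<lambda>i. if i = j then r else if i \<in> set is then rev [] @ s i else s i)"
      by auto
    then show ?case using runs_While_exit[of s j "{1, 2}" ?B] Nil j(4) by simp
  next
    case (Cons a w)
    define s1 where "s1 = (\<lambda>i. if i = j then w @ r else if i \<in> set is then a # s i else s i)"
    have s1: "s1 = (\<lambda>i. if i \<in> set is then a # (s(j := tl (s j))) i else (s(j := tl (s j))) i)"
      using Cons.prems j by (auto simp: s1_def fun_eq_iff)
    have "runs (Pop j ;; push_all is a) s s1 (1 + 1 + (1 + 3 * length is))"
      unfolding s1 by (rule runs_Seq runs_Pop runs_push_all j(2))+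
    then have "runs ?B s s1 (1 + (1 + 1 + (1 + 3 * length is)))"
      using Cons.prems by (intro runs_Ite) (auto split: if_splits)
    moreover have "runs (While j {1, 2} ?B) s1
      (\<lambda>i. if i = j then r else if i \<in> set is then rev w @ s1 i else s1 i) (1 + (5 + 3 * length is) * length w)"
      using Cons.prems by (intro Cons.IH) (auto simp: s1_def)
    moreover have "(\<lambda>i. if i = j then r else if i \<in> set is then rev w @ s1 i else s1 i) =
        (\<lambda>i. if i = j then r else if i \<in> set is then rev (a # w) @ s i else s i)"
      using j(1) by (auto simp: s1_def fun_eq_iff)
    ultimately have "runs (While j {1, 2} ?B) s
      (\<lambda>i. if i = j then r else if i \<in> set is then rev (a # w) @ s i else s i)
      (1 + (1 + (1 + 1 + (1 + 3 * length is))) + (1 + (5 + 3 * length is) * length w))"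
      using Cons.prems by (intro runs_While_iter) auto
    then show ?case by (auto elim: runs_mono)
  qed
  from runs_Seq[OF this runs_Pop[of j]]
  have "runs (move_block j is) s
     ((\<lambda>i. if i = j then r else if i \<in> set is then rev w @ s i else s i)(j := tl r))
     (1 + (1 + (5 + 3 * length is) * length w) + 1)"
    by (simp add: move_block_def)
  moreover have "((\<lambda>i. if i = j then r else if i \<in> set is then rev w @ s i else s i)(j := tl r)) =
     (\<lambda>i. if i = j then tl r else if i \<in> set is then rev w @ s i else s i)"
    by auto
  ultimately show ?thesis by (auto elim: runs_mono)
qed

lemma runs_move_block:
  assumes "j \<notin> set is" "distinct is" "s j = w @ 3 # r" "set w \<subseteq> {1, 2}"
  shows "runs (move_block j is) s (\<lambda>i. if i = j then r else if i \<in> set is then rev w @ s i else s i)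
    (3 + (5 + 3 * length is) * length w)"
  using runs_move_block_end[of j "is" s w "3 # r", unfolded list.sel] assms by simp

lemma rev_code_block: "set (rev (tree_code t)) \<subseteq> {1, 2}" "set (rev (code x)) \<subseteq> {1, 2}"
   "set (code x) \<subseteq> {1, 2}"
  using set_code by (auto simp: code_def)

text \<open>Every transfer reverses, so a copy arrives correctly oriented after an even number of
  them: the first takes the route 0, 1, 0 and the second the route 0, 1, 2, 1, 0.\<close>

definition dup :: com where
  "dup = Push 1 3 ;; Push 2 3 ;; move_tree 0 1 ;; move_block 1 [0, 2] ;; Push 1 3 ;; move_block 2 [1] ;;
     move_block 1 [0]"

lemma runs_dup:
  assumes "s 0 = code x @ r"
  shows "runs dup s (s(0 := code x @ code x @ r)) (60 + 60 * sz x)"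
proof -
  define s1 where "s1 = s(1 := 3 # s 1)"
  define s2 where "s2 = s1(2 := 3 # s1 2)"
  define s3 where "s3 = s2(0 := r, 1 := rev (code x) @ s2 1)"
  define s4 where "s4 = (\<lambda>i. if i = 1 then s 1 else if i \<in> set [0, 2] then rev (rev (code x)) @ s3 i else s3 i)"
  define s5 where "s5 = s4(1 := 3 # s4 1)"
  define s6 where "s6 = (\<lambda>i. if i = 2 then s 2 else if i \<in> set [1] then rev (code x) @ s5 i else s5 i)"
  define s7 where "s7 = (\<lambda>i. if i = 1 then s 1 else if i \<in> set [0] then rev (rev (code x)) @ s6 i else s6 i)"
  have 3: "runs (move_tree 0 1) s2 s3 (10 + 10 * sz x)"
    unfolding s3_def code_def sz_def
    by (rule runs_move_tree) (use assms in \<open>simp_all add: s2_def s1_def code_def\<close>)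
  have 4: "runs (move_block 1 [0, 2]) s3 s4 (3 + (5 + 3 * length [0, 2::nat]) * length (rev (code x)))"
    unfolding s4_def by (rule runs_move_block) (use rev_code_block in \<open>auto simp: s3_def s2_def s1_def\<close>)
  have 6: "runs (move_block 2 [1]) s5 s6 (3 + (5 + 3 * length [1::nat]) * length (code x))"
    unfolding s6_def by (rule runs_move_block) (use rev_code_block in \<open>auto simp: s5_def s4_def s3_def s2_def s1_def\<close>)
  have 7: "runs (move_block 1 [0]) s6 s7 (3 + (5 + 3 * length [0::nat]) * length (rev (code x)))"
    unfolding s7_def by (rule runs_move_block) (use rev_code_block in \<open>auto simp: s6_def s5_def s4_def\<close>)
  have "s7 = s(0 := code x @ code x @ r)"
    by (auto simp: s7_def s6_def s5_def s4_def s3_def s2_def s1_def fun_eq_iff)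
  moreover have "runs dup s s7 (60 + 60 * sz x)"
    unfolding dup_def
    by (rule runs_mono, (rule runs_Seq runs_Push[of 1 3 s, folded s1_def] runs_Push[of 2 3 s1, folded s2_def]
       3 4 runs_Push[of 1 3 s4, folded s5_def] 6 7)+) (simp add: sz_def)
  ultimately show ?thesis by simp
qed

definition swap :: com where
  "swap = Push 1 3 ;; Push 2 3 ;; move_tree 0 1 ;; move_tree 0 2 ;; move_block 1 [0] ;; move_block 2 [0]"

lemma runs_swap:
  assumes "s 0 = code x @ code y @ r"
  shows "runs swap s (s(0 := code y @ code x @ r)) (60 + 60 * (sz x + sz y))"
proof -
  define s1 where "s1 = s(1 := 3 # s 1)"
  define s2 where "s2 = s1(2 := 3 # s1 2)"
  define s3 where "s3 = s2(0 := code y @ r, 1 := rev (code x) @ s2 1)"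
  define s4 where "s4 = s3(0 := r, 2 := rev (code y) @ s3 2)"
  define s5 where "s5 = (\<lambda>i. if i = 1 then s 1 else if i \<in> set [0] then rev (rev (code x)) @ s4 i else s4 i)"
  define s6 where "s6 = (\<lambda>i. if i = 2 then s 2 else if i \<in> set [0] then rev (rev (code y)) @ s5 i else s5 i)"
  have 3: "runs (move_tree 0 1) s2 s3 (10 + 10 * sz x)"
    unfolding s3_def code_def sz_def
    by (rule runs_move_tree) (use assms in \<open>simp_all add: s2_def s1_def code_def\<close>)
  have 4: "runs (move_tree 0 2) s3 s4 (10 + 10 * sz y)"
    unfolding s4_def code_def sz_def
    by (rule runs_move_tree) (use assms in \<open>simp_all add: s3_def code_def\<close>)
  have 5: "runs (move_block 1 [0]) s4 s5 (3 + (5 + 3 * length [0::nat]) * length (rev (code x)))"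
    unfolding s5_def by (rule runs_move_block) (use rev_code_block in \<open>auto simp: s4_def s3_def s2_def s1_def\<close>)
  have 6: "runs (move_block 2 [0]) s5 s6 (3 + (5 + 3 * length [0::nat]) * length (rev (code y)))"
    unfolding s6_def by (rule runs_move_block) (use rev_code_block in \<open>auto simp: s5_def s4_def s3_def s2_def s1_def\<close>)
  have "s6 = s(0 := code y @ code x @ r)"
    by (auto simp: s6_def s5_def s4_def s3_def s2_def s1_def fun_eq_iff)
  moreover have "runs swap s s6 (60 + 60 * (sz x + sz y))"
    unfolding swap_def
    by (rule runs_mono, (rule runs_Seq runs_Push[of 1 3 s, folded s1_def] runs_Push[of 2 3 s1, folded s2_def]
       3 4 5 6)+) (simp add: sz_def)
  ultimately show ?thesis by simp
qed

definition drop_tree :: com where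
  "drop_tree = Push 1 3 ;; move_tree 0 1 ;; move_block 1 []"

lemma runs_drop_tree:
  assumes "s 0 = code x @ r"
  shows "runs drop_tree s (s(0 := r)) (60 + 60 * sz x)"
proof -
  define s1 where "s1 = s(1 := 3 # s 1)"
  define s3 where "s3 = s1(0 := r, 1 := rev (code x) @ s1 1)"
  define s4 where "s4 = (\<lambda>i. if i = 1 then s 1 else if i \<in> set [] then rev (rev (code x)) @ s3 i else s3 i)"
  have 3: "runs (move_tree 0 1) s1 s3 (10 + 10 * sz x)"
    unfolding s3_def code_def sz_def
    by (rule runs_move_tree) (use assms in \<open>simp_all add: s1_def code_def\<close>)
  have 4: "runs (move_block 1 []) s3 s4 (3 + (5 + 3 * length ([]::nat list)) * length (rev (code x)))"
    unfolding s4_def by (rule runs_move_block) (use rev_code_block in \<open>auto simp: s3_def s1_def\<close>)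
  have "s4 = s(0 := r)"
    by (auto simp: s4_def s3_def s1_def fun_eq_iff)
  moreover have "runs drop_tree s s4 (60 + 60 * sz x)"
    unfolding drop_tree_def
    by (rule runs_mono, (rule runs_Seq runs_Push[of 1 3 s, folded s1_def] 3 4)+) (simp add: sz_def)
  ultimately show ?thesis by simp
qed

lemma wf_library [simp]: "wf_com dup" "wf_com swap" "wf_com drop_tree"
  by (simp_all add: dup_def swap_def drop_tree_def move_tree_def move_block_def)

section \<open>Closure properties of polynomial-time functions\<close>

text \<open>When all stores are updates of stack 0, final and initial stores unify, so programs are
  chained by applying rules, and the total time is assembled by unification.\<close>

lemma implementsI:
  "wf_com c \<Longrightarrow> (\<And>x r s. runs c (s(0 := code x @ r)) (s(0 := code (f x) @ r)) (T x)) \<Longrightarrow> implements c f T"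
  unfolding implements_def by (metis fun_upd_triv)

lemma implementsD:
  "implements c f T \<Longrightarrow> runs c (s(0 := code x @ r)) (s(0 := code (f x) @ r)) (T x)"
  unfolding implements_def by (metis fun_upd_same fun_upd_upd)

lemma runs_dup': "runs dup (s(0 := code x @ r)) (s(0 := code x @ code x @ r)) (60 + 60 * sz x)"
  using runs_dup[of "s(0 := code x @ r)" x r] by (simp only: fun_upd_same fun_upd_upd)

lemma runs_swap':
  "runs swap (s(0 := code x @ code y @ r)) (s(0 := code y @ code x @ r)) (60 + 60 * (sz x + sz y))"
  using runs_swap[of "s(0 := code x @ code y @ r)" x y r] by (simp only: fun_upd_same fun_upd_upd)

lemma runs_drop_tree': "runs drop_tree (s(0 := code x @ r)) (s(0 := r)) (60 + 60 * sz x)"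
  using runs_drop_tree[of "s(0 := code x @ r)" x r] by (simp only: fun_upd_same fun_upd_upd)

lemma runs_Pop': "runs (Pop 0) (s(0 := a # w)) (s(0 := w)) 1"
  using runs_Pop[of 0 "s(0 := a # w)"] by (simp del: fun_upd_apply add: fun_upd_same)

lemma runs_Push': "runs (Push 0 a) (s(0 := w)) (s(0 := a # w)) 2"
  using runs_Push[of 0 a "s(0 := w)"] by (simp del: fun_upd_apply add: fun_upd_same)

lemmas stack_rules = runs_Seq runs_dup' runs_swap' runs_drop_tree' runs_Pop' runs_Push'
lemmas poly_bounded_intros = poly_bounded_const poly_bounded_add poly_bounded_mult poly_bounded_sz poly_bounded_poly

lemma ptimeE:
  assumes "ptime f"
  obtains c p where "wf_com c" "implements c f (\<lambda>x. poly p (sz x))"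
proof -
  obtain c T p where 1: "implements c f T" "\<And>x. T x \<le> poly p (sz x)"
    using assms by (auto simp: ptime_def poly_bounded_def)
  then have "wf_com c" by (simp add: implements_def)
  moreover have "implements c f (\<lambda>x. poly p (sz x))"
    using 1 unfolding implements_def by (meson runs_mono)
  ultimately show ?thesis using that by blast
qed

lemma exec_length: "exec c s t s' \<Longrightarrow> length (s' i) \<le> length (s i) + t"
  by (induction rule: exec.induct) auto

text \<open>A step pushes at most one symbol, hence a result is longer than its argument by at most
  the running time. Size bounds thus come for free from membership in \<open>ptime\<close>.\<close>

lemma poly_bounded_output: "ptime f \<Longrightarrow> poly_bounded (\<lambda>x. sz (f x))"
proof (elim ptimeE)
  fix c p assume c: "implements c f (\<lambda>x. poly p (sz x))"
  have "sz (f x) \<le> sz x + poly p (sz x)" for x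
  proof -
    have "runs c ((\<lambda>_. [])(0 := code x @ [])) ((\<lambda>_. [])(0 := code (f x) @ [])) (poly p (sz x))"
      using c by (rule implementsD)
    then obtain t where t: "t \<le> poly p (sz x)"
        "exec c ((\<lambda>_. [])(0 := code x @ [])) t ((\<lambda>_. [])(0 := code (f x) @ []))"
      unfolding runs_def by blast
    show ?thesis using exec_length[OF t(2), of 0] t(1) by (simp add: sz_def)
  qed
  then show ?thesis
    by (rule poly_bounded_mono[rotated]) (intro poly_bounded_intros)
qed

lemma poly_bounded_Suc: "poly_bounded T \<Longrightarrow> poly_bounded (\<lambda>x. Suc (T x))"
  using poly_bounded_add[OF poly_bounded_const[of 1]] by simp

lemma ptime_id [ptime_intros]: "ptime (\<lambda>x. x)"
  by (rule ptimeI[of "\<lambda>_. 1" Skip]) (auto intro!: poly_bounded_intros implementsI runs_Skip[unfolded One_nat_def])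

text \<open>Programs see only trees. A nonempty list shares its tree with the pair of head and tail,
  an option with a list of at most one element, and a number with its list of digits, so conversions
  between these types cost nothing.\<close>

lemma ptime_cast: "ptime f \<Longrightarrow> (\<And>x. tree_of (g x) = tree_of (f x)) \<Longrightarrow> ptime g"
  by (simp add: ptime_def implements_def code_def)

lemma ptime_comp:
  assumes "ptime g" "ptime f"
  shows "ptime (\<lambda>x. g (f x))"
proof -
  obtain c p where g: "wf_com c" "implements c g (\<lambda>x. poly p (sz x))" by (rule ptimeE[OF assms(1)])
  obtain d q where f: "wf_com d" "implements d f (\<lambda>x. poly q (sz x))" by (rule ptimeE[OF assms(2)])
  have "implements (d ;; c) (\<lambda>x. g (f x)) (\<lambda>x. 1 + poly q (sz x) + poly p (sz (f x)))"
    by (rule implementsI) (use g f in simp, rule runs_Seq[OF implementsD[OF f(2)] implementsD[OF g(2)]])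
  then show ?thesis
    by (rule ptimeI[rotated]) (intro poly_bounded_intros poly_bounded_output assms)
qed

text \<open>From the top, stack 0 successively holds \<open>x, x\<close>; then
  \<open>f x, x\<close>; then \<open>x, f x\<close>; then \<open>g x, f x\<close>; then
  \<open>f x, g x\<close>. The final 2 is the node that joins the two values.\<close>

lemma ptime_Pair [ptime_intros]:
  assumes "ptime f" "ptime g"
  shows "ptime (\<lambda>x. (f x, g x))"
proof -
  obtain c p where f: "wf_com c" "implements c f (\<lambda>x. poly p (sz x))" by (rule ptimeE[OF assms(1)])
  obtain d q where g: "wf_com d" "implements d g (\<lambda>x. poly q (sz x))" by (rule ptimeE[OF assms(2)])
  let ?c = "dup ;; c ;; swap ;; d ;; swap ;; Push 0 2"
  let ?T = "\<lambda>x. 187 + 60 * sz x + poly p (sz x) + 60 * (sz (f x) + sz x) + poly q (sz x) + 60 * (sz (g x) + sz (f x))"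
  have "runs ?c (s(0 := code x @ r)) (s(0 := code (f x, g x) @ r)) (?T x)" for x r s
    unfolding code_simps append_Cons append_assoc
    by (rule runs_mono, (rule stack_rules implementsD[OF f(2)] implementsD[OF g(2)])+) simp
  then have "implements ?c (\<lambda>x. (f x, g x)) ?T"
    using f g by (intro implementsI) auto
  then show ?thesis
    by (rule ptimeI[rotated]) (intro poly_bounded_intros poly_bounded_output assms)
qed

lemma ptime_fst [ptime_intros]:
  assumes "ptime f"
  shows "ptime (\<lambda>x. fst (f x))"
proof (rule ptime_comp[OF _ assms])
  have "runs (Pop 0 ;; swap ;; drop_tree) (s(0 := code x @ r)) (s(0 := code (fst x) @ r)) (123 + 120 * sz x)"
    for x :: "'b \<times> 'c" and r s
    by (cases x, simp only: code_simps append_Cons append_assoc fst_conv,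
        rule runs_mono, (rule stack_rules)+) simp
  then have "implements (Pop 0 ;; swap ;; drop_tree) (fst :: 'b \<times> 'c \<Rightarrow> 'b) (\<lambda>x. 123 + 120 * sz x)"
    by (intro implementsI) auto
  then show "ptime (fst :: 'b \<times> 'c \<Rightarrow> 'b)"
    by (rule ptimeI[rotated]) (intro poly_bounded_intros)
qed

lemma ptime_snd [ptime_intros]:
  assumes "ptime f"
  shows "ptime (\<lambda>x. snd (f x))"
proof (rule ptime_comp[OF _ assms])
  have "runs (Pop 0 ;; drop_tree) (s(0 := code x @ r)) (s(0 := code (snd x) @ r)) (62 + 60 * sz x)"
    for x :: "'b \<times> 'c" and r s
    by (cases x, simp only: code_simps append_Cons append_assoc snd_conv,
        rule runs_mono, (rule stack_rules)+) simp
  then have "implements (Pop 0 ;; drop_tree) (snd :: 'b \<times> 'c \<Rightarrow> 'c) (\<lambda>x. 62 + 60 * sz x)"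
    by (intro implementsI) auto
  then show "ptime (snd :: 'b \<times> 'c \<Rightarrow> 'c)"
    by (rule ptimeI[rotated]) (intro poly_bounded_intros)
qed

primrec push_list :: "nat list \<Rightarrow> com" where
  "push_list [] = Skip"
| "push_list (a # w) = push_list w ;; Push 0 a"

lemma runs_push_list: "runs (push_list w) (s(0 := r)) (s(0 := w @ r)) (1 + 3 * length w)"
proof (induction w)
  case (Cons a w)
  from runs_Seq[OF Cons runs_Push'[of a s "w @ r"]] show ?case
    by (auto elim: runs_mono simp del: fun_upd_apply)
qed (use runs_Skip in simp)

lemma wf_push_list: "set w \<subseteq> {1, 2} \<Longrightarrow> wf_com (push_list w)"
  by (induction w) auto

lemma ptime_const [ptime_intros]: "ptime (\<lambda>_. y)"
proof -
  have "implements (drop_tree ;; push_list (code y)) (\<lambda>_. y) (\<lambda>x. 1 + (60 + 60 * sz x) + (1 + 3 * length (code y)))"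
    by (intro implementsI runs_Seq[OF runs_drop_tree' runs_push_list])
      (use wf_push_list[OF rev_code_block(3), of y] in auto)
  then show ?thesis
    by (rule ptimeI[rotated]) (intro poly_bounded_intros)
qed

lemma ptime_if [ptime_intros]:
  assumes "ptime P" "ptime f" "ptime g"
  shows "ptime (\<lambda>x. if P x then f x else g x)"
proof -
  obtain e u where P: "wf_com e" "implements e P (\<lambda>x. poly u (sz x))" by (rule ptimeE[OF assms(1)])
  obtain c p where f: "wf_com c" "implements c f (\<lambda>x. poly p (sz x))" by (rule ptimeE[OF assms(2)])
  obtain d q where g: "wf_com d" "implements d g (\<lambda>x. poly q (sz x))" by (rule ptimeE[OF assms(3)])
  \<comment> \<open>The truth value must be removed before a branch starts: the code of
    \<open>True\<close> has three symbols, that of \<open>False\<close> only one.\<close>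
  let ?I = "Ite 0 {2} (Pop 0 ;; Pop 0 ;; Pop 0 ;; c) (Pop 0 ;; d)"
  let ?T = "\<lambda>x. 90 + 60 * sz x + poly u (sz x) + poly p (sz x) + poly q (sz x)"
  have "runs (dup ;; e ;; ?I) (s(0 := code x @ r)) (s(0 := code (if P x then f x else g x) @ r)) (?T x)" for x r s
  proof -
    have "runs ?I (s(0 := code (P x) @ code x @ r)) (s(0 := code (if P x then f x else g x) @ r))
      (10 + poly p (sz x) + poly q (sz x))"
    proof (cases "P x")
      case True
      have "runs (Pop 0 ;; Pop 0 ;; Pop 0 ;; c) (s(0 := code (P x) @ code x @ r)) (s(0 := code (f x) @ r))
          (1 + 1 + (1 + 1 + (1 + 1 + poly p (sz x))))"
        using True by (simp only: code_simps append_Cons append_Nil) (rule stack_rules implementsD[OF f(2)])+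
      then have "runs ?I (s(0 := code (P x) @ code x @ r)) (s(0 := code (f x) @ r))
          (1 + (1 + 1 + (1 + 1 + (1 + 1 + poly p (sz x)))))"
        by (rule runs_Ite_True[rotated]) (simp add: True)
      then show ?thesis using True by (auto elim!: runs_mono simp del: fun_upd_apply)
    next
      case False
      then have "runs (Pop 0 ;; d) (s(0 := code (P x) @ code x @ r)) (s(0 := code (g x) @ r))
          (1 + 1 + poly q (sz x))"
        by (simp only: code_simps append_Cons append_Nil) (rule stack_rules implementsD[OF g(2)])+
      then have "runs ?I (s(0 := code (P x) @ code x @ r)) (s(0 := code (g x) @ r)) (1 + (1 + 1 + poly q (sz x)))"
        by (rule runs_Ite_False[rotated]) (simp add: False)
      then show ?thesis using False by (auto elim!: runs_mono simp del: fun_upd_apply)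
    qed
    then show ?thesis
      by - (rule runs_mono, (rule stack_rules implementsD[OF P(2)] | assumption)+, simp)
  qed
  then have "implements (dup ;; e ;; ?I) (\<lambda>x. if P x then f x else g x) ?T"
    using f g P by (intro implementsI) auto
  then show ?thesis
    by (rule ptimeI[rotated]) (intro poly_bounded_intros)
qed

lemma ptime_case_list [ptime_intros]:
  assumes "ptime l" "ptime f" "ptime (\<lambda>z. g (fst z) (fst (snd z)) (snd (snd z)))"
  shows "ptime (\<lambda>x. case l x of [] \<Rightarrow> f x | y # ys \<Rightarrow> g x y ys)"
proof -
  obtain e u where l: "wf_com e" "implements e l (\<lambda>x. poly u (sz x))" by (rule ptimeE[OF assms(1)])
  obtain c p where f: "wf_com c" "implements c f (\<lambda>x. poly p (sz x))" by (rule ptimeE[OF assms(2)])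
  obtain d q where g: "wf_com d"
    "implements d (\<lambda>z. g (fst z) (fst (snd z)) (snd (snd z))) (\<lambda>x. poly q (sz x))" by (rule ptimeE[OF assms(3)])
  let ?I = "Ite 0 {1} (Pop 0 ;; c) (swap ;; Push 0 2 ;; d)"
  let ?h = "\<lambda>x. case l x of [] \<Rightarrow> f x | y # ys \<Rightarrow> g x y ys"
  let ?T = "\<lambda>x. 150 + 120 * sz x + 60 * sz (l x) + poly u (sz x) + poly p (sz x) + poly q (1 + sz x + sz (l x))"
  have "runs (dup ;; e ;; ?I) (s(0 := code x @ r)) (s(0 := code (?h x) @ r)) (?T x)" for x r s
  proof -
    have "runs ?I (s(0 := code (l x) @ code x @ r)) (s(0 := code (?h x) @ r))
      (80 + 60 * (sz x + sz (l x)) + poly p (sz x) + poly q (1 + sz x + sz (l x)))"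
    proof (cases "l x")
      case Nil
      have "runs (Pop 0 ;; c) (s(0 := code (l x) @ code x @ r)) (s(0 := code (f x) @ r)) (1 + 1 + poly p (sz x))"
        unfolding Nil by (simp only: code_simps append_Cons append_Nil) (rule stack_rules implementsD[OF f(2)])+
      then have "runs ?I (s(0 := code (l x) @ code x @ r)) (s(0 := code (f x) @ r)) (1 + (1 + 1 + poly p (sz x)))"
        by (rule runs_Ite_True[rotated]) (simp add: Nil)
      then show ?thesis using Nil by (auto elim!: runs_mono simp del: fun_upd_apply)
    next
      case (Cons y ys)
      \<comment> \<open>A cons cell is passed on as the pair of head and tail without being taken
        apart; one more symbol 2 pairs it with \<open>x\<close>.\<close>
      have eq: "code (l x) = code (y, ys)" "sz (l x) = sz (y, ys)" by (simp_all add: Cons)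
      have 1: "s(0 := 2 # code x @ code (y, ys) @ r) = s(0 := code (x, (y, ys)) @ r)" by simp
      have "runs (swap ;; Push 0 2 ;; d) (s(0 := code (l x) @ code x @ r)) (s(0 := code (g x y ys) @ r))
         (1 + (60 + 60 * (sz (y, ys) + sz x)) + (1 + 2 + poly q (sz (x, (y, ys)))))"
        unfolding eq using implementsD[OF g(2), of s "(x, (y, ys))" r]
        by (intro runs_Seq[OF runs_swap' runs_Seq[OF runs_Push']]) (simp only: 1 fst_conv snd_conv)
      then have "runs ?I (s(0 := code (l x) @ code x @ r)) (s(0 := code (g x y ys) @ r))
         (1 + (1 + (60 + 60 * (sz (y, ys) + sz x)) + (1 + 2 + poly q (sz (x, (y, ys))))))"
        by (rule runs_Ite_False[rotated]) (simp add: Cons)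
      then show ?thesis using Cons by (auto elim!: runs_mono simp del: fun_upd_apply)
    qed
    then show ?thesis
      by - (rule runs_mono, (rule stack_rules implementsD[OF l(2)] | assumption)+, simp)
  qed
  then have "implements (dup ;; e ;; ?I) ?h ?T"
    using f g l by (intro implementsI) auto
  then show ?thesis
    by (rule ptimeI[rotated]) (intro poly_bounded_intros poly_bounded_output assms)
qed

lemma ptime_case_option [ptime_intros]:
  assumes "ptime l" "ptime f" "ptime (\<lambda>z. g (fst z) (snd z))"
  shows "ptime (\<lambda>x. case l x of None \<Rightarrow> f x | Some y \<Rightarrow> g x y)"
proof -
  let ?l = "\<lambda>x. case l x of None \<Rightarrow> [] | Some y \<Rightarrow> [y]"
  have "ptime ?l" using assms(1) by (rule ptime_cast) (simp split: option.splits)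
  moreover have "ptime (\<lambda>z. (fst z, fst (snd z)))" by (intro ptime_intros)
  then have "ptime (\<lambda>z. g (fst z) (fst (snd z)))" using ptime_comp[OF assms(3)] by fastforce
  ultimately have "ptime (\<lambda>x. case ?l x of [] \<Rightarrow> f x | y # ys \<Rightarrow> g x y)"
    using assms(2) by (intro ptime_case_list)
  moreover have "(\<lambda>x. case ?l x of [] \<Rightarrow> f x | y # ys \<Rightarrow> g x y) = (\<lambda>x. case l x of None \<Rightarrow> f x | Some y \<Rightarrow> g x y)"
    by (auto split: option.splits)
  ultimately show ?thesis by simp
qed

lemma ptime_Cons [ptime_intros]: "ptime f \<Longrightarrow> ptime g \<Longrightarrow> ptime (\<lambda>x. f x # g x)"
  by (rule ptime_cast[OF ptime_Pair[of f g]]) (simp_all add: tree_of_prod_def)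

lemma ptime_Some [ptime_intros]: "ptime f \<Longrightarrow> ptime (\<lambda>x. Some (f x))"
  by (rule ptime_cast[OF ptime_Cons[OF _ ptime_const[of "[]"]]]) simp_all

text \<open>Few rounds alone do not suffice, since a step that doubles its argument produces
  exponentially long values. Therefore \<open>S\<close> bounds every intermediate value, in terms of
  the initial argument.\<close>

lemma ptime_while:
  fixes h :: "'a::data \<Rightarrow> 'a"
  assumes "ptime P" "ptime h" "ptime i" "poly_bounded N" "poly_bounded S"
    and n: "\<And>x. n x \<le> N x" "\<And>x k. k < n x \<Longrightarrow> P ((h ^^ k) (i x))" "\<And>x. \<not> P ((h ^^ n x) (i x))"
    and S: "\<And>x k. k \<le> n x \<Longrightarrow> sz ((h ^^ k) (i x)) \<le> S x"
  shows "ptime (\<lambda>x. (h ^^ n x) (i x))"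
proof -
  obtain e u where P: "wf_com e" "implements e P (\<lambda>x. poly u (sz x))" by (rule ptimeE[OF assms(1)])
  obtain c p where h: "wf_com c" "implements c h (\<lambda>x. poly p (sz x))" by (rule ptimeE[OF assms(2)])
  obtain d q where i: "wf_com d" "implements d i (\<lambda>x. poly q (sz x))" by (rule ptimeE[OF assms(3)])
  let ?B = "Pop 0 ;; Pop 0 ;; Pop 0 ;; c ;; dup ;; e"
  let ?W = "While 0 {2} ?B"
  \<comment> \<open>Bounds the cost of one round, namely three pops, the body, a copy and the next
    test, for a state of size at most \<open>S x\<close>.\<close>
  define K where "K = (\<lambda>x. 100 + poly p (S x) + 60 * S x + poly u (S x))"
  have loop: "runs ?W (s(0 := code (P y) @ code y @ r)) (s(0 := code False @ code ((h ^^ m) y) @ r)) (1 + m * K x)"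
    if "\<And>k. k < m \<Longrightarrow> P ((h ^^ k) y)" "\<not> P ((h ^^ m) y)" "\<And>k. k \<le> m \<Longrightarrow> sz ((h ^^ k) y) \<le> S x" for m x y r s
    using that
  proof (induction m arbitrary: y)
    case 0
    then show ?case by (auto intro!: runs_While_exit[unfolded One_nat_def])
  next
    case (Suc m)
    have "P y" using Suc.prems(1)[of 0] by simp
    have sz: "sz y \<le> S x" "sz (h y) \<le> S x" using Suc.prems(3)[of 0] Suc.prems(3)[of 1] by simp_all
    have "runs ?B (s(0 := code (P y) @ code y @ r)) (s(0 := code (P (h y)) @ code (h y) @ r))
        (1 + 1 + (1 + 1 + (1 + 1 + (1 + poly p (sz y) + (1 + (60 + 60 * sz (h y)) + poly u (sz (h y)))))))"
      using \<open>P y\<close> by (simp only: code_simps append_Cons append_Nil)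
        (rule stack_rules implementsD[OF h(2)] implementsD[OF P(2)])+
    then have B: "runs ?B (s(0 := code (P y) @ code y @ r)) (s(0 := code (P (h y)) @ code (h y) @ r)) (90 + poly p (S x) + 60 * S x + poly u (S x))"
      using poly_mono_nat[OF sz(1), of p] poly_mono_nat[OF sz(2), of u] sz by (auto elim!: runs_mono)
    have "runs ?W (s(0 := code (P (h y)) @ code (h y) @ r))
        (s(0 := code False @ code ((h ^^ m) (h y)) @ r)) (1 + m * K x)"
      using Suc.prems(1)[of "Suc _"] Suc.prems(2) Suc.prems(3)[of "Suc _"]
      by (intro Suc.IH) (simp_all add: funpow_swap1)
    then have "runs ?W (s(0 := code (P y) @ code y @ r))
        (s(0 := code False @ code ((h ^^ m) (h y)) @ r))
        (1 + (90 + poly p (S x) + 60 * S x + poly u (S x)) + (1 + m * K x))"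
      using \<open>P y\<close> by (intro runs_While_iter[OF _ B]) simp_all
    then show ?case by (auto elim!: runs_mono simp: funpow_swap1 K_def simp del: fun_upd_apply)
  qed
  let ?c = "d ;; dup ;; e ;; ?W ;; Pop 0"
  let ?T = "\<lambda>x. 100 + poly q (sz x) + 60 * S x + poly u (S x) + N x * K x"
  have "runs ?c (s(0 := code x @ r)) (s(0 := code ((h ^^ n x) (i x)) @ r)) (?T x)" for x r s
  proof -
    have W: "runs ?W (s(0 := code (P (i x)) @ code (i x) @ r))
        (s(0 := code False @ code ((h ^^ n x) (i x)) @ r)) (1 + n x * K x)"
      using n S by (intro loop) auto
    have "runs (Pop 0) (s(0 := code False @ code ((h ^^ n x) (i x)) @ r)) (s(0 := code ((h ^^ n x) (i x)) @ r)) 1"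
      by (simp only: code_simps append_Cons append_Nil) (rule runs_Pop')
    note * = runs_Seq[OF W this]
    have "runs ?c (s(0 := code x @ r)) (s(0 := code ((h ^^ n x) (i x)) @ r))
       (1 + poly q (sz x) + (1 + (60 + 60 * sz (i x)) + (1 + poly u (sz (i x)) + (1 + (1 + n x * K x) + 1))))"
      by (intro runs_Seq[OF implementsD[OF i(2)]] runs_Seq[OF runs_dup'] runs_Seq[OF implementsD[OF P(2)]] *)
    moreover have "sz (i x) \<le> S x" using S[of 0 x] by simp
    moreover from this have "poly u (sz (i x)) \<le> poly u (S x)" by (rule poly_mono_nat)
    moreover have "n x * K x \<le> N x * K x" using n by simp
    ultimately show ?thesis by (elim runs_mono) linarith
  qed
  then have "implements ?c (\<lambda>x. (h ^^ n x) (i x)) ?T"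
    using h i P by (intro implementsI) auto
  then show ?thesis
    by (rule ptimeI[rotated]) (unfold K_def, intro poly_bounded_intros assms)
qed

section \<open>Folds over lists\<close>

lemma sz_drop: "sz (drop k xs) \<le> sz xs"
  by (induction xs arbitrary: k) (auto simp: drop_Cons split: nat.splits intro: le_SucI trans_le_add2)

text \<open>The loop state consists of the parameter \<open>x\<close>, the remaining list and the
  accumulator. The list shrinks in every round and thereby counts the rounds, so only the
  accumulator needs a size bound.\<close>

lemma ptime_fold_bounded:
  assumes "ptime l" "ptime i" "ptime (\<lambda>z. g (fst z) (fst (snd z)) (snd (snd z)))" "poly_bounded b"
    and b: "\<And>x k. k \<le> length (l x) \<Longrightarrow> sz (fold (g x) (take k (l x)) (i x)) \<le> b x"
  shows "ptime (\<lambda>x. fold (g x) (l x) (i x))"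
proof -
  define h where "h = (\<lambda>z. case fst (snd z) of [] \<Rightarrow> z | y # ys \<Rightarrow> (fst z, ys, g (fst z) y (snd (snd z))))"
  have h: "(h ^^ k) (x, xs, s) = (x, drop k xs, fold (g x) (take k xs) s)" if "k \<le> length xs" for k x xs s
    using that
  proof (induction k arbitrary: xs s)
    case (Suc k)
    then obtain y ys where "xs = y # ys" by (cases xs) auto
    moreover have "h (x, y # ys, s) = (x, ys, g x y s)" by (simp add: h_def)
    ultimately show ?case using Suc by (simp add: funpow_Suc_right del: funpow.simps)
  qed simp
  have "ptime (\<lambda>x. (h ^^ length (l x)) (x, l x, i x))"
  proof (rule ptime_while[where P = "\<lambda>z. case fst (snd z) of [] \<Rightarrow> False | _ \<Rightarrow> True"
        and N = "\<lambda>x. sz (l x)" and S = "\<lambda>x. 2 + sz x + sz (l x) + b x"])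
    have "ptime (\<lambda>x. (fst (fst x), (fst (snd x), snd (snd (fst x)))))" by (intro ptime_intros)
    from ptime_comp[OF assms(3) this]
    have "ptime (\<lambda>x. g (fst (fst x)) (fst (snd x)) (snd (snd (fst x))))" by simp
    then show "ptime h" unfolding h_def by (intro ptime_intros)
    show "ptime (\<lambda>z. case fst (snd z) of [] \<Rightarrow> False | _ \<Rightarrow> True)" by (intro ptime_intros)
    show "ptime (\<lambda>x. (x, l x, i x))" using assms by (intro ptime_intros)
    show "poly_bounded (\<lambda>x. sz (l x))" using assms by (intro poly_bounded_output)
    then show "poly_bounded (\<lambda>x. 2 + sz x + sz (l x) + b x)" using assms by (intro poly_bounded_intros)
    show "length (l x) \<le> sz (l x)" for x by (rule length_le_sz)
    show "case fst (snd ((h ^^ k) (x, l x, i x))) of [] \<Rightarrow> False | _ \<Rightarrow> True" if "k < length (l x)" for x k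
      using that h[of k "l x" x "i x"] by (auto split: list.splits)
    show "\<not> (case fst (snd ((h ^^ length (l x)) (x, l x, i x))) of [] \<Rightarrow> False | _ \<Rightarrow> True)" for x
      by (simp add: h)
    show "sz ((h ^^ k) (x, l x, i x)) \<le> 2 + sz x + sz (l x) + b x" if "k \<le> length (l x)" for x k
      using that b[of k x] sz_drop[of k "l x"] by (simp add: h)
  qed
  from ptime_snd[OF ptime_snd[OF this]] show ?thesis by (simp add: h)
qed

text \<open>For accumulators whose size is limited by their meaning, such as truth values or partial
  parses, which correspond to pieces of the input.\<close>

lemma ptime_fold_invariant:
  assumes "ptime l" "ptime i" "ptime (\<lambda>z. g (fst z) (fst (snd z)) (snd (snd z)))" "poly_bounded b"
    and "\<And>x. I x (i x)" "\<And>x a s. a \<in> set (l x) \<Longrightarrow> I x s \<Longrightarrow> I x (g x a s)" "\<And>x s. I x s \<Longrightarrow> sz s \<le> b x"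
  shows "ptime (\<lambda>x. fold (g x) (l x) (i x))"
proof (rule ptime_fold_bounded[OF assms(1-4)])
  fix x k assume "k \<le> length (l x)"
  have "I x (fold (g x) xs s)" if "I x s" "set xs \<subseteq> set (l x)" for xs s
    using that assms(6) by (induction xs arbitrary: s) auto
  then show "sz (fold (g x) (take k (l x)) (i x)) \<le> b x"
    using assms(5,7) by (meson set_take_subset)
qed

text \<open>Growth by a summand that does not depend on the accumulator adds up to a polynomial, in
  contrast to growth by a factor.\<close>

lemma ptime_fold_increment:
  assumes "ptime l" "ptime i" "ptime (\<lambda>z. g (fst z) (fst (snd z)) (snd (snd z)))" "poly_bounded b"
    and "\<And>x a s. a \<in> set (l x) \<Longrightarrow> sz (g x a s) \<le> sz s + b x"
  shows "ptime (\<lambda>x. fold (g x) (l x) (i x))"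
proof (rule ptime_fold_bounded[OF assms(1-3), where b = "\<lambda>x. sz (i x) + sz (l x) * b x"])
  show "poly_bounded (\<lambda>x. sz (i x) + sz (l x) * b x)"
    using assms by (intro poly_bounded_intros poly_bounded_output)
  fix x k assume "k \<le> length (l x)"
  have "sz (fold (g x) xs s) \<le> sz s + length xs * b x" if "set xs \<subseteq> set (l x)" for xs s
    using that
  proof (induction xs arbitrary: s)
    case (Cons a xs)
    then have "sz (fold (g x) (a # xs) s) \<le> sz (g x a s) + length xs * b x" by simp
    also have "\<dots> \<le> sz s + b x + length xs * b x" using Cons.prems assms(5) by simp
    finally show ?case by simp
  qed simp
  from this[of "take k (l x)" "i x"]
  have "sz (fold (g x) (take k (l x)) (i x)) \<le> sz (i x) + k * b x"
    using \<open>k \<le> length (l x)\<close> by (simp add: set_take_subset)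
  also have "\<dots> \<le> sz (i x) + sz (l x) * b x"
    using \<open>k \<le> length (l x)\<close> length_le_sz[of "l x"] by simp
  finally show "sz (fold (g x) (take k (l x)) (i x)) \<le> sz (i x) + sz (l x) * b x" .
qed

lemma poly_bounded_elements:
  assumes "ptime (\<lambda>z. g (fst z) (snd z))" "ptime l"
  obtains b where "poly_bounded b" "\<And>x a. a \<in> set (l x) \<Longrightarrow> sz (g x a) \<le> b x"
proof -
  obtain p where p: "\<And>z. sz (g (fst z) (snd z)) \<le> poly p (sz z)"
    using poly_bounded_output[OF assms(1)] unfolding poly_bounded_def by blast
  show ?thesis
  proof
    show "poly_bounded (\<lambda>x. poly p (1 + sz x + sz (l x)))"
      using assms by (intro poly_bounded_intros poly_bounded_output)
    fix x a assume "a \<in> set (l x)"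
    then have "sz (x, a) \<le> 1 + sz x + sz (l x)" using sz_mem by fastforce
    then show "sz (g x a) \<le> poly p (1 + sz x + sz (l x))"
      using le_trans[OF p[of "(x, a)"] poly_mono_nat] by simp
  qed
qed

section \<open>From polynomial-time functions to the class P\<close>

definition symbol :: "bool \<Rightarrow> nat" where
  "symbol b = (if b then 2 else 1)"

text \<open>Raw bits are turned into the code of a list of truth values: a cons contributes 2,
  followed by \<open>[1]\<close> or \<open>[2, 1, 1]\<close>. The detour via stack 1 presents the
  last bit first, so the list grows from its end.\<close>

definition load_input :: com where
  "load_input = Push 1 3 ;; move_block 0 [1] ;; Push 0 1 ;;
     While 1 {1, 2} (Ite 1 {1} (Pop 1 ;; Push 0 1 ;; Push 0 2)
       (Pop 1 ;; Push 0 1 ;; Push 0 1 ;; Push 0 2 ;; Push 0 2)) ;; Pop 1"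

lemma load_input_loop:
  assumes "s 1 = map symbol ys @ 3 # r" "s 0 = code zs"
  defines "B \<equiv> Ite 1 {1} (Pop 1 ;; Push 0 1 ;; Push 0 2)
       (Pop 1 ;; Push 0 1 ;; Push 0 1 ;; Push 0 2 ;; Push 0 2)"
  shows "runs (While 1 {1, 2} B) s (s(1 := 3 # r, 0 := code (rev ys @ zs))) (1 + 16 * length ys)"
  using assms(1,2)
proof (induction ys arbitrary: s zs)
  case Nil
  then have "s(1 := 3 # r, 0 := code (rev [] @ zs)) = s" by auto
  then show ?case using runs_While_exit[of s 1 "{1, 2}" B] Nil by (simp del: fun_upd_apply)
next
  case (Cons b ys)
  define s1 where "s1 = s(1 := map symbol ys @ 3 # r, 0 := code (b # zs))"
  have "runs B s s1 15"
  proof (cases b)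
    case True
    have "s1 = (let s1 = s(1 := tl (s 1)); s2 = s1(0 := 1 # s1 0); s3 = s2(0 := 1 # s2 0); s4 = s3(0 := 2 # s3 0)
        in s4(0 := 2 # s4 0))"
      using Cons.prems True by (auto simp: s1_def Let_def fun_eq_iff)
    then have "runs (Pop 1 ;; Push 0 1 ;; Push 0 1 ;; Push 0 2 ;; Push 0 2) s s1 (1 + 1 + (1 + 2 + (1 + 2 + (1 + 2 + 2))))"
      unfolding Let_def by (simp only:) (rule runs_intros)+
    then have "runs B s s1 (1 + (1 + 1 + (1 + 2 + (1 + 2 + (1 + 2 + 2)))))"
      unfolding B_def by (rule runs_Ite_False[rotated]) (use Cons.prems True in \<open>simp add: symbol_def\<close>)
    then show ?thesis by (auto elim: runs_mono)
  next
    case False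
    have "s1 = (let s1 = s(1 := tl (s 1)); s2 = s1(0 := 1 # s1 0) in s2(0 := 2 # s2 0))"
      using Cons.prems False by (auto simp: s1_def Let_def fun_eq_iff)
    then have "runs (Pop 1 ;; Push 0 1 ;; Push 0 2) s s1 (1 + 1 + (1 + 2 + 2))"
      unfolding Let_def by (simp only:) (rule runs_intros)+
    then have "runs B s s1 (1 + (1 + 1 + (1 + 2 + 2)))"
      unfolding B_def by (rule runs_Ite_True[rotated]) (use Cons.prems False in \<open>simp add: symbol_def\<close>)
    then show ?thesis by (auto elim: runs_mono)
  qed
  moreover have "runs (While 1 {1, 2} B) s1 (s1(1 := 3 # r, 0 := code (rev ys @ b # zs))) (1 + 16 * length ys)"
    by (rule Cons.IH) (simp_all add: s1_def)
  moreover have "s1(1 := 3 # r, 0 := code (rev ys @ b # zs)) = s(1 := 3 # r, 0 := code (rev (b # ys) @ zs))"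
    by (auto simp: s1_def fun_eq_iff)
  moreover have "hd0 (s 1) \<in> {1, 2}" using Cons.prems by (simp add: symbol_def)
  ultimately have "runs (While 1 {1, 2} B) s (s(1 := 3 # r, 0 := code (rev (b # ys) @ zs))) (1 + 15 + (1 + 16 * length ys))"
    by (metis runs_While_iter)
  then show ?case by (auto elim: runs_mono simp del: fun_upd_apply)
qed

lemma runs_load_input:
  assumes "s = (\<lambda>_. [])(0 := map symbol x)"
  shows "runs load_input s ((\<lambda>_. [])(0 := code x)) (30 + 30 * length x)"
proof -
  define s1 where "s1 = s(1 := 3 # s 1)"
  define s2 where "s2 = (\<lambda>i. if i = 0 then tl [] else if i \<in> set [1] then rev (map symbol x) @ s1 i else s1 i)"
  define s3 where "s3 = s2(0 := 1 # s2 0)"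
  define s4 where "s4 = s3(1 := 3 # [], 0 := code (rev (rev x) @ []))"
  have 2: "runs (move_block 0 [1]) s1 s2 (3 + (5 + 3 * length [1::nat]) * length (map symbol x))"
    unfolding s2_def by (rule runs_move_block_end) (auto simp: s1_def assms symbol_def)
  have 4: "runs (While 1 {1, 2} (Ite 1 {1} (Pop 1 ;; Push 0 1 ;; Push 0 2)
       (Pop 1 ;; Push 0 1 ;; Push 0 1 ;; Push 0 2 ;; Push 0 2))) s3 s4 (1 + 16 * length (rev x))"
    unfolding s4_def by (rule load_input_loop) (auto simp: s3_def s2_def s1_def assms rev_map)
  have "s4(1 := tl (s4 1)) = (\<lambda>_. [])(0 := code x)"
    by (auto simp: s4_def s3_def s2_def s1_def assms fun_eq_iff)
  moreover have "runs load_input s (s4(1 := tl (s4 1))) (30 + 30 * length x)"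
    unfolding load_input_def
    by (rule runs_mono, (rule runs_Seq runs_Push[of 1 3 s, folded s1_def] 2 runs_Push[of 0 1 s2, folded s3_def] 4
       runs_Pop)+) simp
  ultimately show ?thesis by simp
qed

lemma sz_bools: "sz (x :: bool list) \<le> 1 + 4 * length x"
proof (induction x)
  case (Cons b x)
  then show ?case using sz_bool_le[of b] by simp
qed simp

lemma class_P_ptime:
  assumes "ptime f"
  shows "{x. f x} \<in> class_P"
proof -
  obtain c p where c: "wf_com c" "implements c f (\<lambda>x. poly p (sz x))" by (rule ptimeE[OF assms])
  have "wf_com (load_input ;; c)" using c by (simp add: load_input_def move_block_def)
  then obtain M where M: "wf_tm M" "tm_tapes M = 4"
    "\<And>s t s' ts. exec (load_input ;; c) s t s' \<Longrightarrow> represents ts s \<Longrightarrow>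
       \<exists>n \<le> t. fst ((tm_step M ^^ Suc n) (tm_start M, ts)) =
         (if hd0 (s' 0) = 2 then tm_accept M else tm_reject M)"
    by (rule tm_of_com) blast
  \<comment> \<open>Loading takes at most \<open>30 + 30 * n\<close> steps on \<open>n\<close> bits;
    the other two steps are the sequencing and the verdict. The inner polynomial bounds the size of
    a list of \<open>n\<close> bits, each of which takes at most four symbols.\<close>
  define q where "q = [:32, 30:] + pcompose p [:1, 4:]"
  have "fst ((tm_step M ^^ poly q (length x)) (tm_init M x)) =
      (if x \<in> {x. f x} then tm_accept M else tm_reject M)" for x
  proof -
    let ?ts = "snd (tm_init M x)"
    let ?s = "(\<lambda>_. [])(0 := map symbol x) :: store"
    let ?r = "if f x then tm_accept M else tm_reject M"
    have r: "represents ?ts ?s"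
      by (auto simp: represents_def tm_init_def M(2) is_stack_def input_tape_def symbol_def nth_Cons split: nat.splits)
    have "runs (load_input ;; c) ?s ((\<lambda>_. [])(0 := code (f x))) (1 + (30 + 30 * length x) + poly p (sz x))"
      using implementsD[OF c(2), of "\<lambda>_. []" x "[]"] by (intro runs_Seq[OF runs_load_input[OF refl]]) simp
    then obtain t where t: "t \<le> 1 + (30 + 30 * length x) + poly p (sz x)"
        "exec (load_input ;; c) ?s t ((\<lambda>_. [])(0 := code (f x)))"
      unfolding runs_def by blast
    have hd: "(hd0 (((\<lambda>_. [])(0 := code (f x))) 0) = 2) = f x"
      by (cases "f x") simp_all
    then obtain n where n: "n \<le> t" "fst ((tm_step M ^^ Suc n) (tm_start M, ?ts)) = ?r"
      using M(3)[OF t(2) r, unfolded hd] by blast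
    have "poly p (sz x) \<le> poly (pcompose p [:1, 4:]) (length x)"
      using poly_mono_nat[OF sz_bools, of p x] by (simp add: poly_pcompose mult.commute)
    moreover have "poly q (length x) = 32 + 30 * length x + poly (pcompose p [:1, 4:]) (length x)"
      by (simp add: q_def)
    ultimately have le: "Suc n \<le> poly q (length x)" using t(1) n(1) by linarith
    define ts' where "ts' = snd ((tm_step M ^^ Suc n) (tm_start M, ?ts))"
    have ts': "(tm_step M ^^ Suc n) (tm_start M, ?ts) = (?r, ts')"
      unfolding ts'_def n(2)[symmetric] by (rule surjective_pairing)
    have init: "tm_init M x = (tm_start M, ?ts)" by (simp add: tm_init_def)
    have "(tm_step M ^^ (poly q (length x) - Suc n + Suc n)) (tm_start M, ?ts) =
        (tm_step M ^^ (poly q (length x) - Suc n)) (?r, ts')"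
      by (simp only: funpow_add o_apply ts')
    then have "(tm_step M ^^ poly q (length x)) (tm_init M x) = (tm_step M ^^ (poly q (length x) - Suc n)) (?r, ts')"
      using le init by (simp only: le_add_diff_inverse2)
    then show ?thesis by (simp add: tm_step_halted)
  qed
  then show ?thesis using M(1) unfolding class_P_def decides_in_time_def by blast
qed

section \<open>Lists and numbers in polynomial time\<close>

lemma ptime_not [ptime_intros]: "ptime P \<Longrightarrow> ptime (\<lambda>x. \<not> P x)"
proof -
  assume "ptime P"
  then have "ptime (\<lambda>x. if P x then False else True)" by (intro ptime_intros)
  moreover have "(\<lambda>x. if P x then False else True) = (\<lambda>x. \<not> P x)" by auto
  ultimately show ?thesis by simp
qed

lemma ptime_conj [ptime_intros]: "ptime P \<Longrightarrow> ptime Q \<Longrightarrow> ptime (\<lambda>x. P x \<and> Q x)"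
proof -
  assume "ptime P" "ptime Q"
  then have "ptime (\<lambda>x. if P x then Q x else False)" by (intro ptime_intros)
  moreover have "(\<lambda>x. if P x then Q x else False) = (\<lambda>x. P x \<and> Q x)" by auto
  ultimately show ?thesis by simp
qed

lemma ptime_disj [ptime_intros]: "ptime P \<Longrightarrow> ptime Q \<Longrightarrow> ptime (\<lambda>x. P x \<or> Q x)"
proof -
  assume "ptime P" "ptime Q"
  then have "ptime (\<lambda>x. if P x then True else Q x)" by (intro ptime_intros)
  moreover have "(\<lambda>x. if P x then True else Q x) = (\<lambda>x. P x \<or> Q x)" by auto
  ultimately show ?thesis by simp
qed

lemma ptime_iff [ptime_intros]: "ptime P \<Longrightarrow> ptime Q \<Longrightarrow> ptime (\<lambda>x. (P x :: bool) = Q x)"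
proof -
  assume "ptime P" "ptime Q"
  then have "ptime (\<lambda>x. if P x then Q x else \<not> Q x)" by (intro ptime_intros)
  moreover have "(\<lambda>x. if P x then Q x else \<not> Q x) = (\<lambda>x. P x = Q x)" by auto
  ultimately show ?thesis by simp
qed

lemma ptime_is_Nil [ptime_intros]: "ptime l \<Longrightarrow> ptime (\<lambda>x. l x = [])"
proof -
  assume "ptime l"
  then have "ptime (\<lambda>x. case l x of [] \<Rightarrow> True | _ # _ \<Rightarrow> False)" by (intro ptime_intros)
  moreover have "(case l x of [] \<Rightarrow> True | _ # _ \<Rightarrow> False) = (l x = [])" for x
    by (cases "l x") simp_all
  ultimately show ?thesis by (simp only:)
qed

lemma ptime_is_None [ptime_intros]: "ptime l \<Longrightarrow> ptime (\<lambda>x. l x = None)"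
proof -
  assume "ptime l"
  then have "ptime (\<lambda>x. case l x of None \<Rightarrow> True | Some _ \<Rightarrow> False)" by (intro ptime_intros)
  moreover have "(\<lambda>x. case l x of None \<Rightarrow> True | Some _ \<Rightarrow> False) = (\<lambda>x. l x = None)"
    by (auto split: option.splits)
  ultimately show ?thesis by simp
qed

lemma ptime_tl [ptime_intros]: "ptime l \<Longrightarrow> ptime (\<lambda>x. tl (l x))"
proof -
  assume "ptime l"
  then have "ptime (\<lambda>x. case l x of [] \<Rightarrow> [] | _ # ys \<Rightarrow> ys)" by (intro ptime_intros)
  then show ?thesis by (simp add: tl_def)
qed

lemma ptime_rev [ptime_intros]:
  assumes "ptime l"
  shows "ptime (\<lambda>x. rev (l x))"
proof -
  have "ptime (\<lambda>x. fold (\<lambda>a s. a # s) (l x) [])"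
    by (rule ptime_fold_increment[where b = "\<lambda>x. 1 + sz (l x)"])
      (use sz_mem in \<open>auto intro!: ptime_intros poly_bounded_Suc poly_bounded_const poly_bounded_output assms\<close>)
  then show ?thesis by (simp add: fold_Cons_rev)
qed

lemma ptime_map [ptime_intros]:
  assumes "ptime (\<lambda>z. g (fst z) (snd z))" "ptime l"
  shows "ptime (\<lambda>x. map (g x) (l x))"
proof -
  obtain b where b: "poly_bounded b" "\<And>x a. a \<in> set (l x) \<Longrightarrow> sz (g x a) \<le> b x"
    using poly_bounded_elements[OF assms] by blast
  have "ptime (\<lambda>z. (fst z, fst (snd z)))" by (intro ptime_intros)
  from ptime_comp[OF assms(1) this] have "ptime (\<lambda>z. g (fst z) (fst (snd z)))" by simp
  then have "ptime (\<lambda>x. fold (\<lambda>a s. g x a # s) (l x) [])"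
    by (intro ptime_fold_increment[where b = "\<lambda>x. 1 + b x"])
      (use b in \<open>auto intro!: ptime_intros poly_bounded_Suc poly_bounded_const assms\<close>)
  moreover have "fold (\<lambda>a s. h a # s) xs ys = rev (map h xs) @ ys" for h :: "'b \<Rightarrow> 'c" and xs ys
    by (induction xs arbitrary: ys) auto
  ultimately have "ptime (\<lambda>x. rev (map (g x) (l x)))" by simp
  then have "ptime (\<lambda>x. rev (rev (map (g x) (l x))))" by (rule ptime_rev)
  then show ?thesis by simp
qed

lemma ptime_append [ptime_intros]:
  assumes "ptime f" "ptime g"
  shows "ptime (\<lambda>x. f x @ g x)"
proof -
  have "ptime (\<lambda>x. fold (\<lambda>a s. a # s) (rev (f x)) (g x))"
    by (rule ptime_fold_increment[where b = "\<lambda>x. 1 + sz (f x)"])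
      (use sz_mem in \<open>auto intro!: ptime_intros poly_bounded_Suc poly_bounded_const poly_bounded_output assms\<close>)
  then show ?thesis by (simp add: fold_Cons_rev)
qed

lemma ptime_Bex [ptime_intros]:
  assumes "ptime (\<lambda>z. P (fst z) (snd z))" "ptime l"
  shows "ptime (\<lambda>x. \<exists>a \<in> set (l x). P x a)"
proof -
  have "ptime (\<lambda>z. (fst z, fst (snd z)))" by (intro ptime_intros)
  from ptime_comp[OF assms(1) this] have "ptime (\<lambda>z. P (fst z) (fst (snd z)))" by simp
  then have "ptime (\<lambda>x. fold (\<lambda>a s. P x a \<or> s) (l x) False)"
    by (intro ptime_fold_invariant[where b = "\<lambda>x. 3" and I = "\<lambda>_ _. True"])
      (auto intro!: ptime_intros poly_bounded_const sz_bool_le assms)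
  moreover have "fold (\<lambda>a s. Q a \<or> s) xs s = (s \<or> (\<exists>a \<in> set xs. Q a))" for Q :: "'b \<Rightarrow> bool" and xs s
    by (induction xs arbitrary: s) auto
  ultimately show ?thesis by simp
qed

lemma ptime_Ball [ptime_intros]:
  assumes "ptime (\<lambda>z. P (fst z) (snd z))" "ptime l"
  shows "ptime (\<lambda>x. \<forall>a \<in> set (l x). P x a)"
proof -
  have "ptime (\<lambda>x. \<not> (\<exists>a \<in> set (l x). \<not> P x a))" using assms by (intro ptime_intros)
  then show ?thesis by simp
qed

text \<open>Scanned from the right, an element that violates the condition deletes all that was
  collected so far, so the longest good prefix survives.\<close>

lemma ptime_takeWhile [ptime_intros]:
  assumes "ptime (\<lambda>z. P (fst z) (snd z))" "ptime l"
  shows "ptime (\<lambda>x. takeWhile (P x) (l x))"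
proof -
  have "ptime (\<lambda>z. (fst z, fst (snd z)))" by (intro ptime_intros)
  from ptime_comp[OF assms(1) this] have "ptime (\<lambda>z. P (fst z) (fst (snd z)))" by simp
  then have "ptime (\<lambda>x. fold (\<lambda>a s. if P x a then a # s else []) (rev (l x)) [])"
    by (intro ptime_fold_increment[where b = "\<lambda>x. 1 + sz (l x)"])
      (use sz_mem in \<open>auto intro!: ptime_intros poly_bounded_Suc poly_bounded_const poly_bounded_output assms
        intro: le_SucI trans_le_add2\<close>)
  moreover have "foldr (\<lambda>a s. if Q a then a # s else []) xs [] = takeWhile Q xs" for Q :: "'b \<Rightarrow> bool" and xs
    by (induction xs) auto
  ultimately show ?thesis by (simp add: foldr_conv_fold)
qed

text \<open>The list is both the clock and the initial state. A round removes the head if it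
  satisfies the condition; from the first violation on, the state does not change.\<close>

lemma ptime_dropWhile [ptime_intros]:
  assumes "ptime (\<lambda>z. P (fst z) (snd z))" "ptime l"
  shows "ptime (\<lambda>x. dropWhile (P x) (l x))"
proof -
  let ?g = "\<lambda>x a s. case s of [] \<Rightarrow> [] | y # ys \<Rightarrow> if P x y then ys else s"
  have "ptime (\<lambda>z. (fst (fst z), fst (snd z)))" by (intro ptime_intros)
  from ptime_comp[OF assms(1) this] have "ptime (\<lambda>z. P (fst (fst z)) (fst (snd z)))" by simp
  then have "ptime (\<lambda>x. fold (?g x) (l x) (l x))"
    by (intro ptime_fold_increment[where b = "\<lambda>x. 0"])
      (auto intro!: ptime_intros poly_bounded_const assms split: list.splits)
  moreover have "fold (?g x) zs xs = dropWhile (P x) xs" if "length xs \<le> length zs" for x xs and zs :: "'b list"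
    using that
  proof (induction zs arbitrary: xs)
    case (Cons z zs)
    show ?case
    proof (cases "xs = [] \<or> \<not> P x (hd xs)")
      case True
      then have fix_pt: "?g x a xs = xs" for a :: 'b by (cases xs) auto
      have "fold (?g x) as xs = xs" for as :: "'b list" by (induction as) (simp_all add: fix_pt)
      then show ?thesis using True by (cases xs) auto
    next
      case False
      then show ?thesis using Cons by (cases xs) auto
    qed
  qed simp
  ultimately show ?thesis by simp
qed

lemma fold_tl: "fold (\<lambda>_ l. tl l) xs ys = drop (length xs) ys"
  by (induction xs arbitrary: ys) (auto simp: drop_Suc)

lemma sz_tl: "sz (tl xs) \<le> sz xs"
  by (cases xs) auto

lemma ptime_drop_length [ptime_intros]:
  assumes "ptime f" "ptime g"
  shows "ptime (\<lambda>x. drop (length (f x)) (g x))"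
proof -
  have "ptime (\<lambda>x. fold (\<lambda>_ l. tl l) (f x) (g x))"
    by (rule ptime_fold_increment[where b = "\<lambda>_. 0"])
      (auto intro!: ptime_intros poly_bounded_const assms sz_tl)
  then show ?thesis by (simp add: fold_tl)
qed

section \<open>Binary arithmetic\<close>

primrec val :: "bool list \<Rightarrow> nat" where
  "val [] = 0"
| "val (b # bs) = of_bool b + 2 * val bs"

lemma bits_0 [simp]: "bits 0 = []"
  by (simp add: bits.simps)

lemma bits_pos: "0 < n \<Longrightarrow> bits n = odd n # bits (n div 2)"
  by (simp add: bits.simps[of n])

lemma bits_eq_Nil [simp]: "bits n = [] \<longleftrightarrow> n = 0"
  by (simp add: bits.simps[of n])

lemma val_bits [simp]: "val (bits n) = n"
proof (induction n rule: less_induct)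
  case (less n)
  then show ?case by (cases "n = 0") (auto simp: bits_pos odd_two_times_div_two_succ)
qed

lemma bits_val: "bits (val bs) = foldr (\<lambda>b r. if b \<or> r \<noteq> [] then b # r else []) bs []"
proof (induction bs)
  case (Cons b bs)
  have "bits (val (b # bs)) = (if b \<or> val bs \<noteq> 0 then b # bits (val bs) else [])"
    by (cases b) (auto simp: bits_pos)
  then show ?case by (simp only: foldr.simps o_apply Cons.IH[symmetric] bits_eq_Nil)
qed simp

lemma val_append: "val (xs @ ys) = val xs + 2 ^ length xs * val ys"
  by (induction xs) (auto simp: algebra_simps)

lemma less_two_power_bits: "n < 2 ^ length (bits n)"
proof (induction n rule: less_induct)
  case (less n)
  show ?case
  proof (cases "n = 0")
    case False
    then have "n div 2 < 2 ^ length (bits (n div 2))" using less by simp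
    then show ?thesis using False by (simp add: bits_pos)
  qed simp
qed

lemma length_bits_mono: "m \<le> n \<Longrightarrow> length (bits m) \<le> length (bits n)"
proof (induction n arbitrary: m rule: less_induct)
  case (less n)
  show ?case
  proof (cases "m = 0")
    case False
    then have "length (bits (m div 2)) \<le> length (bits (n div 2))"
      using less by (intro less.IH) auto
    then show ?thesis using False less.prems by (simp add: bits_pos)
  qed simp
qed

lemma sz_nat: "sz (n :: nat) = sz (bits n)"
  by (rule sz_cong) (simp add: tree_of_nat_def)

lemma length_bits_le_sz: "length (bits n) \<le> sz n"
  by (simp add: sz_nat length_le_sz)

text \<open>The size is not monotone: a digit 1 has a longer code than a digit 0, so 7 takes more
  symbols than 8. Only the number of digits is monotone, whence the factor.\<close>

lemma sz_nat_le: "(m :: nat) \<le> n \<Longrightarrow> sz m \<le> 1 + 4 * sz n"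
  using sz_bools[of "bits m"] length_bits_mono[of m n] length_bits_le_sz[of n] by (simp add: sz_nat)

lemma ptime_bits [ptime_intros]: "ptime f \<Longrightarrow> ptime (\<lambda>x. bits (f x))"
  by (erule ptime_cast) (simp add: tree_of_nat_def)

lemma ptime_val [ptime_intros]:
  assumes "ptime f"
  shows "ptime (\<lambda>x. val (f x))"
proof -
  have "ptime (\<lambda>x. fold (\<lambda>b r. if b \<or> r \<noteq> [] then b # r else []) (rev (f x)) [])"
  proof (rule ptime_fold_increment[where b = "\<lambda>_. 4"])
    show "sz (if a \<or> s \<noteq> [] then a # s else []) \<le> sz s + 4" for a s
      using sz_bool_le[of a] sz_ge_1[of s] by auto
  qed (auto intro!: ptime_intros poly_bounded_const assms)
  then show ?thesis by (rule ptime_cast) (simp add: tree_of_nat_def bits_val foldr_conv_fold)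
qed

lemma bits_div_2: "bits (n div 2) = tl (bits n)"
  by (cases "n = 0") (simp_all add: bits_pos)

lemma ptime_div_2 [ptime_intros]: "ptime f \<Longrightarrow> ptime (\<lambda>x. f x div 2 :: nat)"
  by (rule ptime_cast[OF ptime_tl[OF ptime_bits[of f]]]) (simp_all add: tree_of_nat_def bits_div_2)

lemma ptime_even [ptime_intros]: "ptime f \<Longrightarrow> ptime (\<lambda>x. even (f x :: nat))"
proof -
  assume "ptime f"
  then have "ptime (\<lambda>x. case bits (f x) of [] \<Rightarrow> True | b # _ \<Rightarrow> \<not> b)" by (intro ptime_intros)
  moreover have "(case bits n of [] \<Rightarrow> True | b # _ \<Rightarrow> \<not> b) = even n" for n
    by (cases "n = 0") (simp_all add: bits_pos)
  ultimately show ?thesis by simp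
qed

lemma sz_div_2: "sz (n div 2) \<le> sz n" for n :: nat
  using sz_tl[of "bits n"] by (simp add: sz_nat bits_div_2)

lemma fold_const_funpow: "fold (\<lambda>_. h) xs = h ^^ length xs"
  by (induction xs) (simp_all add: funpow_swap1 fun_eq_iff)

text \<open>A ripple-carry adder: the third component is the carry, the majority of three bits, and
  the nested equivalence of the parities and the carry is their exclusive disjunction. The digits of
  the sum accumulate with the most significant one in front.\<close>

definition add_step :: "nat \<times> nat \<times> bool \<times> bool list \<Rightarrow> nat \<times> nat \<times> bool \<times> bool list" where
  "add_step s = (fst s div 2, fst (snd s) div 2,
     odd (fst s) \<and> odd (fst (snd s)) \<or> fst (snd (snd s)) \<and> (odd (fst s) \<or> odd (fst (snd s))),
     ((odd (fst s) = odd (fst (snd s))) = fst (snd (snd s))) # snd (snd (snd s)))"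

lemma add_step_invariant:
  assumes "(add_step ^^ k) (a, b, False, []) = (a', b', c, ds)"
  shows "a' = a div 2 ^ k \<and> b' = b div 2 ^ k \<and> length ds = k \<and>
    val (rev ds) + 2 ^ k * (a' + b' + of_bool c) = a + b"
  using assms
proof (induction k arbitrary: a' b' c ds)
  case (Suc k)
  obtain a1 b1 c1 es where e: "(add_step ^^ k) (a, b, False, []) = (a1, b1, c1, es)"
    using prod_cases4 by blast
  note IH = Suc.IH[OF e]
  have "(a', b', c, ds) = add_step (a1, b1, c1, es)"
    using Suc.prems e by (simp only: funpow.simps o_apply)
  then have s: "a' = a1 div 2" "b' = b1 div 2" "c \<longleftrightarrow> odd a1 \<and> odd b1 \<or> c1 \<and> (odd a1 \<or> odd b1)"
    "ds = ((odd a1 = odd b1) = c1) # es"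
    unfolding add_step_def fst_conv snd_conv prod.inject by blast+
  define D S :: nat where "D = of_bool ((odd a1 = odd b1) = c1)" and "S = a' + b' + of_bool c"
  have "D + 2 * S = a1 + b1 + of_bool c1"
    unfolding s D_def S_def by (cases "odd a1"; cases "odd b1"; cases c1) (auto elim!: evenE oddE)
  moreover have "val (rev es) + 2 ^ k * (a1 + b1 + of_bool c1) = a + b" using IH by blast
  ultimately have "val (rev es) + 2 ^ k * (D + 2 * S) = a + b" by simp
  moreover have "val (rev ds) = val (rev es) + 2 ^ k * D"
    using IH by (simp add: s(4) val_append D_def)
  ultimately have "val (rev ds) + 2 ^ Suc k * S = a + b" by (simp add: algebra_simps)
  moreover have "a' = a div 2 ^ Suc k" "b' = b div 2 ^ Suc k"
    using IH s by (simp_all add: div_mult2_eq[symmetric] mult.commute)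
  ultimately show ?case
    using IH by (simp add: s(4) S_def)
qed simp

lemma ptime_add [ptime_intros]:
  assumes "ptime f" "ptime g"
  shows "ptime (\<lambda>x. f x + g x :: nat)"
proof -
  \<comment> \<open>The concatenated digits are a clock that outlasts both numbers, whichever is
    longer. Then only the carry is left, and it becomes the top digit.\<close>
  let ?r = "\<lambda>x. fold (\<lambda>_. add_step) (bits (f x) @ bits (g x)) (f x, g x, False, [])"
  have inc: "sz (add_step s) \<le> sz s + 6" for s
  proof -
    obtain a b c ds where s: "s = (a, b, c, ds)" using prod_cases4 by blast
    have "sz (a div 2, b div 2, p, q # ds) \<le> sz (a, b, c, ds) + 6" for p q :: bool
      using sz_div_2[of a] sz_div_2[of b] sz_bool_le[of p] sz_bool_le[of q] sz_ge_1[of c] by simp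
    then show ?thesis unfolding s add_step_def fst_conv snd_conv .
  qed
  have "ptime ?r"
  proof (rule ptime_fold_increment[where b = "\<lambda>_. 6"])
    show "ptime (\<lambda>z. add_step (snd (snd z)))" unfolding add_step_def by (intro ptime_intros)
  qed (intro inc ptime_intros poly_bounded_const assms)+
  then have "ptime (\<lambda>x. val (rev (fst (snd (snd (?r x))) # snd (snd (snd (?r x))))))"
    by (intro ptime_intros)
  moreover have "val (rev (fst (snd (snd (?r x))) # snd (snd (snd (?r x))))) = f x + g x" for x
  proof -
    let ?k = "length (bits (f x) @ bits (g x))"
    have r: "?r x = (add_step ^^ ?k) (f x, g x, False, [])" by (rule fun_cong[OF fold_const_funpow])
    obtain a b c ds where e: "?r x = (a, b, c, ds)" using prod_cases4 by blast
    note inv = add_step_invariant[OF e[unfolded r]]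
    have "f x < 2 ^ ?k" "g x < 2 ^ ?k"
      using less_two_power_bits[of "f x"] less_two_power_bits[of "g x"]
      by (auto elim!: order_less_le_trans intro!: power_increasing)
    then have "a = 0" "b = 0" using inv by auto
    then show ?thesis using inv unfolding e by (auto simp: val_append)
  qed
  ultimately show ?thesis by simp
qed

text \<open>Digits arrive from the least significant one on, so a later difference overrides the
  verdict of the earlier digits.\<close>

definition le_step :: "nat \<times> nat \<times> bool \<Rightarrow> nat \<times> nat \<times> bool" where
  "le_step s = (fst s div 2, fst (snd s) div 2,
     if odd (fst s) = odd (fst (snd s)) then snd (snd s) else odd (fst (snd s)))"

lemma le_step_invariant:
  assumes "(le_step ^^ k) (a, b, True) = (a', b', c)"
  shows "a' = a div 2 ^ k \<and> b' = b div 2 ^ k \<and> (a' < b' \<or> a' = b' \<and> c \<longleftrightarrow> a \<le> b)"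
  using assms
proof (induction k arbitrary: a' b' c)
  case (Suc k)
  obtain a1 b1 c1 where e: "(le_step ^^ k) (a, b, True) = (a1, b1, c1)"
    using prod_cases3 by blast
  note IH = Suc.IH[OF e]
  have "(a', b', c) = le_step (a1, b1, c1)"
    using Suc.prems e by (simp only: funpow.simps o_apply)
  then have s: "a' = a1 div 2" "b' = b1 div 2" "c = (if odd a1 = odd b1 then c1 else odd b1)"
    unfolding le_step_def fst_conv snd_conv prod.inject by blast+
  have "a' = a div 2 ^ Suc k" "b' = b div 2 ^ Suc k"
    using IH s by (simp_all add: div_mult2_eq[symmetric] mult.commute)
  moreover have "(a' < b' \<or> a' = b' \<and> c) = (a1 < b1 \<or> a1 = b1 \<and> c1)"
    unfolding s by (cases "odd a1"; cases "odd b1") (auto elim!: evenE oddE, presburger)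
  moreover have "(a1 < b1 \<or> a1 = b1 \<and> c1) = (a \<le> b)" using IH by (elim conjE)
  ultimately show ?case by (intro conjI) (assumption | simp only:)+
qed auto

lemma ptime_le [ptime_intros]:
  assumes "ptime f" "ptime g"
  shows "ptime (\<lambda>x. (f x :: nat) \<le> g x)"
proof -
  let ?r = "\<lambda>x. fold (\<lambda>_. le_step) (bits (f x) @ bits (g x)) (f x, g x, True)"
  have inc: "sz (le_step s) \<le> sz s + 2" for s
  proof -
    obtain a b c where s: "s = (a, b, c)" using prod_cases3 by blast
    have "sz (a div 2, b div 2, p) \<le> sz (a, b, c) + 2" for p :: bool
      using sz_div_2[of a] sz_div_2[of b] sz_bool_le[of p] sz_ge_1[of c] by simp
    then show ?thesis unfolding s le_step_def fst_conv snd_conv .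
  qed
  have "ptime ?r"
  proof (rule ptime_fold_increment[where b = "\<lambda>_. 2"])
    show "ptime (\<lambda>z. le_step (snd (snd z)))" unfolding le_step_def by (intro ptime_intros)
  qed (intro inc ptime_intros poly_bounded_const assms)+
  then have "ptime (\<lambda>x. snd (snd (?r x)))" by (intro ptime_intros)
  moreover have "snd (snd (?r x)) \<longleftrightarrow> f x \<le> g x" for x
  proof -
    let ?k = "length (bits (f x) @ bits (g x))"
    have r: "?r x = (le_step ^^ ?k) (f x, g x, True)" by (rule fun_cong[OF fold_const_funpow])
    obtain a b c where e: "?r x = (a, b, c)" using prod_cases3 by blast
    note inv = le_step_invariant[OF e[unfolded r]]
    have "f x < 2 ^ ?k" "g x < 2 ^ ?k"
      using less_two_power_bits[of "f x"] less_two_power_bits[of "g x"]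
      by (auto elim!: order_less_le_trans intro!: power_increasing)
    then have "a = 0" "b = 0" using inv by auto
    then show ?thesis using inv unfolding e by auto
  qed
  ultimately show ?thesis by simp
qed

lemma ptime_eq_nat [ptime_intros]:
  assumes "ptime f" "ptime g"
  shows "ptime (\<lambda>x. (f x :: nat) = g x)"
proof -
  have "ptime (\<lambda>x. f x \<le> g x \<and> g x \<le> f x)" using assms by (intro ptime_intros)
  then show ?thesis by (simp add: order.eq_iff)
qed

lemma ptime_comp2:
  "ptime (\<lambda>z. g (fst z) (snd z)) \<Longrightarrow> ptime a \<Longrightarrow> ptime b \<Longrightarrow> ptime (\<lambda>x. g (a x) (b x))"
  using ptime_comp[OF _ ptime_Pair[of a b], of "\<lambda>z. g (fst z) (snd z)"] by simp

lemma ptime_comp3: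
  "ptime (\<lambda>z. g (fst z) (fst (snd z)) (snd (snd z))) \<Longrightarrow> ptime a \<Longrightarrow> ptime b \<Longrightarrow> ptime c \<Longrightarrow>
    ptime (\<lambda>x. g (a x) (b x) (c x))"
  using ptime_comp2[of "\<lambda>a p. g a (fst p) (snd p)" a "\<lambda>x. (b x, c x)"] ptime_Pair[of b c] by simp

lemma ptime_comp4:
  "ptime (\<lambda>z. g (fst z) (fst (snd z)) (fst (snd (snd z))) (snd (snd (snd z)))) \<Longrightarrow>
    ptime a \<Longrightarrow> ptime b \<Longrightarrow> ptime c \<Longrightarrow> ptime d \<Longrightarrow> ptime (\<lambda>x. g (a x) (b x) (c x) (d x))"
  using ptime_comp3[of "\<lambda>a b p. g a b (fst p) (snd p)" a b "\<lambda>x. (c x, d x)"] ptime_Pair[of c d] by simp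

lemma ptime_comp5:
  "ptime (\<lambda>z. g (fst z) (fst (snd z)) (fst (snd (snd z))) (fst (snd (snd (snd z)))) (snd (snd (snd (snd z))))) \<Longrightarrow>
    ptime a \<Longrightarrow> ptime b \<Longrightarrow> ptime c \<Longrightarrow> ptime d \<Longrightarrow> ptime e \<Longrightarrow> ptime (\<lambda>x. g (a x) (b x) (c x) (d x) (e x))"
  using ptime_comp4[of "\<lambda>a b c p. g a b c (fst p) (snd p)" a b c "\<lambda>x. (d x, e x)"] ptime_Pair[of d e] by simp

lemma sz_list_le: "(\<And>a. a \<in> set xs \<Longrightarrow> sz a \<le> K) \<Longrightarrow> sz xs \<le> 1 + length xs * (1 + K)"
proof (induction xs)
  case (Cons a xs)
  then have "sz xs \<le> 1 + length xs * (1 + K)" "sz a \<le> K" by simp_all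
  then show ?case by simp
qed simp

lemma sz_fst: "sz (fst p) \<le> sz p" and sz_snd: "sz (snd p) \<le> sz p"
  by (cases p; simp)+

section \<open>Parsing\<close>

text \<open>The equivalence comprises soundness and completeness. Since \<open>p\<close> is a
  function, it also makes the split of a string into a code and a remainder unique.\<close>

definition is_parser :: "(bool list \<Rightarrow> ('a \<times> bool list) option) \<Rightarrow> ('a \<Rightarrow> bool list) \<Rightarrow> bool" where
  "is_parser p e \<longleftrightarrow> (\<forall>s x r. p s = Some (x, r) \<longleftrightarrow> s = e x @ r)"

definition parse_bit :: "bool list \<Rightarrow> (bool \<times> bool list) option" where
  "parse_bit s = (case s of [] \<Rightarrow> None | b # r \<Rightarrow> Some (b, r))"

lemma is_parser_bit: "is_parser parse_bit (\<lambda>b. [b])"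
  by (auto simp: is_parser_def parse_bit_def split: list.splits)

lemma ptime_parse_bit: "ptime parse_bit"
  unfolding parse_bit_def[abs_def] by (intro ptime_intros)

definition parse_pair :: "(bool list \<Rightarrow> ('a \<times> bool list) option) \<Rightarrow> (bool list \<Rightarrow> ('b \<times> bool list) option)
    \<Rightarrow> bool list \<Rightarrow> (('a \<times> 'b) \<times> bool list) option" where
  "parse_pair p q s = (case p s of None \<Rightarrow> None | Some y \<Rightarrow>
     (case q (snd y) of None \<Rightarrow> None | Some z \<Rightarrow> Some ((fst y, fst z), snd z)))"

lemma is_parser_pair:
  "is_parser p e \<Longrightarrow> is_parser q f \<Longrightarrow> is_parser (parse_pair p q) (\<lambda>(x, y). e x @ f y)"
proof -
  assume p: "is_parser p e" and q: "is_parser q f"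
  have "parse_pair p q s = Some ((x, y), r) \<longleftrightarrow> (\<exists>t. p s = Some (x, t) \<and> q t = Some (y, r))" for s x y r
    by (auto simp: parse_pair_def split: option.splits)
  then show ?thesis using p q by (simp add: is_parser_def)
qed

lemma ptime_parse_pair:
  assumes "ptime p" "ptime q"
  shows "ptime (parse_pair p q)"
  unfolding parse_pair_def[abs_def] by (intro ptime_intros assms ptime_comp[OF assms(2)])

text \<open>The flag tells that the end marker has been read. Finished and failed states are fixed
  points, so surplus rounds do no harm.\<close>

definition parse_list_step :: "(bool list \<Rightarrow> ('a \<times> bool list) option) \<Rightarrow>
    (bool \<times> 'a list \<times> bool list) option \<Rightarrow> (bool \<times> 'a list \<times> bool list) option" where
  "parse_list_step p st = (case st of None \<Rightarrow> None | Some y \<Rightarrow> if fst y then st else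
     (case snd (snd y) of [] \<Rightarrow> None | b # r \<Rightarrow>
        if b then (case p r of None \<Rightarrow> None | Some z \<Rightarrow> Some (False, fst z # fst (snd y), snd z))
        else Some (True, fst (snd y), r)))"

text \<open>Every step consumes a bit, so that the input itself can be used as a clock.\<close>

definition parse_list :: "(bool list \<Rightarrow> ('a \<times> bool list) option) \<Rightarrow> bool list \<Rightarrow> ('a list \<times> bool list) option" where
  "parse_list p s = (case fold (\<lambda>_. parse_list_step p) s (Some (False, [], s)) of None \<Rightarrow> None
     | Some y \<Rightarrow> if fst y then Some (rev (fst (snd y)), snd (snd y)) else None)"

text \<open>What was read and what remains make up the input. This yields soundness and also bounds
  the state, because the codes of the collected elements are pieces of the input.\<close>

definition parse_list_inv :: "('a \<Rightarrow> bool list) \<Rightarrow> bool list \<Rightarrow> (bool \<times> 'a list \<times> bool list) option \<Rightarrow> bool" where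
  "parse_list_inv e s st \<longleftrightarrow> (case st of None \<Rightarrow> True | Some (b, xs, r) \<Rightarrow>
     s = concat (map (\<lambda>x. True # e x) (rev xs)) @ (if b then [False] else []) @ r)"

lemma parse_list_inv_step:
  "is_parser p e \<Longrightarrow> parse_list_inv e s st \<Longrightarrow> parse_list_inv e s (parse_list_step p st)"
  unfolding parse_list_inv_def parse_list_step_def is_parser_def
  by (auto split: option.splits list.splits if_splits)

lemma parse_list_complete:
  assumes "is_parser p e"
  shows "(parse_list_step p ^^ Suc (length xs)) (Some (False, ys, enc_list e xs @ r)) = Some (True, rev xs @ ys, r)"
proof (induction xs arbitrary: ys)
  case Nil
  then show ?case by (simp add: enc_list_def parse_list_step_def)
next
  case (Cons x xs)
  have "p (e x @ enc_list e xs @ r) = Some (x, enc_list e xs @ r)"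
    using assms by (simp add: is_parser_def)
  moreover have "enc_list e (x # xs) @ r = True # e x @ enc_list e xs @ r"
    by (simp add: enc_list_def)
  ultimately have "parse_list_step p (Some (False, ys, enc_list e (x # xs) @ r)) =
      Some (False, x # ys, enc_list e xs @ r)"
    by (simp add: parse_list_step_def)
  then show ?case using Cons[of "x # ys"]
    by (simp only: funpow_Suc_right o_apply length_Cons rev.simps append_assoc append_Cons append_Nil)
qed

lemma is_parser_list:
  assumes p: "is_parser p e"
  shows "is_parser (parse_list p) (enc_list e)"
  unfolding is_parser_def
proof (intro allI iffI)
  fix s xs r assume "parse_list p s = Some (xs, r)"
  then have st: "(parse_list_step p ^^ length s) (Some (False, [], s)) = Some (True, rev xs, r)"
    by (auto simp: parse_list_def fold_const_funpow split: option.splits if_splits)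
  have "parse_list_inv e s ((parse_list_step p ^^ n) (Some (False, [], s)))" for n
    by (induction n) (simp add: parse_list_inv_def, simp add: parse_list_inv_step[OF p])
  from this[of "length s"] show "s = enc_list e xs @ r"
    unfolding st by (simp add: parse_list_inv_def enc_list_def)
next
  fix s xs r assume s: "s = enc_list e xs @ r"
  \<comment> \<open>Every element is announced by a bit, and the end marker takes one more, so the
    clock allows for all required rounds.\<close>
  have "length xs \<le> length (concat (map (\<lambda>x. True # e x) xs))" by (induction xs) auto
  then have le: "Suc (length xs) \<le> length s" using s by (simp add: enc_list_def)
  have "(parse_list_step p ^^ n) (Some (True, rev xs, r)) = Some (True, rev xs, r)" for n
    by (induction n) (simp_all add: parse_list_step_def)
  then have "(parse_list_step p ^^ (length s - Suc (length xs) + Suc (length xs))) (Some (False, [], s)) = Some (True, rev xs, r)"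
    using parse_list_complete[OF p, of xs "[]" r] unfolding s by (simp only: funpow_add o_apply append_Nil2)
  then show "parse_list p s = Some (xs, r)"
    using le by (simp only: parse_list_def fold_const_funpow le_add_diff_inverse2) simp
qed

text \<open>Applying the output bound of \<open>p\<close> round after round would compose
  polynomials without limit. The invariant avoids this by locating each element in the original
  input.\<close>

lemma ptime_parse_list:
  assumes p: "is_parser p e" "ptime p"
  shows "ptime (parse_list p)"
proof -
  obtain q where q: "\<And>s. sz (p s) \<le> poly q (sz s)"
    using poly_bounded_output[OF p(2)] by (auto simp: poly_bounded_def)
  have "ptime (\<lambda>s. fold (\<lambda>_. parse_list_step p) s (Some (False, [], s)))"
  proof (rule ptime_fold_invariant[where I = "\<lambda>s. parse_list_inv e s" and
        b = "\<lambda>s. 10 + sz s * (1 + poly q (1 + 4 * sz s)) + 4 * sz s"])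
    show "ptime (\<lambda>z. parse_list_step p (snd (snd z)))"
      unfolding parse_list_step_def by (intro ptime_intros ptime_comp[OF p(2)])
    show "poly_bounded (\<lambda>s. 10 + sz s * (1 + poly q (1 + 4 * sz s)) + 4 * sz (s :: bool list))"
      by (intro poly_bounded_intros)
    show "parse_list_inv e s (Some (False, [], s))" for s by (simp add: parse_list_inv_def)
    show "parse_list_inv e s (parse_list_step p st)" if "parse_list_inv e s st" for s st
      using parse_list_inv_step[OF p(1) that] .
    show "sz st \<le> 10 + sz s * (1 + poly q (1 + 4 * sz s)) + 4 * sz s" if inv: "parse_list_inv e s st" for s st
    proof (cases st)
      case (Some y)
      then obtain b xs r where st: "st = Some (b, xs, r)" by (cases y) auto
      have s: "s = concat (map (\<lambda>x. True # e x) (rev xs)) @ (if b then [False] else []) @ r"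
        using inv by (simp add: st parse_list_inv_def)
      have len: "length (e x) \<le> length s" if "x \<in> set xs" for x
      proof -
        have "length (True # e x) \<le> length (concat (map (\<lambda>x. True # e x) (rev xs)))"
          using that by (simp only: length_concat map_map) (rule member_le_sum_list, auto)
        then show ?thesis using s by simp
      qed
      have "sz x \<le> poly q (1 + 4 * sz s)" if "x \<in> set xs" for x
      proof -
        \<comment> \<open>On its own code alone \<open>p\<close> also returns \<open>x\<close>, so
          the output bound applies at the size of that code, which is at most linear in that of
          \<open>s\<close>.\<close>
        have "p (e x @ []) = Some (x, [])" using p(1) unfolding is_parser_def by blast
        then have "sz x \<le> poly q (sz (e x))" using q[of "e x"] by simp
        also have "sz (e x) \<le> 1 + 4 * sz s"
          using sz_bools[of "e x"] len[OF that] length_le_sz[of s] by simp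
        then have "poly q (sz (e x)) \<le> poly q (1 + 4 * sz s)" by (rule poly_mono_nat)
        finally show ?thesis .
      qed
      then have "sz xs \<le> 1 + length xs * (1 + poly q (1 + 4 * sz s))" by (rule sz_list_le)
      moreover have "length xs \<le> sz s"
      proof -
        have "length ys \<le> length (concat (map (\<lambda>x. True # e x) ys))" for ys by (induction ys) auto
        from this[of "rev xs"] have "length xs \<le> length s" using s by simp
        then show ?thesis using length_le_sz[of s] by simp
      qed
      then have "length xs * (1 + poly q (1 + 4 * sz s)) \<le> sz s * (1 + poly q (1 + 4 * sz s))"
        by (rule mult_le_mono1)
      moreover have "length r \<le> length s" unfolding s by simp
      then have "sz r \<le> 1 + 4 * sz s" using sz_bools[of r] length_le_sz[of s] by linarith
      moreover have "sz st = 4 + sz b + sz xs + sz r" by (simp add: st)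
      ultimately show ?thesis using sz_bool_le[of b] by linarith
    qed simp
  qed (intro ptime_intros)+
  then show ?thesis unfolding parse_list_def[abs_def] by (intro ptime_intros)
qed

text \<open>The fold returns the last entry, the most significant digit; the empty list, the code of
  zero, is accepted through the initial value.\<close>

definition canonical_bits :: "bool list \<Rightarrow> bool" where
  "canonical_bits bs = fold (\<lambda>b _. b) bs True"

lemma canonical_bits_iff: "canonical_bits bs \<longleftrightarrow> bits (val bs) = bs"
proof (induction bs)
  case (Cons b bs)
  have f: "fold (\<lambda>b _. b) xs y = (if xs = [] then y else fold (\<lambda>b _. b) xs True)" for xs and y :: bool
    by (cases xs) simp_all
  have "canonical_bits (b # bs) = (if bs = [] then b else canonical_bits bs)"
    using f[of bs b] by (simp add: canonical_bits_def)
  moreover have "bits (val (b # bs)) = (if b \<or> val bs \<noteq> 0 then b # bits (val bs) else [])"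
    by (cases b) (auto simp: bits_pos)
  moreover have "val bs \<noteq> 0" if "bits (val bs) = bs" "bs \<noteq> []" using that by (metis bits_0)
  ultimately show ?case using Cons by auto
qed (simp add: canonical_bits_def)

definition parse_nat :: "bool list \<Rightarrow> (nat \<times> bool list) option" where
  "parse_nat s = (case parse_list parse_bit s of None \<Rightarrow> None | Some y \<Rightarrow>
     if canonical_bits (fst y) then Some (val (fst y), snd y) else None)"

lemma is_parser_nat: "is_parser parse_nat enc_nat"
proof -
  have l: "parse_list parse_bit s = Some (bs, r) \<longleftrightarrow> s = enc_list (\<lambda>b. [b]) bs @ r" for s bs r
    using is_parser_list[OF is_parser_bit] by (simp add: is_parser_def)
  show ?thesis
    unfolding is_parser_def enc_nat_def
  proof (intro allI iffI)
    fix s n r assume "parse_nat s = Some (n, r)"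
    then obtain bs where "parse_list parse_bit s = Some (bs, r)" "canonical_bits bs" "n = val bs"
      by (auto simp: parse_nat_def split: option.splits if_splits)
    then show "s = enc_list (\<lambda>b. [b]) (bits n) @ r" by (simp add: l canonical_bits_iff)
  next
    fix s n r assume "s = enc_list (\<lambda>b. [b]) (bits n) @ r"
    then have "parse_list parse_bit s = Some (bits n, r)" by (simp add: l)
    then show "parse_nat s = Some (n, r)" by (simp add: parse_nat_def canonical_bits_iff)
  qed
qed

lemma ptime_canonical_bits: "ptime canonical_bits"
  unfolding canonical_bits_def[abs_def]
  by (rule ptime_fold_invariant[where b = "\<lambda>_. 3" and I = "\<lambda>_ _. True"])
    (intro ptime_intros poly_bounded_const TrueI sz_bool_le)+

lemma ptime_parse_nat: "ptime parse_nat"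
  unfolding parse_nat_def[abs_def]
  by (intro ptime_intros ptime_parse_list[OF is_parser_bit ptime_parse_bit] ptime_comp[OF ptime_canonical_bits])

section \<open>The decision algorithm\<close>

text \<open>If \<open>d\<close> is shifted back by \<open>t\<close> positions in a vote, then the score of \<open>c\<close> minus the score of
  \<open>d\<close> grows by \<open>t\<close>, and by one more if \<open>c\<close> is passed. Price functions are handled as the lists of their finite values.\<close>

type_synonym vote = "nat list \<times> nat list"

definition below :: "nat \<Rightarrow> nat list \<Rightarrow> nat list" where
  "below d v = tl (dropWhile (\<lambda>x. x \<noteq> d) v)"

text \<open>The length of this list is the unary representation of the sum of \<open>pos v c - 1\<close> over all
  votes \<open>v\<close>.\<close>

definition all_above :: "nat \<Rightarrow> vote list \<Rightarrow> nat list" where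
  "all_above c ws = fold (\<lambda>w s. takeWhile (\<lambda>x. x \<noteq> c) (fst w) @ s) ws []"

lemma ptime_below [ptime_intros]: "ptime a \<Longrightarrow> ptime b \<Longrightarrow> ptime (\<lambda>x. below (a x) (b x))"
  by (rule ptime_comp2) (unfold below_def, intro ptime_intros)

lemma sz_takeWhile: "sz (takeWhile P xs) \<le> sz xs"
  by (induction xs) auto

lemma ptime_all_above [ptime_intros]:
  assumes "ptime a" "ptime b"
  shows "ptime (\<lambda>x. all_above (a x) (b x))"
proof (rule ptime_comp2[OF _ assms], unfold all_above_def, rule ptime_fold_increment[where b = sz])
  show "sz (takeWhile (\<lambda>y. y \<noteq> fst x) (fst w) @ s) \<le> sz s + sz x"
    if "w \<in> set (snd x)" for x :: "nat \<times> vote list" and w s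
  proof -
    have "sz (takeWhile (\<lambda>y. y \<noteq> fst x) (fst w)) \<le> sz x"
      using that by (meson sz_takeWhile sz_mem sz_fst sz_snd le_trans)
    then show ?thesis using sz_append[of "takeWhile (\<lambda>y. y \<noteq> fst x) (fst w)" s] by linarith
  qed
qed (intro ptime_intros poly_bounded_sz)+

text \<open>A table maps a gain of \<open>c\<close> on \<open>d\<close> (its index) to the least cost at which it can be achieved
  within the budget \<open>B\<close>. All indices are offset by the sum of \<open>pos v d - 1\<close>, so that \<open>c\<close> catches up
  with \<open>d\<close> at the indices from the sum of \<open>pos v c - 1\<close> on.\<close>

type_synonym table = "nat option list"

definition cheaper :: "nat option \<Rightarrow> nat option \<Rightarrow> nat option" where
  "cheaper x y = (case x of None \<Rightarrow> y | Some a \<Rightarrow> (case y of None \<Rightarrow> x | Some b \<Rightarrow> if a \<le> b then x else y))"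

fun merge :: "table \<Rightarrow> table \<Rightarrow> table" where
  "merge [] U = U"
| "merge T [] = T"
| "merge (x # T) (y # U) = cheaper x y # merge T U"

definition merge_step :: "nat option \<Rightarrow> table \<times> table \<Rightarrow> table \<times> table" where
  "merge_step x s = (case fst s of [] \<Rightarrow> ([], x # snd s) | y # U \<Rightarrow> (U, cheaper x y # snd s))"

lemma merge_Nil [simp]: "merge T [] = T"
  by (cases T) simp_all

text \<open>Simultaneous recursion on two lists becomes a fold over the first with the unread part
  of the second in the state. What is left of the second list is appended at the end.\<close>

lemma merge_fold:
  "rev (snd (fold merge_step T (U, A))) @ fst (fold merge_step T (U, A)) = rev A @ merge T U"
proof (induction T U arbitrary: A rule: merge.induct)
  case (2 x T)
  have "fold merge_step T ([], A) = ([], rev T @ A)" for T A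
    by (induction T arbitrary: A) (simp_all add: merge_step_def)
  from this[of "x # T" A] show ?case by (simp del: fold_simps)
qed (simp_all add: merge_step_def)

lemma ptime_cheaper [ptime_intros]: "ptime a \<Longrightarrow> ptime b \<Longrightarrow> ptime (\<lambda>x. cheaper (a x) (b x))"
  by (rule ptime_comp2) (unfold cheaper_def, intro ptime_intros)

lemma ptime_merge [ptime_intros]:
  assumes "ptime a" "ptime b"
  shows "ptime (\<lambda>x. merge (a x) (b x))"
proof (rule ptime_comp2[OF _ assms])
  have "ptime (\<lambda>z :: table \<times> table. fold merge_step (fst z) (snd z, []))"
  proof (rule ptime_fold_increment[where b = "\<lambda>z. 2 + sz z"])
    show "sz (merge_step x s) \<le> sz s + (2 + sz z)" if "x \<in> set (fst z)" for x s and z :: "table \<times> table"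
    proof -
      have x: "sz x \<le> sz z" using that by (meson sz_mem sz_fst le_trans)
      have cheaper: "sz (cheaper x y) \<le> sz x + sz y" for y
        by (auto simp: cheaper_def split: option.splits)
      have "sz (merge_step x s) \<le> sz s + 1 + sz x"
      proof (cases s)
        case (Pair U A)
        then show ?thesis using cheaper[of "hd U"] by (cases U) (simp_all add: merge_step_def)
      qed
      with x show ?thesis by linarith
    qed
  qed (unfold merge_step_def, (intro ptime_intros poly_bounded_intros)+)
  then have "ptime (\<lambda>z :: table \<times> table. rev (snd (fold merge_step (fst z) (snd z, []))) @ fst (fold merge_step (fst z) (snd z, [])))"
    by (intro ptime_intros)
  then show "ptime (\<lambda>z. merge (fst z) (snd z))" by (simp add: merge_fold)
qed

text \<open>Dropping sums above the budget keeps every entry below \<open>B\<close>, so that the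
  number of digits does not grow with the number of voters.\<close>

definition add_cost :: "nat \<Rightarrow> nat \<Rightarrow> table \<Rightarrow> table" where
  "add_cost B p T =
     map (\<lambda>x. case x of None \<Rightarrow> None | Some k \<Rightarrow> if k + p \<le> B then Some (k + p) else None) T"

lemma ptime_add_cost [ptime_intros]:
  "ptime a \<Longrightarrow> ptime b \<Longrightarrow> ptime c \<Longrightarrow> ptime (\<lambda>x. add_cost (a x) (b x) (c x))"
  by (rule ptime_comp3) (unfold add_cost_def, intro ptime_intros)

text \<open>The state consists of the candidates that \<open>d\<close> can still be shifted behind, the table of the
  earlier voters with indices moved by the gain of the present shift, and the table that is being
  computed.\<close>

definition shift_step :: "nat \<Rightarrow> nat \<Rightarrow> nat \<Rightarrow> nat list \<times> table \<times> table \<Rightarrow> nat list \<times> table \<times> table" where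
  "shift_step B c p s = (tl (fst s),
     case fst s of [] \<Rightarrow> None # fst (snd s)
       | y # _ \<Rightarrow> if y = c then None # None # fst (snd s) else None # fst (snd s),
     merge (snd (snd s)) (add_cost B p (fst (snd s))))"

definition voter_step :: "nat \<Rightarrow> nat \<Rightarrow> nat \<Rightarrow> vote \<Rightarrow> table \<Rightarrow> table" where
  "voter_step B c d w T = snd (snd (fold (shift_step B c) (snd w) (below d (fst w), T, [])))"

definition final_table :: "nat \<Rightarrow> nat \<Rightarrow> nat \<Rightarrow> vote list \<Rightarrow> table" where
  "final_table B c d ws = fold (voter_step B c d) ws (map (\<lambda>_. None) (all_above d ws) @ [Some 0])"

section \<open>Sizes of the tables\<close>

definition capped :: "nat \<Rightarrow> table \<Rightarrow> bool" where
  "capped B T \<longleftrightarrow> (\<forall>k. Some k \<in> set T \<longrightarrow> k \<le> B)"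

lemma sz_capped: "capped B T \<Longrightarrow> sz T \<le> 1 + length T * (4 + 4 * sz B)"
proof -
  assume w: "capped B T"
  have "sz x \<le> 3 + 4 * sz B" if "x \<in> set T" for x
  proof (cases x)
    case (Some k)
    then have "k \<le> B" using that w by (auto simp: capped_def)
    from sz_nat_le[OF this] show ?thesis by (simp add: Some)
  qed simp
  from sz_list_le[OF this] show ?thesis by simp
qed

lemma length_merge: "length (merge T U) = max (length T) (length U)"
  by (induction T U rule: merge.induct) auto

lemma set_merge: "set (merge T U) \<subseteq> set T \<union> set U"
proof (induction T U rule: merge.induct)
  case (3 x T y U)
  have "cheaper x y \<in> {x, y}" by (auto simp: cheaper_def split: option.splits)
  then show ?case using 3 by auto
qed auto

lemma capped_merge: "capped B T \<Longrightarrow> capped B U \<Longrightarrow> capped B (merge T U)"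
  using set_merge[of T U] unfolding capped_def by blast

lemma capped_add_cost: "capped B (add_cost B p T)"
  by (auto simp: capped_def add_cost_def split: option.splits if_splits)

text \<open>A merge may replace every entry of the result, so its size is controlled by length and
  cap and not by increments. The shifted table gains at most two \<open>None\<close> entries per
  price, each worth two symbols.\<close>

lemma shift_fold_bounds:
  assumes "capped B A" "fold (shift_step B c) ps (bl, U, A) = (bl', U', A')"
  shows "sz bl' \<le> sz bl \<and> sz U' \<le> sz U + 4 * length ps \<and> length U' \<le> length U + 2 * length ps \<and>
    capped B A' \<and> length A' \<le> max (length A) (length U + 2 * length ps)"
  using assms
proof (induction ps arbitrary: bl U A)
  case (Cons p ps)
  obtain bl1 U1 A1 where 1: "shift_step B c p (bl, U, A) = (bl1, U1, A1)" using prod_cases3 by blast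
  have "capped B A1" "length A1 = max (length A) (length U)" "sz bl1 \<le> sz bl"
      "sz U1 \<le> sz U + 4" "length U1 \<le> length U + 2"
    using 1 Cons.prems(1) sz_tl[of bl]
    by (auto simp: shift_step_def length_merge add_cost_def intro!: capped_merge capped_add_cost[unfolded add_cost_def]
        split: list.splits if_splits)
  moreover have "fold (shift_step B c) ps (bl1, U1, A1) = (bl', U', A')" using Cons.prems(2) 1 by simp
  ultimately show ?case using Cons.IH[of A1 bl1 U1] by fastforce
qed simp

text \<open>Here the dynamic program becomes polynomial: table length grows with the number of
  listed prices and not with their values.\<close>

lemma voter_step_bounds:
  "capped B (voter_step B c d w T)" "length (voter_step B c d w T) \<le> length T + 2 * length (snd w)"
proof -
  obtain bl U A where "fold (shift_step B c) (snd w) (below d (fst w), T, []) = (bl, U, A)"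
    using prod_cases3 by blast
  from shift_fold_bounds[OF _ this] this
  show "capped B (voter_step B c d w T)" "length (voter_step B c d w T) \<le> length T + 2 * length (snd w)"
    by (simp_all add: voter_step_def capped_def)
qed

lemma sz_below: "sz (below d v) \<le> sz v"
proof -
  have "sz (dropWhile P v) \<le> sz v" for P by (induction v) auto
  then show ?thesis unfolding below_def by (meson sz_tl le_trans)
qed

lemma ptime_voter_step [ptime_intros]:
  assumes "ptime a" "ptime b" "ptime c" "ptime d" "ptime e"
  shows "ptime (\<lambda>x. voter_step (a x) (b x) (c x) (d x) (e x))"
proof (rule ptime_comp5[OF _ assms])
  let ?B = "fst :: nat \<times> nat \<times> nat \<times> vote \<times> table \<Rightarrow> nat" and ?c = "\<lambda>z. fst (snd z)" and
    ?d = "\<lambda>z. fst (snd (snd z))" and ?w = "\<lambda>z. fst (snd (snd (snd z)))" and ?T = "\<lambda>z. snd (snd (snd (snd z)))"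
  have "ptime (\<lambda>z. fold (shift_step (?B z) (?c z)) (snd (?w z)) (below (?d z) (fst (?w z)), ?T z, []))"
  \<comment> \<open>The parts of the state contribute \<open>sz z\<close> for the candidates,
    \<open>5 * sz z\<close> for the shifted table and, by length times entry size, the quadratic
    term for the result.\<close>
  proof (rule ptime_fold_bounded[where b = "\<lambda>z. 3 + 6 * sz z + 3 * sz z * (4 + 4 * sz z)"])
    show "sz (fold (shift_step (?B z) (?c z)) (take k (snd (?w z))) (below (?d z) (fst (?w z)), ?T z, []))
        \<le> 3 + 6 * sz z + 3 * sz z * (4 + 4 * sz z)" if k: "k \<le> length (snd (?w z))" for z k
    proof -
      obtain bl U A where f: "fold (shift_step (?B z) (?c z)) (take k (snd (?w z))) (below (?d z) (fst (?w z)), ?T z, []) = (bl, U, A)"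
        using prod_cases3 by blast
      note b = shift_fold_bounds[OF _ f, unfolded length_take min_absorb2[OF k]]
      have s: "sz (?T z) \<le> sz z" "sz (snd (?w z)) \<le> sz z" "sz (fst (?w z)) \<le> sz z" "sz (?B z) \<le> sz z"
        by (meson sz_fst sz_snd le_trans)+
      have kz: "k \<le> sz z" using k length_le_sz[of "snd (?w z)"] s(2) by linarith
      have 1: "sz bl \<le> sz z" using b s(3) sz_below[of "?d z" "fst (?w z)"] by (force simp: capped_def)
      have 2: "sz U \<le> 5 * sz z" using b s(1) kz by (force simp: capped_def)
      have "length A \<le> 3 * sz z" using b s(1) kz length_le_sz[of "?T z"] by (force simp: capped_def)
      then have "length A * (4 + 4 * sz (?B z)) \<le> 3 * sz z * (4 + 4 * sz z)"
        using s(4) by (intro mult_le_mono) simp_all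
      moreover have "capped (?B z) A" using b by (simp add: capped_def)
      ultimately have "sz A \<le> 1 + 3 * sz z * (4 + 4 * sz z)"
        using sz_capped[of "?B z" A] by linarith
      with 1 2 show ?thesis unfolding f by simp
    qed
  qed (unfold shift_step_def, (intro ptime_intros poly_bounded_intros)+)
  then show "ptime (\<lambda>z. voter_step (?B z) (?c z) (?d z) (?w z) (?T z))"
    unfolding voter_step_def by (intro ptime_intros)
qed

lemma ptime_final_table [ptime_intros]:
  assumes "ptime a" "ptime b" "ptime c" "ptime d"
  shows "ptime (\<lambda>x. final_table (a x) (b x) (c x) (d x))"
proof (rule ptime_comp4[OF _ assms], unfold final_table_def)
  let ?B = "fst :: nat \<times> nat \<times> nat \<times> vote list \<Rightarrow> nat" and ?c = "\<lambda>z. fst (snd z)" and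
    ?d = "\<lambda>z. fst (snd (snd z))" and ?ws = "\<lambda>z. snd (snd (snd z))"
  let ?T0 = "\<lambda>z. map (\<lambda>_. None) (all_above (?d z) (?ws z)) @ [Some 0]"
  have T0: "ptime ?T0" by (intro ptime_intros)
  show "ptime (\<lambda>z. fold (voter_step (?B z) (?c z) (?d z)) (?ws z) (?T0 z))"
  proof (rule ptime_fold_bounded[where b = "\<lambda>z. 1 + (sz (?T0 z) + sz z * (2 * sz z)) * (4 + 4 * sz z)"])
    show "ptime ?T0" by (rule T0)
    show "poly_bounded (\<lambda>z. 1 + (sz (?T0 z) + sz z * (2 * sz z)) * (4 + 4 * sz z))"
      using poly_bounded_output[OF T0] by (intro poly_bounded_intros)
    show "sz (fold (voter_step (?B z) (?c z) (?d z)) (take k (?ws z)) (?T0 z))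
        \<le> 1 + (sz (?T0 z) + sz z * (2 * sz z)) * (4 + 4 * sz z)" if k: "k \<le> length (?ws z)" for z k
    proof -
      have loop: "capped (?B z) (fold (voter_step (?B z) (?c z) (?d z)) ws T) \<and>
        length (fold (voter_step (?B z) (?c z) (?d z)) ws T) \<le> length T + length ws * (2 * sz z)"
        if "capped (?B z) T" "set ws \<subseteq> set (?ws z)" for ws T
        using that
      proof (induction ws arbitrary: T)
        case (Cons w ws)
        have "length (snd w) \<le> sz (snd w)" by (rule length_le_sz)
        also have "\<dots> \<le> sz z"
          using Cons.prems(2) by (meson sz_snd sz_mem le_trans list.set_intros(1) subsetD)
        finally have "length (voter_step (?B z) (?c z) (?d z) w T) \<le> length T + 2 * sz z"
          using voter_step_bounds(2)[of "?B z" "?c z" "?d z" w T] by linarith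
        then show ?case
          using Cons.IH[of "voter_step (?B z) (?c z) (?d z) w T"] voter_step_bounds(1) Cons.prems(2) by fastforce
      qed simp
      let ?F = "fold (voter_step (?B z) (?c z) (?d z)) (take k (?ws z)) (?T0 z)"
      have T: "capped (?B z) ?F" "length ?F \<le> length (?T0 z) + k * (2 * sz z)"
        using loop[of "?T0 z" "take k (?ws z)"] k by (auto simp: capped_def set_take_subset min_absorb2)
      have s: "sz (?ws z) \<le> sz z" "sz (?B z) \<le> sz z" by (meson sz_fst sz_snd le_trans)+
      have "k * (2 * sz z) \<le> sz z * (2 * sz z)"
        using k length_le_sz[of "?ws z"] s(1) by (intro mult_le_mono1) linarith
      then have "length ?F \<le> sz (?T0 z) + sz z * (2 * sz z)"
        by (rule order_trans[OF T(2) add_mono[OF length_le_sz]])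
      then have "length ?F * (4 + 4 * sz (?B z)) \<le> (sz (?T0 z) + sz z * (2 * sz z)) * (4 + 4 * sz z)"
        using s(2) by (intro mult_le_mono) simp_all
      then show ?thesis by (rule order_trans[OF sz_capped[OF T(1)] add_left_mono])
    qed
  qed (intro ptime_intros)+
qed

definition beatable :: "nat \<Rightarrow> nat \<Rightarrow> nat \<Rightarrow> vote list \<Rightarrow> bool" where
  "beatable B c d ws \<longleftrightarrow> (\<exists>x \<in> set (drop (length (all_above c ws)) (final_table B c d ws)). x \<noteq> None)"

text \<open>Without voters all scores are zero and any second candidate is a rival, but
  \<open>m\<close> may then be exponential in the input length; hence a comparison instead of a
  search. With voters, a ranking supplies the candidates.\<close>

definition solvable :: "nat \<Rightarrow> nat \<Rightarrow> nat \<Rightarrow> vote list \<Rightarrow> bool" where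
  "solvable m d B ws \<longleftrightarrow> (case ws of [] \<Rightarrow> 2 \<le> m
     | w # _ \<Rightarrow> \<exists>c \<in> set (fst w). c \<noteq> d \<and> beatable B c d ws)"

lemma ptime_beatable [ptime_intros]:
  "ptime a \<Longrightarrow> ptime b \<Longrightarrow> ptime c \<Longrightarrow> ptime d \<Longrightarrow> ptime (\<lambda>x. beatable (a x) (b x) (c x) (d x))"
  by (rule ptime_comp4) (unfold beatable_def, intro ptime_intros)

lemma ptime_solvable [ptime_intros]:
  "ptime a \<Longrightarrow> ptime b \<Longrightarrow> ptime c \<Longrightarrow> ptime d \<Longrightarrow> ptime (\<lambda>x. solvable (a x) (b x) (c x) (d x))"
  by (rule ptime_comp4) (unfold solvable_def, intro ptime_intros)

section \<open>Recognising well-formed instances\<close>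

definition count_up :: "nat list \<Rightarrow> nat \<times> nat list" where
  "count_up v = fold (\<lambda>_ s. (fst s + 1, (fst s + 1) # snd s)) v (0, [])"

text \<open>Counting up to the length of \<open>v\<close> avoids listing \<open>{1..m}\<close> for a
  huge \<open>m\<close>. Membership is phrased as a bounded quantifier to fit the closure
  rules.\<close>

definition valid_ranking :: "nat \<Rightarrow> nat list \<Rightarrow> bool" where
  "valid_ranking m v \<longleftrightarrow> fst (count_up v) = m \<and> (\<forall>i \<in> set (snd (count_up v)). \<exists>j \<in> set v. j = i)"

definition sorted_prices :: "nat list \<Rightarrow> bool" where
  "sorted_prices ps = snd (fold (\<lambda>p s. (p, snd s \<and> fst s \<le> p)) ps (0, True))"

text \<open>The leading zero is the price of not shifting, hence the tail; dropping compares two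
  lengths in unary, so that there is at most one further price per candidate below
  \<open>d\<close>.\<close>

definition valid_prices :: "nat \<Rightarrow> nat list \<Rightarrow> nat list \<Rightarrow> bool" where
  "valid_prices d v ps \<longleftrightarrow> (case ps of [] \<Rightarrow> False | p # _ \<Rightarrow> p = 0) \<and> sorted_prices ps \<and>
     drop (length (below d v)) (tl ps) = []"

definition valid_instance :: "nat \<Rightarrow> nat \<Rightarrow> vote list \<Rightarrow> bool" where
  "valid_instance m d ws \<longleftrightarrow> 1 \<le> d \<and> d \<le> m \<and>
     (\<forall>w \<in> set ws. valid_ranking m (fst w) \<and> valid_prices d (fst w) (snd w))"

lemma count_up: "fst (count_up v) = length v" "length (snd (count_up v)) = length v"
  "set (snd (count_up v)) = {1..length v}"
proof -
  have "fold (\<lambda>_ s. (fst s + 1, (fst s + 1) # snd s)) v (k, l) = (k + length v, rev [Suc k..<Suc (k + length v)] @ l)" for k l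
    by (induction v arbitrary: k l) (simp_all add: upt_conv_Cons del: upt_Suc)
  then have "count_up v = (length v, rev [1..<Suc (length v)])" by (simp add: count_up_def del: upt_Suc)
  then show "fst (count_up v) = length v" "length (snd (count_up v)) = length v"
    "set (snd (count_up v)) = {1..length v}"
    by (simp_all add: atLeastLessThanSuc_atLeastAtMost del: upt_Suc)
qed

lemma sz_nat_le_self: "sz n \<le> 1 + 4 * n"
proof -
  have "length (bits n) \<le> n"
  proof (induction n rule: less_induct)
    case (less n)
    show ?case
    proof (cases "n = 0")
      case False
      then show ?thesis using less[of "n div 2"] by (simp add: bits_pos)
    qed simp
  qed
  then show ?thesis using sz_bools[of "bits n"] by (simp add: sz_nat)
qed

lemma ptime_count_up: "ptime count_up"
  unfolding count_up_def[abs_def]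
proof (rule ptime_fold_bounded[where b = "\<lambda>v. 3 + 4 * sz v + sz v * (2 + 4 * sz v)"])
  show "sz (fold (\<lambda>_ s. (fst s + 1, (fst s + 1) # snd s)) (take k v) (0 :: nat, [])) \<le> 3 + 4 * sz v + sz v * (2 + 4 * sz v)"
    if "k \<le> length v" for v :: "nat list" and k
  proof -
    have k: "k \<le> sz v" using that length_le_sz[of v] by linarith
    have l: "length (take k v) = k" using that by simp
    have el: "sz a \<le> 1 + 4 * sz v" if "a \<le> k" for a using sz_nat_le_self[of a] that k by linarith
    have "sz (snd (count_up (take k v))) \<le> 1 + length (snd (count_up (take k v))) * (1 + (1 + 4 * sz v))"
      by (rule sz_list_le) (use el in \<open>auto simp: count_up l\<close>)
    also have "\<dots> \<le> 1 + sz v * (1 + (1 + 4 * sz v))" using k by (simp add: count_up l del: mult_Suc_right)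
    finally have "sz (count_up (take k v)) \<le> 3 + 4 * sz v + sz v * (2 + 4 * sz v)"
      using el[of k] count_up(1)[of "take k v"] by (cases "count_up (take k v)") (simp add: l min_absorb2[OF that])
    then show ?thesis by (simp only: count_up_def)
  qed
qed (intro ptime_intros poly_bounded_intros)+

lemma ptime_valid_ranking [ptime_intros]: "ptime a \<Longrightarrow> ptime b \<Longrightarrow> ptime (\<lambda>x. valid_ranking (a x) (b x))"
  by (rule ptime_comp2) (unfold valid_ranking_def, intro ptime_intros ptime_comp[OF ptime_count_up])

lemma ptime_sorted_prices: "ptime sorted_prices"
proof -
  have "ptime (\<lambda>ps. fold (\<lambda>p s. (p, snd s \<and> fst s \<le> p)) ps (0 :: nat, True))"
  proof (rule ptime_fold_increment[where b = "\<lambda>ps. 4 + sz ps"])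
    show "sz (p, snd s \<and> fst s \<le> p) \<le> sz s + (4 + sz ps)" if "p \<in> set ps" for p ps and s :: "nat \<times> bool"
      using sz_mem[OF that] sz_bool_le[of "snd s \<and> fst s \<le> p"] by simp
  qed (intro ptime_intros poly_bounded_intros)+
  then show ?thesis unfolding sorted_prices_def[abs_def] by (rule ptime_snd)
qed

lemma ptime_valid_prices [ptime_intros]:
  "ptime a \<Longrightarrow> ptime b \<Longrightarrow> ptime c \<Longrightarrow> ptime (\<lambda>x. valid_prices (a x) (b x) (c x))"
  by (rule ptime_comp3) (unfold valid_prices_def, intro ptime_intros ptime_comp[OF ptime_sorted_prices])

lemma ptime_valid_instance [ptime_intros]:
  "ptime a \<Longrightarrow> ptime b \<Longrightarrow> ptime c \<Longrightarrow> ptime (\<lambda>x. valid_instance (a x) (b x) (c x))"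
  by (rule ptime_comp3) (unfold valid_instance_def, intro ptime_intros)

definition parse_instance :: "bool list \<Rightarrow> ((nat \<times> nat \<times> nat \<times> vote list) \<times> bool list) option" where
  "parse_instance = parse_pair parse_nat (parse_pair parse_nat (parse_pair parse_nat
     (parse_list (parse_pair (parse_list parse_nat) (parse_list parse_nat)))))"

definition decide :: "bool list \<Rightarrow> bool" where
  "decide s = (case parse_instance s of None \<Rightarrow> False | Some y \<Rightarrow> snd y = [] \<and>
     valid_instance (fst (fst y)) (fst (snd (fst y))) (snd (snd (snd (fst y)))) \<and>
     solvable (fst (fst y)) (fst (snd (fst y))) (fst (snd (snd (fst y)))) (snd (snd (snd (fst y)))))"

lemma ptime_decide: "ptime decide"
proof -
  have "ptime parse_instance"
    unfolding parse_instance_def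
    by (intro ptime_parse_pair ptime_parse_nat ptime_parse_list[OF is_parser_nat]
        ptime_parse_list[OF is_parser_pair[OF is_parser_list is_parser_list, OF is_parser_nat is_parser_nat]])
  then show ?thesis unfolding decide_def[abs_def] by (intro ptime_intros)
qed

lemma decide_iff:
  "decide s \<longleftrightarrow> (\<exists>m d B ws. s = enc_nat m @ enc_nat d @ enc_nat B @
      enc_list (\<lambda>(v, ps). enc_list enc_nat v @ enc_list enc_nat ps) ws \<and>
    valid_instance m d ws \<and> solvable m d B ws)"
proof -
  let ?e = "\<lambda>(m, d, B, ws). enc_nat m @ enc_nat d @ enc_nat B @
      enc_list (\<lambda>(v, ps). enc_list enc_nat v @ enc_list enc_nat ps) ws"
  have "is_parser parse_instance (\<lambda>(m, y). enc_nat m @ (\<lambda>(d, y). enc_nat d @ (\<lambda>(B, ws). enc_nat B @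
      enc_list (\<lambda>(v, ps). enc_list enc_nat v @ enc_list enc_nat ps) ws) y) y)"
    unfolding parse_instance_def
    by (rule is_parser_pair[OF is_parser_nat is_parser_pair[OF is_parser_nat is_parser_pair[OF is_parser_nat
        is_parser_list[OF is_parser_pair[OF is_parser_list[OF is_parser_nat] is_parser_list[OF is_parser_nat]]]]]])
  then have i: "parse_instance s = Some ((m, d, B, ws), r) \<longleftrightarrow> s = enc_nat m @ enc_nat d @ enc_nat B @
      enc_list (\<lambda>(v, ps). enc_list enc_nat v @ enc_list enc_nat ps) ws @ r" for m d B ws r
    by (simp add: is_parser_def)
  have "decide s \<longleftrightarrow> (\<exists>m d B ws. parse_instance s = Some ((m, d, B, ws), []) \<and>
      valid_instance m d ws \<and> solvable m d B ws)"
  proof (cases "parse_instance s")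
    case (Some y)
    obtain m d B ws r where "y = ((m, d, B, ws), r)" by (cases y) auto
    then show ?thesis using Some by (auto simp: decide_def)
  qed (simp add: decide_def)
  then show ?thesis by (simp only: i append_Nil2)
qed

section \<open>Correctness of the algorithm\<close>

subsection \<open>The dynamic program\<close>

definition lookup :: "table \<Rightarrow> nat \<Rightarrow> nat option" where
  "lookup T g = (if g < length T then T ! g else None)"

lemma lookup_simps [simp]:
  "lookup [] g = None" "lookup (x # T) 0 = x" "lookup (x # T) (Suc g) = lookup T g"
  by (simp_all add: lookup_def)

lemma lookup_merge: "lookup (merge T U) g = cheaper (lookup T g) (lookup U g)"
proof (induction T U arbitrary: g rule: merge.induct)
  case (3 x T y U)
  then show ?case by (cases g) simp_all
qed (auto simp: cheaper_def split: option.splits)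

lemma lookup_add_cost:
  "lookup (add_cost B p T) g =
    (case lookup T g of None \<Rightarrow> None | Some k \<Rightarrow> if k + p \<le> B then Some (k + p) else None)"
  by (simp add: lookup_def add_cost_def)

text \<open>Here \<open>A\<close> is a set of pairs of gain and cost. Every entry is realised, and
  every affordable pair is matched at no greater cost, so entries are minima. In this form unions
  and images of \<open>A\<close> correspond directly to operations on tables.\<close>

definition tabulates :: "nat \<Rightarrow> table \<Rightarrow> (nat \<times> nat) set \<Rightarrow> bool" where
  "tabulates B T A \<longleftrightarrow> (\<forall>g k. lookup T g = Some k \<longrightarrow> k \<le> B \<and> (g, k) \<in> A) \<and>
     (\<forall>g k. (g, k) \<in> A \<longrightarrow> k \<le> B \<longrightarrow> (\<exists>k' \<le> k. lookup T g = Some k'))"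

lemma tabulates_Nil: "tabulates B [] {}"
  by (simp add: tabulates_def)

lemma tabulates_None: "tabulates B T A \<Longrightarrow> tabulates B (None # T) ((\<lambda>(g, k). (Suc g, k)) ` A)"
  unfolding tabulates_def
proof (intro conjI allI impI)
  fix g k assume a: "(\<forall>g k. lookup T g = Some k \<longrightarrow> k \<le> B \<and> (g, k) \<in> A) \<and>
     (\<forall>g k. (g, k) \<in> A \<longrightarrow> k \<le> B \<longrightarrow> (\<exists>k' \<le> k. lookup T g = Some k'))"
  {
    assume "lookup (None # T) g = Some k"
    then show "k \<le> B" "(g, k) \<in> (\<lambda>(g, k). (Suc g, k)) ` A" using a by (cases g; force)+
  next
    assume "(g, k) \<in> (\<lambda>(g, k). (Suc g, k)) ` A" "k \<le> B"
    then show "\<exists>k' \<le> k. lookup (None # T) g = Some k'" using a by auto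
  }
qed

lemma tabulates_merge:
  assumes "tabulates B T A" "tabulates B U C"
  shows "tabulates B (merge T U) (A \<union> C)"
  unfolding tabulates_def
proof (intro conjI allI impI)
  fix g k assume "lookup (merge T U) g = Some k"
  then have "lookup T g = Some k \<or> lookup U g = Some k"
    by (auto simp: lookup_merge cheaper_def split: option.splits if_splits)
  then show "k \<le> B" "(g, k) \<in> A \<union> C" using assms unfolding tabulates_def by blast+
next
  fix g k assume "(g, k) \<in> A \<union> C" "k \<le> B"
  then have "(\<exists>k' \<le> k. lookup T g = Some k') \<or> (\<exists>k' \<le> k. lookup U g = Some k')"
    using assms unfolding tabulates_def by blast
  then show "\<exists>k' \<le> k. lookup (merge T U) g = Some k'"
    by (cases "lookup T g"; cases "lookup U g") (auto simp: lookup_merge cheaper_def)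
qed

lemma tabulates_add_cost:
  assumes "tabulates B T A"
  shows "tabulates B (add_cost B p T) ((\<lambda>(g, k). (g, k + p)) ` A)"
  unfolding tabulates_def
proof (intro conjI allI impI)
  fix g k assume "lookup (add_cost B p T) g = Some k"
  then obtain l where "lookup T g = Some l" "l + p \<le> B" "k = l + p"
    by (auto simp: lookup_add_cost split: option.splits if_splits)
  then show "k \<le> B" "(g, k) \<in> (\<lambda>(g, k). (g, k + p)) ` A"
    using assms unfolding tabulates_def by force+
next
  fix g k assume "(g, k) \<in> (\<lambda>(g, k). (g, k + p)) ` A" "k \<le> B"
  then obtain l where l: "k = l + p" "(g, l) \<in> A" "l \<le> B" by auto
  then obtain l' where "l' \<le> l" "lookup T g = Some l'" using assms unfolding tabulates_def by blast
  then show "\<exists>k' \<le> k. lookup (add_cost B p T) g = Some k'"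
    using l \<open>k \<le> B\<close> by (auto simp: lookup_add_cost)
qed

definition gain :: "nat \<Rightarrow> nat list \<Rightarrow> nat \<Rightarrow> nat" where
  "gain c bl t = t + of_bool (c \<in> set (take t bl))"

lemma gain_0 [simp]: "gain c bl 0 = 0"
  by (simp add: gain_def)

text \<open>The extra point is earned at the moment \<open>c\<close> is passed; distinctness
  prevents it from being earned again later.\<close>

lemma gain_Suc:
  "distinct bl \<Longrightarrow> gain c bl (Suc t) = Suc (of_bool (bl \<noteq> [] \<and> hd bl = c)) + gain c (tl bl) t"
proof (cases bl)
  case (Cons y ys)
  assume "distinct bl"
  then have "y \<notin> set (take t ys)" using Cons by (auto dest: in_set_takeD)
  then show ?thesis by (auto simp: Cons gain_def)
qed (simp add: gain_def)

text \<open>Performing one shift moves the pairs in \<open>A\<close> by its gain and leaves the same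
  problem for the remaining prices and the tail of \<open>bl\<close>. The initial result table is
  therefore kept arbitrary.\<close>

lemma tabulates_shift_fold:
  assumes "distinct bl" "tabulates B U A" "tabulates B T C"
  shows "tabulates B (snd (snd (fold (shift_step B c) ps (bl, U, T))))
    (C \<union> {(g + gain c bl t, k + ps ! t) | g k t. (g, k) \<in> A \<and> t < length ps})"
  using assms
proof (induction ps arbitrary: bl U T A C)
  case Nil
  then show ?case by simp
next
  case (Cons p ps)
  define e where "e = Suc (of_bool (bl \<noteq> [] \<and> hd bl = c))"
  define A' where "A' = (\<lambda>(g, k). (e + g, k)) ` A"
  obtain bl1 U1 T1 where s: "shift_step B c p (bl, U, T) = (bl1, U1, T1)" using prod_cases3 by blast
  have 1: "bl1 = tl bl" "T1 = merge T (add_cost B p U)"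
    "U1 = (if bl \<noteq> [] \<and> hd bl = c then None # None # U else None # U)"
    using s by (auto simp: shift_step_def split: list.splits)
  have "tabulates B U1 A'"
  proof (cases "bl \<noteq> [] \<and> hd bl = c")
    case True
    then show ?thesis
      using tabulates_None[OF tabulates_None[OF Cons.prems(2)]] by (simp add: 1 A'_def e_def image_image case_prod_unfold)
  next
    case False
    then have "e = Suc 0" "U1 = None # U" using 1(3) by (auto simp: e_def)
    then show ?thesis
      using tabulates_None[OF Cons.prems(2)] by (simp add: A'_def)
  qed
  moreover have "tabulates B T1 (C \<union> (\<lambda>(g, k). (g, k + p)) ` A)"
    unfolding 1 by (intro tabulates_merge tabulates_add_cost Cons.prems)
  ultimately have "tabulates B (snd (snd (fold (shift_step B c) ps (tl bl, U1, T1))))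
    ((C \<union> (\<lambda>(g, k). (g, k + p)) ` A) \<union> {(g + gain c (tl bl) t, k + ps ! t) | g k t. (g, k) \<in> A' \<and> t < length ps})"
    using Cons.prems(1) by (intro Cons.IH) (simp_all add: distinct_tl)
  moreover have "{(g + gain c bl t, k + (p # ps) ! t) | g k t. (g, k) \<in> A \<and> t < length (p # ps)} =
      (\<lambda>(g, k). (g, k + p)) ` A \<union> {(g + gain c (tl bl) t, k + ps ! t) | g k t. (g, k) \<in> A' \<and> t < length ps}"
    (is "?L = ?R")
  proof (intro set_eqI iffI)
    fix x assume "x \<in> ?L"
    then obtain g k t where x: "x = (g + gain c bl t, k + (p # ps) ! t)" "(g, k) \<in> A" "t < length (p # ps)"
      by blast
    show "x \<in> ?R"
    proof (cases t)
      case 0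
      then show ?thesis using x by force
    next
      case (Suc u)
      then have "x = ((e + g) + gain c (tl bl) u, k + ps ! u)" "(e + g, k) \<in> A'" "u < length ps"
        using x gain_Suc[OF Cons.prems(1), of c u] by (auto simp: e_def A'_def)
      then show ?thesis by blast
    qed
  next
    fix x assume "x \<in> ?R"
    then consider g k where "x = (g, k + p)" "(g, k) \<in> A"
      | g k t where "x = (e + g + gain c (tl bl) t, k + ps ! t)" "(g, k) \<in> A" "t < length ps"
      unfolding A'_def by auto
    then show "x \<in> ?L"
    proof cases
      case 1
      then have "x = (g + gain c bl 0, k + (p # ps) ! 0)" "0 < length (p # ps)" by simp_all
      then show ?thesis using 1 by blast
    next
      case 2
      then have "x = (g + gain c bl (Suc t), k + (p # ps) ! Suc t)" "Suc t < length (p # ps)"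
        using gain_Suc[OF Cons.prems(1), of c t] by (auto simp: e_def)
      then show ?thesis using 2 by blast
    qed
  qed
  ultimately show ?case using s 1(1) by (simp add: Un_assoc)
qed

definition choices :: "nat \<Rightarrow> nat \<Rightarrow> vote list \<Rightarrow> (nat \<times> nat) set \<Rightarrow> (nat \<times> nat) set" where
  "choices c d ws A = {(g + (\<Sum>i<length ws. gain c (below d (fst (ws ! i))) (t i)),
      k + (\<Sum>i<length ws. snd (ws ! i) ! t i)) | g k t.
      (g, k) \<in> A \<and> (\<forall>i<length ws. t i < length (snd (ws ! i)))}"

text \<open>The decision of the first voter is absorbed into the start set, just as the left fold
  absorbs the first voter into the table.\<close>

lemma choices_Cons: "choices c d (w # ws) A =
  choices c d ws {(g + gain c (below d (fst w)) t, k + snd w ! t) | g k t. (g, k) \<in> A \<and> t < length (snd w)}"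
  (is "?L = ?R")
proof (intro set_eqI iffI)
  fix x assume "x \<in> ?L"
  then obtain g k t where x: "(g, k) \<in> A" "\<forall>i<length (w # ws). t i < length (snd ((w # ws) ! i))"
    "x = (g + (\<Sum>i<length (w # ws). gain c (below d (fst ((w # ws) ! i))) (t i)),
      k + (\<Sum>i<length (w # ws). snd ((w # ws) ! i) ! t i))"
    unfolding choices_def by blast
  define u where "u = (\<lambda>i. t (Suc i))"
  have "t 0 < length (snd w)" "\<forall>i<length ws. u i < length (snd (ws ! i))"
    using x(2) by (auto simp: u_def)
  moreover have "x = ((g + gain c (below d (fst w)) (t 0)) + (\<Sum>i<length ws. gain c (below d (fst (ws ! i))) (u i)),
      (k + snd w ! t 0) + (\<Sum>i<length ws. snd (ws ! i) ! u i))"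
    unfolding x(3) u_def by (simp add: sum.lessThan_Suc_shift add.assoc del: sum.lessThan_Suc)
  ultimately show "x \<in> ?R" using x(1) unfolding choices_def by blast
next
  fix x assume "x \<in> ?R"
  then obtain g k t u where x: "(g, k) \<in> A" "t < length (snd w)" "\<forall>i<length ws. u i < length (snd (ws ! i))"
    "x = ((g + gain c (below d (fst w)) t) + (\<Sum>i<length ws. gain c (below d (fst (ws ! i))) (u i)),
      (k + snd w ! t) + (\<Sum>i<length ws. snd (ws ! i) ! u i))"
    unfolding choices_def by blast
  define v where "v = case_nat t u"
  have "\<forall>i<length (w # ws). v i < length (snd ((w # ws) ! i))"
    using x by (auto simp: v_def less_Suc_eq_0_disj)
  moreover have "x = (g + (\<Sum>i<length (w # ws). gain c (below d (fst ((w # ws) ! i))) (v i)),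
      k + (\<Sum>i<length (w # ws). snd ((w # ws) ! i) ! v i))"
    unfolding x(4) v_def by (simp add: sum.lessThan_Suc_shift add.assoc del: sum.lessThan_Suc)
  ultimately show "x \<in> ?L" using x(1) unfolding choices_def by blast
qed

lemma distinct_below: "distinct v \<Longrightarrow> distinct (below d v)"
  by (simp add: below_def distinct_tl)

lemma tabulates_voter_fold:
  assumes "\<forall>w \<in> set ws. distinct (fst w)" "tabulates B T A"
  shows "tabulates B (fold (voter_step B c d) ws T) (choices c d ws A)"
  using assms
proof (induction ws arbitrary: T A)
  case Nil
  then show ?case by (simp add: choices_def)
next
  case (Cons w ws)
  have "tabulates B (voter_step B c d w T)
    ({} \<union> {(g + gain c (below d (fst w)) t, k + snd w ! t) | g k t. (g, k) \<in> A \<and> t < length (snd w)})"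
    unfolding voter_step_def
    by (intro tabulates_shift_fold tabulates_Nil distinct_below) (use Cons.prems in auto)
  then show ?case using Cons unfolding choices_Cons by simp
qed

lemma beatable_iff:
  assumes "\<forall>w \<in> set ws. distinct (fst w)"
  shows "beatable B c d ws \<longleftrightarrow> (\<exists>t. (\<forall>i<length ws. t i < length (snd (ws ! i))) \<and>
    (\<Sum>i<length ws. snd (ws ! i) ! t i) \<le> B \<and>
    length (all_above c ws) \<le> length (all_above d ws) +
      (\<Sum>i<length ws. gain c (below d (fst (ws ! i))) (t i)))"
proof -
  let ?a = "length (all_above d ws)" and ?b = "length (all_above c ws)" and ?T = "final_table B c d ws"
  have "lookup (map (\<lambda>_. None) xs @ [Some 0]) g = (if g = length xs then Some 0 else None)" for xs :: "nat list" and g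
    by (auto simp: lookup_def nth_append)
  then have "tabulates B (map (\<lambda>_. None) (all_above d ws) @ [Some 0]) {(?a, 0)}"
    by (auto simp: tabulates_def)
  then have T: "tabulates B ?T (choices c d ws {(?a, 0)})"
    unfolding final_table_def by (rule tabulates_voter_fold[OF assms])
  have "beatable B c d ws \<longleftrightarrow> (\<exists>g k. ?b \<le> g \<and> lookup ?T g = Some k)"
  proof
    assume "beatable B c d ws"
    then obtain x i where "i < length (drop ?b ?T)" "drop ?b ?T ! i = x" "x \<noteq> None"
      unfolding beatable_def by (auto simp: in_set_conv_nth)
    then show "\<exists>g k. ?b \<le> g \<and> lookup ?T g = Some k"
      by (intro exI[of _ "?b + i"] exI[of _ "the x"]) (auto simp: lookup_def)
  next
    assume "\<exists>g k. ?b \<le> g \<and> lookup ?T g = Some k"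
    then obtain g k where g: "?b \<le> g" "g < length ?T" "?T ! g = Some k"
      by (auto simp: lookup_def split: if_splits)
    then have "drop ?b ?T ! (g - ?b) = Some k" "g - ?b < length (drop ?b ?T)" by auto
    then have "Some k \<in> set (drop ?b ?T)" by (metis nth_mem)
    then show "beatable B c d ws" unfolding beatable_def by blast
  qed
  \<comment> \<open>Only existence matters: an entry stands for an affordable choice, and every
    affordable choice has an entry at its gain.\<close>
  also have "\<dots> \<longleftrightarrow> (\<exists>g k. ?b \<le> g \<and> k \<le> B \<and> (g, k) \<in> choices c d ws {(?a, 0)})"
    using T unfolding tabulates_def by blast
  also have "\<dots> \<longleftrightarrow> (\<exists>t. (\<forall>i<length ws. t i < length (snd (ws ! i))) \<and>
    (\<Sum>i<length ws. snd (ws ! i) ! t i) \<le> B \<and>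
    ?b \<le> ?a + (\<Sum>i<length ws. gain c (below d (fst (ws ! i))) (t i)))"
    unfolding choices_def by auto
  finally show ?thesis .
qed

subsection \<open>Price lists and rankings\<close>

definition price_fun :: "nat list \<Rightarrow> nat \<Rightarrow> enat" where
  "price_fun ps i = (if i < length ps then enat (ps ! i) else \<infinity>)"

lemma sorted_prices_iff: "sorted_prices ps \<longleftrightarrow> sorted ps"
proof -
  have "snd (fold (\<lambda>p s. (p, snd s \<and> fst s \<le> p)) ps (q, b)) \<longleftrightarrow> b \<and> sorted (q # ps)" for q b
  proof (induction ps arbitrary: q b)
    case (Cons p ps)
    then show ?case by (auto intro: order_trans)
  qed simp
  then show ?thesis by (simp add: sorted_prices_def)
qed

text \<open>By the pigeonhole principle a list of length \<open>m\<close> that covers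
  \<open>m\<close> values has neither repetitions nor further elements, so one inclusion
  suffices.\<close>

lemma valid_ranking_iff: "valid_ranking m v \<longleftrightarrow> is_ranking {1..m} v"
proof -
  have "valid_ranking m v \<longleftrightarrow> length v = m \<and> {1..m} \<subseteq> set v"
    by (auto simp: valid_ranking_def count_up)
  also have "\<dots> \<longleftrightarrow> is_ranking {1..m} v"
  proof
    assume a: "length v = m \<and> {1..m} \<subseteq> set v"
    then have "card {1..m} \<le> card (set v)" by (intro card_mono) auto
    then have "card (set v) = length v" using a card_length[of v] by simp
    moreover from this have "{1..m} = set v" using a by (intro card_subset_eq) auto
    ultimately show "is_ranking {1..m} v" by (simp add: is_ranking_def card_distinct)
  next
    assume "is_ranking {1..m} v"
    then show "length v = m \<and> {1..m} \<subseteq> set v"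
      unfolding is_ranking_def using distinct_card[of v] by auto
  qed
  finally show ?thesis .
qed

lemma pos_below:
  assumes "d \<in> set v"
  shows "pos v d + length (below d v) = length v"
proof -
  have "length (takeWhile (\<lambda>x. x \<noteq> d) v) + length (dropWhile (\<lambda>x. x \<noteq> d) v) = length v"
    by (metis length_append takeWhile_dropWhile_id)
  moreover have "dropWhile (\<lambda>x. x \<noteq> d) v \<noteq> []" using assms by (simp add: dropWhile_eq_Nil_conv)
  then have "0 < length (dropWhile (\<lambda>x. x \<noteq> d) v)" by blast
  moreover have "length (below d v) = length (dropWhile (\<lambda>x. x \<noteq> d) v) - 1" by (simp add: below_def)
  ultimately show ?thesis unfolding pos_def by linarith
qed

lemma valid_prices_iff:
  assumes "is_ranking {1..m} v" "d \<in> {1..m}"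
  shows "valid_prices d v ps \<longleftrightarrow> is_price_function {1..m} d v (price_fun ps)"
proof -
  have "length v = m" using assms(1) distinct_card[of v] by (simp add: is_ranking_def)
  moreover have "d \<in> set v" using assms by (simp add: is_ranking_def)
  ultimately have N: "card {1..m} - pos v d = length (below d v)"
    using pos_below[of d v] by simp
  have valid: "valid_prices d v ps \<longleftrightarrow> ps \<noteq> [] \<and> ps ! 0 = 0 \<and> sorted ps \<and> length ps \<le> Suc (length (below d v))"
    by (cases ps) (auto simp: valid_prices_def sorted_prices_iff)
  show ?thesis
    unfolding valid is_price_function_def N
  proof (intro iffI conjI allI impI)
    assume v: "ps \<noteq> [] \<and> ps ! 0 = 0 \<and> sorted ps \<and> length ps \<le> Suc (length (below d v))"
    show "price_fun ps 0 = 0" using v by (simp add: price_fun_def zero_enat_def)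
    show "price_fun ps i \<le> price_fun ps i'" if "i < i' \<and> i' \<le> length (below d v)" for i i'
      using that v by (auto simp: price_fun_def sorted_nth_mono)
    show "price_fun ps i = \<infinity>" if "length (below d v) < i" for i
      using that v by (auto simp: price_fun_def)
  next
    assume p: "price_fun ps 0 = 0 \<and>
      (\<forall>i i'. i < i' \<and> i' \<le> length (below d v) \<longrightarrow> price_fun ps i \<le> price_fun ps i') \<and>
      (\<forall>i > length (below d v). price_fun ps i = \<infinity>)"
    then have 0: "price_fun ps 0 = 0" by blast
    then show "ps \<noteq> []" "ps ! 0 = 0" by (auto simp: price_fun_def zero_enat_def split: if_splits)
    show len: "length ps \<le> Suc (length (below d v))"
    proof (rule ccontr)
      assume n: "\<not> length ps \<le> Suc (length (below d v))"
      then have "price_fun ps (Suc (length (below d v))) = \<infinity>" using p by blast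
      then show False using n by (simp add: price_fun_def)
    qed
    have "ps ! i \<le> ps ! j" if "i < j" "j < length ps" for i j
    proof -
      have "price_fun ps i \<le> price_fun ps j" using p that len by auto
      then show ?thesis using that by (simp add: price_fun_def)
    qed
    then show "sorted ps" by (simp add: sorted_wrt_iff_nth_less)
  qed
qed

text \<open>Monotonicity carries the first infinite price \<open>n\<close> to all later attainable
  shifts, and beyond these prices are infinite anyway. So the finite values form an initial segment,
  which a list can hold.\<close>

lemma price_fun_surj:
  assumes "is_price_function C d v \<rho>"
  shows "\<exists>ps. \<rho> = price_fun ps"
proof -
  define n where "n = (LEAST i. \<rho> i = \<infinity>)"
  have n: "\<rho> n = \<infinity>"
    unfolding n_def by (rule LeastI[of _ "Suc (card C - pos v d)"]) (use assms in \<open>simp add: is_price_function_def\<close>)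
  have "\<rho> i \<noteq> \<infinity>" if "i < n" for i
    using not_less_Least that unfolding n_def by blast
  then have fin: "\<rho> i = enat (the_enat (\<rho> i))" if "i < n" for i using that by fastforce
  have inf: "\<rho> i = \<infinity>" if "n \<le> i" for i
  proof (cases "i = n \<or> card C - pos v d < i")
    case True
    then show ?thesis using n assms unfolding is_price_function_def by blast
  next
    case False
    then have "\<rho> n \<le> \<rho> i" using that assms unfolding is_price_function_def by auto
    then show ?thesis using n by simp
  qed
  have "\<rho> = price_fun (map (\<lambda>i. the_enat (\<rho> i)) [0..<n])"
    using fin inf by (auto simp: price_fun_def fun_eq_iff not_less)
  then show ?thesis by blast
qed

lemma enc_price_fun: "enc_price (price_fun ps) = enc_list enc_nat ps"
proof -
  have "{i. price_fun ps i \<noteq> \<infinity>} = {..<length ps}" by (auto simp: price_fun_def)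
  then have "sorted_list_of_set {i. price_fun ps i \<noteq> \<infinity>} = [0..<length ps]"
    by (simp add: lessThan_atLeast0)
  moreover have "map (\<lambda>i. True # enc_nat (the_enat (price_fun ps i))) [0..<length ps] = map (\<lambda>p. True # enc_nat p) ps"
    by (intro nth_equalityI) (simp_all add: price_fun_def)
  ultimately show ?thesis by (simp add: enc_price_def enc_list_def)
qed

subsection \<open>Shifts and Borda scores\<close>

lemma pos_append: "pos (xs @ ys) c = (if c \<in> set xs then pos xs c else length xs + pos ys c)"
  by (auto simp: pos_def takeWhile_append split: if_splits)

lemma pos_Cons: "pos (x # xs) c = (if x = c then 1 else Suc (pos xs c))"
  by (simp add: pos_def)

lemma split_ranking:
  assumes "d \<in> set v"
  shows "v = takeWhile (\<lambda>x. x \<noteq> d) v @ d # below d v"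
proof -
  have "dropWhile (\<lambda>x. x \<noteq> d) v \<noteq> []" using assms by (simp add: dropWhile_eq_Nil_conv)
  then have "dropWhile (\<lambda>x. x \<noteq> d) v = d # below d v"
    using hd_dropWhile[of "\<lambda>x. x \<noteq> d" v] by (cases "dropWhile (\<lambda>x. x \<noteq> d) v") (auto simp: below_def)
  then show ?thesis by (metis takeWhile_dropWhile_id)
qed

lemma pos_shift_back:
  assumes v: "is_ranking C v" "d \<in> C" "c \<in> C" "c \<noteq> d" and t: "t \<le> length (below d v)"
  shows "pos (shift_back d t v) d = pos v d + t"
    "pos (shift_back d t v) c + of_bool (c \<in> set (take t (below d v))) = pos v c"
    "set (shift_back d t v) = C" "distinct (shift_back d t v)"
proof -
  define a b where "a = takeWhile (\<lambda>x. x \<noteq> d) v" and "b = below d v"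
  have v': "v = a @ d # b"
    unfolding a_def b_def using assms by (intro split_ranking) (simp add: is_ranking_def)
  have s: "shift_back d t v = a @ take t b @ d # drop t b"
    by (simp add: shift_back_def a_def b_def below_def Let_def)
  have dist: "distinct (a @ d # take t b @ drop t b)" using v(1) v' by (simp add: is_ranking_def)
  have set: "set a \<union> insert d (set (take t b) \<union> set (drop t b)) = C"
    using v(1) v' set_append[of "take t b" "drop t b"] by (simp add: is_ranking_def)
  have b: "b = take t b @ drop t b" by simp
  have len: "length (take t b) = t" using t by (simp add: b_def)
  have d: "d \<notin> set a" "d \<notin> set (take t b)" "d \<notin> set (drop t b)" using dist by (auto dest: in_set_takeD in_set_dropD)
  show "pos (shift_back d t v) d = pos v d + t"
    unfolding s using d len by (subst v') (simp add: pos_append pos_Cons)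
  have "pos v c = pos (a @ d # take t b @ drop t b) c" using v' b by metis
  then show "pos (shift_back d t v) c + of_bool (c \<in> set (take t (below d v))) = pos v c"
    unfolding s b_def[symmetric] using v(4) dist by (auto simp: pos_append pos_Cons simp del: append_take_drop_id)
  show "set (shift_back d t v) = C" unfolding s using set by auto
  show "distinct (shift_back d t v)" unfolding s using dist by (auto simp del: append_take_drop_id)
qed

lemma pos_le: "(c :: nat) \<in> set v \<Longrightarrow> pos v c \<le> length v"
  using pos_below[of c v] by linarith

text \<open>A position is one more than the number of candidates above, whence the extra summand of
  one per vote.\<close>

lemma length_all_above: "length (all_above c ws) + length ws = (\<Sum>i<length ws. pos (fst (ws ! i)) c)"
proof -
  have "length (fold (\<lambda>w s. takeWhile (\<lambda>x. x \<noteq> c) (fst w) @ s) ws s) + length ws =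
     length s + (\<Sum>i<length ws. pos (fst (ws ! i)) c)" for s
  proof (induction ws arbitrary: s)
    case (Cons w ws)
    show ?case
      using Cons[of "takeWhile (\<lambda>x. x \<noteq> c) (fst w) @ s"]
      by (simp add: sum.lessThan_Suc_shift pos_def del: sum.lessThan_Suc)
  qed simp
  from this[of "[]"] show ?thesis by (simp add: all_above_def)
qed

text \<open>Some candidate attains the maximal score. If it is not \<open>d\<close>, it is the
  desired rival; otherwise \<open>d\<close> wins and the rival is a further winner.\<close>

lemma borda_not_unique:
  assumes "finite C" "d \<in> C"
  shows "borda (C, V) \<noteq> {d} \<longleftrightarrow> (\<exists>c \<in> C. c \<noteq> d \<and> borda_score (C, V) d \<le> borda_score (C, V) c)"
proof -
  let ?s = "borda_score (C, V)"
  obtain w where w: "w \<in> C" "\<forall>c \<in> C. ?s c \<le> ?s w"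
  proof -
    have "Max (?s ` C) \<in> ?s ` C" using assms by (intro Max_in) auto
    then obtain w where "w \<in> C" "?s w = Max (?s ` C)" by auto
    moreover from this have "\<forall>c \<in> C. ?s c \<le> ?s w" using assms(1) by simp
    ultimately show ?thesis using that by blast
  qed
  show ?thesis
  proof
    assume n: "borda (C, V) \<noteq> {d}"
    show "\<exists>c \<in> C. c \<noteq> d \<and> ?s d \<le> ?s c"
    proof (cases "w = d")
      case True
      then have "d \<in> borda (C, V)" using w by (simp add: borda_def)
      then obtain c where "c \<in> borda (C, V)" "c \<noteq> d" using n by blast
      then show ?thesis using assms(2) by (auto simp: borda_def)
    qed (use w assms(2) in blast)
  next
    assume "\<exists>c \<in> C. c \<noteq> d \<and> ?s d \<le> ?s c"
    then obtain c where c: "c \<in> C" "c \<noteq> d" "?s d \<le> ?s c" by blast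
    show "borda (C, V) \<noteq> {d}"
    proof
      assume u: "borda (C, V) = {d}"
      then have "\<forall>c' \<in> C. ?s c' \<le> ?s d" by (auto simp: borda_def)
      then have "c \<in> borda (C, V)" using c by (auto simp: borda_def intro: order_trans)
      then show False using u c(2) by simp
    qed
  qed
qed

text \<open>Written as a sum, the relation is free of truncated subtraction, and comparing scores
  turns into comparing sums of positions.\<close>

lemma borda_score_positions:
  fixes n :: nat and c :: nat
  assumes "\<forall>i<n. distinct (f i) \<and> set (f i) = C" "c \<in> C"
  shows "borda_score (C, mset (map f [0..<n])) c + (\<Sum>i<n. pos (f i) c) = n * card C"
proof -
  have "pos (f i) c \<le> card C" if "i < n" for i
    using assms that pos_le[of c "f i"] distinct_card[of "f i"] by auto
  then have "(\<Sum>i<n. card C - pos (f i) c) + (\<Sum>i<n. pos (f i) c) = (\<Sum>i<n. card C)"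
    unfolding sum.distrib[symmetric] by (intro sum.cong) auto
  moreover have "borda_score (C, mset (map f [0..<n])) c = (\<Sum>i<n. card C - pos (f i) c)"
    by (simp add: borda_score_def image_mset.compositionality comp_def lessThan_atLeast0 sum_unfold_sum_mset)
  ultimately show ?thesis by simp
qed

section \<open>Equivalence of instances and decisions\<close>

definition priced :: "vote \<Rightarrow> nat priced_voter" where
  "priced = (\<lambda>(v, ps). (v, price_fun ps))"

lemma valid_instance_iff: "valid_instance m d ws \<longleftrightarrow> is_instance {1..m} d (map priced ws)"
proof (cases "d \<in> {1..m}")
  case True
  have "valid_ranking m (fst w) \<and> valid_prices d (fst w) (snd w) \<longleftrightarrow>
      (case priced w of (v, \<rho>) \<Rightarrow> is_ranking {1..m} v \<and> is_price_function {1..m} d v \<rho>)" for w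
    by (cases w) (auto simp: priced_def valid_ranking_iff valid_prices_iff[OF _ True])
  then show ?thesis using True by (simp add: valid_instance_def is_instance_def)
qed (auto simp: valid_instance_def is_instance_def)

text \<open>A single infinite price makes the total infinite, so the budget alone forces every shift
  to have a listed price.\<close>

lemma cost_le_iff:
  fixes n :: nat
  shows "(\<Sum>i<n. price_fun (f i) (t i)) \<le> enat B \<longleftrightarrow>
    (\<forall>i<n. t i < length (f i)) \<and> (\<Sum>i<n. f i ! t i) \<le> B"
proof (cases "\<forall>i<n. t i < length (f i)")
  case True
  then have "(\<Sum>i<n. price_fun (f i) (t i)) = (\<Sum>i<n. enat (f i ! t i))"
    by (intro sum.cong) (auto simp: price_fun_def)
  also have "\<dots> = enat (\<Sum>i<n. f i ! t i)" by (induction n) (simp_all add: zero_enat_def)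
  finally show ?thesis using True by simp
next
  case False
  then obtain i where i: "i < n" "price_fun (f i) (t i) = \<infinity>" by (auto simp: price_fun_def)
  have "price_fun (f i) (t i) \<le> (\<Sum>i<n. price_fun (f i) (t i))"
    using i(1) by (intro member_le_sum) auto
  then have "(\<Sum>i<n. price_fun (f i) (t i)) = \<infinity>" using i(2) by simp
  then show ?thesis using False by simp
qed

lemma shifted_not_unique_iff:
  assumes inst: "is_instance {1..m} d (map priced ws)" and t: "\<forall>i<length ws. t i < length (snd (ws ! i))"
  shows "borda ({1..m}, mset (map (\<lambda>i. shift_back d (t i) (fst (map priced ws ! i))) [0..<length ws])) \<noteq> {d} \<longleftrightarrow>
    (\<exists>c \<in> {1..m}. c \<noteq> d \<and> length (all_above c ws) \<le> length (all_above d ws) +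
      (\<Sum>i<length ws. gain c (below d (fst (ws ! i))) (t i)))"
proof -
  let ?n = "length ws"
  define f where "f = (\<lambda>i. shift_back d (t i) (fst (ws ! i)))"
  have d: "d \<in> {1..m}" using inst by (simp add: is_instance_def)
  have val: "valid_instance m d ws" using inst by (simp add: valid_instance_iff)
  have rank: "is_ranking {1..m} (fst (ws ! i))" if "i < ?n" for i
    using val that by (auto simp: valid_instance_def valid_ranking_iff)
  have le: "t i \<le> length (below d (fst (ws ! i)))" if "i < ?n" for i
  proof -
    have "valid_prices d (fst (ws ! i)) (snd (ws ! i))" using val that by (auto simp: valid_instance_def)
    then have "length (snd (ws ! i)) \<le> Suc (length (below d (fst (ws ! i))))"
      by (cases "snd (ws ! i)") (auto simp: valid_prices_def)
    moreover have "t i < length (snd (ws ! i))" using t that by simp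
    ultimately show ?thesis by linarith
  qed
  have key: "borda_score ({1..m}, mset (map f [0..<?n])) d \<le> borda_score ({1..m}, mset (map f [0..<?n])) c \<longleftrightarrow>
      length (all_above c ws) \<le> length (all_above d ws) + (\<Sum>i<?n. gain c (below d (fst (ws ! i))) (t i))"
    if c: "c \<in> {1..m}" "c \<noteq> d" for c
  proof -
    have f: "\<forall>i<?n. distinct (f i) \<and> set (f i) = {1..m}"
      using pos_shift_back(3,4)[OF rank d c le] unfolding f_def by blast
    have "(\<Sum>i<?n. pos (f i) d) = (\<Sum>i<?n. pos (fst (ws ! i)) d) + (\<Sum>i<?n. t i)"
      unfolding sum.distrib[symmetric] f_def by (intro sum.cong pos_shift_back(1)[OF rank d c le]) auto
    moreover have "(\<Sum>i<?n. pos (f i) c) + (\<Sum>i<?n. of_bool (c \<in> set (take (t i) (below d (fst (ws ! i)))))) =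
        (\<Sum>i<?n. pos (fst (ws ! i)) c)"
      unfolding sum.distrib[symmetric] f_def by (intro sum.cong pos_shift_back(2)[OF rank d c le]) auto
    moreover have "(\<Sum>i<?n. gain c (below d (fst (ws ! i))) (t i)) =
        (\<Sum>i<?n. t i) + (\<Sum>i<?n. of_bool (c \<in> set (take (t i) (below d (fst (ws ! i))))))"
      by (simp add: gain_def sum.distrib)
    \<comment> \<open>The common total of score and positions cancels, as does the one per vote by
      which positions exceed the numbers of candidates above.\<close>
    ultimately show ?thesis
      using borda_score_positions[OF f d] borda_score_positions[OF f c(1)]
        length_all_above[of c ws] length_all_above[of d ws] by linarith
  qed
  have eq: "map (\<lambda>i. shift_back d (t i) (fst (map priced ws ! i))) [0..<?n] = map f [0..<?n]"
    by (auto simp: f_def priced_def split: prod.splits)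
  show ?thesis
    unfolding eq borda_not_unique[OF finite_atLeastAtMost d] using key by blast
qed

text \<open>The quantifiers over shifts and over rivals commute, so the shifts may be optimised for
  each rival separately, which is what its table does.\<close>

lemma yes_instance_iff:
  "is_yes_instance borda {1..m} d B (map priced ws) \<longleftrightarrow> valid_instance m d ws \<and> solvable m d B ws"
proof (cases "is_instance {1..m} d (map priced ws)")
  case True
  have val: "valid_instance m d ws" using True by (simp add: valid_instance_iff)
  have dist: "\<forall>w \<in> set ws. distinct (fst w)"
    using val by (auto simp: valid_instance_def valid_ranking_iff is_ranking_def)
  have d: "d \<in> {1..m}" using True by (simp add: is_instance_def)
  let ?sum = "\<lambda>t. \<Sum>i<length ws. price_fun (snd (ws ! i)) (t i)"
  have "(\<Sum>i<length ws. snd (map priced ws ! i) (t i)) = ?sum t" for t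
    by (intro sum.cong) (auto simp: priced_def split: prod.splits)
  then have "is_yes_instance borda {1..m} d B (map priced ws) \<longleftrightarrow>
      (\<exists>t. ?sum t \<le> enat B \<and> borda ({1..m}, mset (map (\<lambda>i. shift_back d (t i) (fst (map priced ws ! i))) [0..<length ws])) \<noteq> {d})"
    using True by (simp add: is_yes_instance_def)
  also have "\<dots> \<longleftrightarrow> (\<exists>c \<in> {1..m}. c \<noteq> d \<and> beatable B c d ws)"
    unfolding cost_le_iff beatable_iff[OF dist] using shifted_not_unique_iff[OF True] by blast
  also have "\<dots> \<longleftrightarrow> solvable m d B ws"
  proof (cases ws)
    case Nil
    have "beatable B c d []" for c
      by (simp add: beatable_iff all_above_def)
    moreover have "(\<exists>c \<in> {1..m}. c \<noteq> d) \<longleftrightarrow> 2 \<le> m"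
    proof
      assume "2 \<le> m"
      then have "(if d = 1 then 2 else 1) \<in> {1..m} \<and> (if d = 1 then 2 else 1) \<noteq> d" by auto
      then show "\<exists>c \<in> {1..m}. c \<noteq> d" by blast
    qed (use d in auto)
    ultimately show ?thesis by (simp add: Nil solvable_def)
  next
    case (Cons w ws')
    then have "set (fst w) = {1..m}"
      using val by (auto simp: valid_instance_def valid_ranking_iff is_ranking_def)
    then show ?thesis by (simp add: Cons solvable_def)
  qed
  finally show ?thesis using val by simp
qed (simp add: is_yes_instance_def valid_instance_iff)

lemma enc_instance_priced:
  "enc_instance m d B (map priced ws) = enc_nat m @ enc_nat d @ enc_nat B @
    enc_list (\<lambda>(v, ps). enc_list enc_nat v @ enc_list enc_nat ps) ws"
  by (simp add: enc_instance_def enc_list_def comp_def priced_def case_prod_unfold enc_price_fun)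

lemma instance_priced: "is_instance C d vs \<Longrightarrow> \<exists>ws. vs = map priced ws"
proof (induction vs)
  case (Cons x vs)
  obtain v \<rho> where x: "x = (v, \<rho>)" by (cases x)
  then obtain ps where "\<rho> = price_fun ps" using Cons.prems price_fun_surj by (fastforce simp: is_instance_def)
  moreover obtain ws where "vs = map priced ws" using Cons by (auto simp: is_instance_def)
  ultimately have "x # vs = map priced ((v, ps) # ws)" by (simp add: x priced_def)
  then show ?case by (rule exI)
qed simp

text \<open>Price lists lose nothing: every instance arises from a list of votes through
  \<open>priced\<close>, and both have the same code.\<close>

lemma decide_correct: "{s. decide s} = Destructive_Shift_Bribery borda"
proof (intro set_eqI iffI)
  fix s assume "s \<in> {s. decide s}"
  then obtain m d B ws where "s = enc_instance m d B (map priced ws)" "is_yes_instance borda {1..m} d B (map priced ws)"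
    unfolding mem_Collect_eq decide_iff yes_instance_iff enc_instance_priced by blast
  then show "s \<in> Destructive_Shift_Bribery borda" unfolding Destructive_Shift_Bribery_def by blast
next
  fix s assume "s \<in> Destructive_Shift_Bribery borda"
  then obtain m d B vs where s: "s = enc_instance m d B vs" "is_yes_instance borda {1..m} d B vs"
    unfolding Destructive_Shift_Bribery_def by blast
  then obtain ws where "vs = map priced ws"
    using instance_priced unfolding is_yes_instance_def by blast
  then show "s \<in> {s. decide s}"
    using s unfolding mem_Collect_eq decide_iff yes_instance_iff[symmetric] enc_instance_priced[symmetric] by blast
qed

theorem theorem2: "Destructive_Shift_Bribery borda \<in> class_P"
  using class_P_ptime[OF ptime_decide] by (simp only: decide_correct)

end
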